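(* Let $\mathbb{H}$ be the sub-Finsler Heisenberg group equipped with a $C^1$ and strongly convex norm $\|\cdot\|$ and with the Lebesgue measure $\mathscr{L}^3$. If $\mathscr{L}^1(\mathsf{Z})>0$, then $(\mathbb{H},\mathsf{d},\mathscr{L}^3)$ does not satisfy $\mathsf{MCP}(0,N)$ for any $N\in(1,\infty)$.
   Context: Fix a norm $\|\cdot\|$ on $\mathbb{R}^2$. The sub-Finsler Heisenberg group $\mathbb{H}$ is $\mathbb{R}^3$ with group law $(x,y,z)\star(x',y',z')=(x+x',y+y',z+z'+\tfrac12(xy'-x'y))$, identity $\mathrm{e}=(0,0,0)$, and left-invariant vector fields $X_1=\partial_x-\tfrac{y}{2}\partial_z$, $X_2=\partial_y+\tfrac{x}{2}\partial_z$. A curve $\gamma:[0,1]\to\mathbb{R}^3$ is admissible if it is absolutely continuous and there is $u=(u_1,u_2)\in L^2([0,1];\mathbb{R}^2)$ with $\dot\gamma(t)=u_1(t)X_1(\gamma(t))+u_2(t)X_2(\gamma(t))$ for a.e. $t$; its length is $\int_0^1\|u(t)\|\,dt$. The sub-Finsler distance $\mathsf{d}(p,q)$ is the infimum of the lengths of admissible curves from $p$ to $q$. $\mathscr{L}^3$ denotes Lebesgue measure on $\mathbb{R}^3$. A geodesic in a metric space $(X,\mathsf{d})$ is a curve $\gamma:[0,1]\to X$ with $\mathsf{d}(\gamma(s),\gamma(t))=|t-s|\,\mathsf{d}(\gamma(0),\gamma(1))$ for all $s,t\in[0,1]$. Regularity/convexity of the norm: with $f(x)=\tfrac12\|x\|^2$,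 the norm is called $C^1$ (resp. $C^2$) if it is of class $C^1$ (resp. $C^2$) on $\mathbb{R}^2\setminus\{0\}$, $C^{1,1}$ if $f$ is $C^1$ with Lipschitz gradient, strictly convex if $f$ is strictly convex, and strongly convex if there is $\alpha>0$ with $f(tx+(1-t)y)\le tf(x)+(1-t)f(y)-\tfrac{\alpha}{2}t(1-t)\|x-y\|^2$ for all $x,y\in\mathbb{R}^2$, $t\in[0,1]$. Convex trigonometry: let $\Omega=\{x:\|x\|\le1\}$ and $\Omega^\circ=\{p:\langle p,x\rangle\le1\ \forall x\in\Omega\}$ (the closed unit ball of the dual norm). For a compact convex $S\subset\mathbb{R}^2$ with $0$ in its interior, let $\pi_S$ be the area of $S$; for $\theta\in[0,2\pi_S)$ let $P^S_\theta\in\partial S$ be the point such that the region of $S$ swept counterclockwise from the ray through $(1,0)$ to the ray through $P^S_\theta$ has area $\theta/2$; extend $2\pi_S$-periodically and write $P^S_\theta=(\cos_S\theta,\sin_S\theta)$. Angles $\theta$ and $\phi$ correspond if $\cos_\Omega(\theta)\cos_{\Omega^\circ}(\phi)+\sin_\Omega(\theta)\sin_{\Omega^\circ}(\phi)=1$. $C_\circ$ is the nondecreasing (possibly multivalued) map on $\mathbb{R}$ assigning to $\phi$ the maximal closed interval of angles $\theta$ corresponding to $\phi$, normalized so that $C_\circ(\phi+2k\pi_{\Omega^\circ})=C_\circ(\phi)+2k\pi_\Omega$ for $k\in\mathbb{Z}$. For a $C^1$ strongly convex norm $C_\circ$ is single-valued and Lipschitz; $\mathsf{D}_1\subset\mathbb{R}/2\pi_{\Omega^\circ}\mathbb{Z}$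 denotes the set of angles where $C_\circ$ is differentiable, $C_\circ'$ its derivative there, and $\mathsf{Z}=\{\phi\in\mathsf{D}_1: C_\circ'(\phi)=0\}$. Measure contraction property: for $K\in\mathbb{R}$, $N\in(1,\infty)$, $t\in[0,1]$, $\theta\ge0$, let $\sigma^{(t)}_{K,N}(\theta)=+\infty$ if $N\pi^2\le K\theta^2$, $\sigma^{(t)}_{K,N}(\theta)=\sin(t\theta\sqrt{K/N})/\sin(\theta\sqrt{K/N})$ if $0<K\theta^2<N\pi^2$, $\sigma^{(t)}_{K,N}(\theta)=t$ if $K=0$, $\sigma^{(t)}_{K,N}(\theta)=\sinh(t\theta\sqrt{-K/N})/\sinh(\theta\sqrt{-K/N})$ if $K<0$; and $\tau^{(t)}_{K,N}(\theta)=t^{1/N}[\sigma^{(t)}_{K,N-1}(\theta)]^{1-1/N}$. For a metric measure space $(X,\mathsf{d},\mathfrak{m})$, $\mathrm{Geo}(X)$ is the space of geodesics, $e_t(\gamma)=\gamma(t)$, and $W_2$ is the quadratic Wasserstein distance. $(X,\mathsf{d},\mathfrak{m})$ satisfies $\mathsf{MCP}(K,N)$ if for every $x\in\mathrm{spt}\,\mathfrak{m}$ and every Borel $A\subset X$ with $0<\mathfrak{m}(A)<\infty$ there is a probability measure $\eta$ on $\mathrm{Geo}(X)$ such that $((e_t)_\#\eta)_{t\in[0,1]}$ is a $W_2$-geodesic from $\delta_x$ to $\mathfrak{m}|_A/\mathfrak{m}(A)$ and, for every $t\in[0,1]$, $\frac{1}{\mathfrak{m}(A)}\mathfrak{m}\ge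 (e_t)_\#\big(\tau^{(t)}_{K,N}(\mathsf{d}(\gamma(0),\gamma(1)))^N\,\eta(d\gamma)\big)$ as measures. *)

theory Defs
  imports "HOL-Probability.Probability"
begin

type_synonym R2 = "real \<times> real"
type_synonym R3 = "real \<times> real \<times> real"

definition is_norm :: "(R2 \<Rightarrow> real) \<Rightarrow> bool" where
  "is_norm Nm \<longleftrightarrow> (\<forall>x. 0 \<le> Nm x) \<and> (\<forall>x. Nm x = 0 \<longleftrightarrow> x = 0)
     \<and> (\<forall>c x. Nm (c *\<^sub>R x) = \<bar>c\<bar> * Nm x) \<and> (\<forall>x y. Nm (x + y) \<le> Nm x + Nm y)"

definition norm_C1 :: "(R2 \<Rightarrow> real) \<Rightarrow> bool" where
  "norm_C1 Nm \<longleftrightarrow> (\<exists>g :: R2 \<Rightarrow> R2. continuous_on (- {0}) g \<and>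
       (\<forall>x. x \<noteq> 0 \<longrightarrow> (Nm has_derivative (\<lambda>h. g x \<bullet> h)) (at x)))"

definition norm_strongly_convex :: "(R2 \<Rightarrow> real) \<Rightarrow> bool" where
  "norm_strongly_convex Nm \<longleftrightarrow> (\<exists>\<alpha>>0. \<forall>x y. \<forall>t\<in>{0..1}.
      (Nm (t *\<^sub>R x + (1 - t) *\<^sub>R y))\<^sup>2 / 2
        \<le> t * ((Nm x)\<^sup>2 / 2) + (1 - t) * ((Nm y)\<^sup>2 / 2) - \<alpha> / 2 * t * (1 - t) * (Nm (x - y))\<^sup>2)"

definition X1 :: "R3 \<Rightarrow> R3" where "X1 p = (1, 0, - fst (snd p) / 2)"
definition X2 :: "R3 \<Rightarrow> R3" where "X2 p = (0, 1, fst p / 2)"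

definition abs_continuous_on :: "real set \<Rightarrow> (real \<Rightarrow> 'a::real_normed_vector) \<Rightarrow> bool" where
  "abs_continuous_on I f \<longleftrightarrow> (\<forall>e>0. \<exists>d>0. \<forall>(n::nat) (s::nat \<Rightarrow> real) t.
      (\<forall>i<n. s i \<in> I \<and> t i \<in> I \<and> s i \<le> t i)
      \<and> (\<forall>i<n. \<forall>j<n. i \<noteq> j \<longrightarrow> t i \<le> s j \<or> t j \<le> s i)
      \<and> (\<Sum>i<n. t i - s i) < d
      \<longrightarrow> (\<Sum>i<n. norm (f (t i) - f (s i))) < e)"

definition admissible :: "(real \<Rightarrow> R3) \<Rightarrow> (real \<Rightarrow> R2) \<Rightarrow> bool" where
  "admissible \<gamma> u \<longleftrightarrow> abs_continuous_on {0..1} \<gamma>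
     \<and> u \<in> borel_measurable (lebesgue_on {0..1})
     \<and> integrable (lebesgue_on {0..1}) (\<lambda>t. (norm (u t))\<^sup>2)
     \<and> (AE t in lebesgue_on {0..1}.
          (\<gamma> has_vector_derivative (fst (u t) *\<^sub>R X1 (\<gamma> t) + snd (u t) *\<^sub>R X2 (\<gamma> t))) (at t))"

definition control_length :: "(R2 \<Rightarrow> real) \<Rightarrow> (real \<Rightarrow> R2) \<Rightarrow> real" where
  "control_length Nm u = integral\<^sup>L (lebesgue_on {0..1}) (\<lambda>t. Nm (u t))"

definition sf_dist :: "(R2 \<Rightarrow> real) \<Rightarrow> R3 \<Rightarrow> R3 \<Rightarrow> real" where
  "sf_dist Nm p q = Inf {L. \<exists>\<gamma> u. admissible \<gamma> u \<and> \<gamma> 0 = p \<and> \<gamma> 1 = q \<and> L = control_length Nm u}"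

definition unit_ball_of :: "(R2 \<Rightarrow> real) \<Rightarrow> R2 set" where
  "unit_ball_of Nm = {x. Nm x \<le> 1}"

definition polar_set :: "R2 set \<Rightarrow> R2 set" where
  "polar_set S = {p. \<forall>x\<in>S. p \<bullet> x \<le> 1}"

definition area :: "R2 set \<Rightarrow> real" where
  "area S = measure lborel S"

definition sector :: "R2 set \<Rightarrow> real \<Rightarrow> R2 set" where
  "sector S \<alpha> = {x \<in> S. \<exists>\<rho>\<ge>0. \<exists>\<beta>\<in>{0..\<alpha>}. x = (\<rho> * cos \<beta>, \<rho> * sin \<beta>)}"

definition trig_pt :: "R2 set \<Rightarrow> real \<Rightarrow> R2" where
  "trig_pt S \<theta> = (let \<theta>' = \<theta> - 2 * area S * of_int \<lfloor>\<theta> / (2 * area S)\<rfloor> in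
     THE P. P \<in> frontier S \<and> (\<exists>\<alpha>\<in>{0..<2*pi}. P = (norm P * cos \<alpha>, norm P * sin \<alpha>)
                                        \<and> 2 * measure lborel (sector S \<alpha>) = \<theta>'))"

definition cos_S :: "R2 set \<Rightarrow> real \<Rightarrow> real" where "cos_S S \<theta> = fst (trig_pt S \<theta>)"
definition sin_S :: "R2 set \<Rightarrow> real \<Rightarrow> real" where "sin_S S \<theta> = snd (trig_pt S \<theta>)"

definition corresponds :: "(R2 \<Rightarrow> real) \<Rightarrow> real \<Rightarrow> real \<Rightarrow> bool" where
  "corresponds Nm \<theta> \<phi> \<longleftrightarrow>
     (let \<Omega> = unit_ball_of Nm; \<Omega>o = polar_set (unit_ball_of Nm) in
      cos_S \<Omega> \<theta> * cos_S \<Omega>o \<phi> + sin_S \<Omega> \<theta> * sin_S \<Omega>o \<phi> = 1)"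

text \<open>Single-valued version of the map C_circ (valid for C^1 strongly convex norms).\<close>
definition is_Ccirc :: "(R2 \<Rightarrow> real) \<Rightarrow> (real \<Rightarrow> real) \<Rightarrow> bool" where
  "is_Ccirc Nm C \<longleftrightarrow> mono C \<and> (\<forall>\<phi>. corresponds Nm (C \<phi>) \<phi>)
     \<and> (\<forall>\<phi> (k::int). C (\<phi> + 2 * of_int k * area (polar_set (unit_ball_of Nm)))
                    = C \<phi> + 2 * of_int k * area (unit_ball_of Nm))"

definition Ccirc :: "(R2 \<Rightarrow> real) \<Rightarrow> real \<Rightarrow> real" where
  "Ccirc Nm = (SOME C. is_Ccirc Nm C)"

text \<open>The set Z, represented by its points in the fundamental domain [0, 2 pi_{Omega polar}).\<close>
definition Zset :: "(R2 \<Rightarrow> real) \<Rightarrow> real set" where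
  "Zset Nm = {\<phi> \<in> {0..<2 * area (polar_set (unit_ball_of Nm))}.
                 (Ccirc Nm has_real_derivative 0) (at \<phi>)}"

definition sigma_KN :: "real \<Rightarrow> real \<Rightarrow> real \<Rightarrow> real \<Rightarrow> ennreal" where
  "sigma_KN K N t \<theta> =
    (if N * pi\<^sup>2 \<le> K * \<theta>\<^sup>2 then \<infinity>
     else if 0 < K * \<theta>\<^sup>2 then ennreal (sin (t * \<theta> * sqrt (K / N)) / sin (\<theta> * sqrt (K / N)))
     else if K = 0 then ennreal t
     else if K < 0 \<and> \<theta> \<noteq> 0 then ennreal (sinh (t * \<theta> * sqrt (- K / N)) / sinh (\<theta> * sqrt (- K / N)))
     else ennreal t)"

text \<open>tau_{K,N}^{(t)}(theta) raised to the power N (values in [0,infinity], with 0 * infinity = 0).\<close>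
definition tau_pow_N :: "real \<Rightarrow> real \<Rightarrow> real \<Rightarrow> real \<Rightarrow> ennreal" where
  "tau_pow_N K N t \<theta> =
    (if sigma_KN K (N - 1) t \<theta> = \<infinity> then (if t = 0 then 0 else \<infinity>)
     else ennreal ((t powr (1 / N) * (enn2real (sigma_KN K (N - 1) t \<theta>)) powr (1 - 1 / N)) powr N))"

definition mm_support :: "('a \<Rightarrow> 'a \<Rightarrow> real) \<Rightarrow> 'a measure \<Rightarrow> 'a set" where
  "mm_support d m = {x. \<forall>r>0. 0 < emeasure m {y. d x y < r}}"

definition Geo :: "('a \<Rightarrow> 'a \<Rightarrow> real) \<Rightarrow> (real \<Rightarrow> 'a) set" where
  "Geo d = {\<gamma> \<in> extensional {0..1}. \<forall>s\<in>{0..1}. \<forall>t\<in>{0..1}.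
              d (\<gamma> s) (\<gamma> t) = \<bar>t - s\<bar> * d (\<gamma> 0) (\<gamma> 1)}"

definition GeoM :: "('a::topological_space \<Rightarrow> 'a \<Rightarrow> real) \<Rightarrow> (real \<Rightarrow> 'a) measure" where
  "GeoM d = restrict_space (Pi\<^sub>M {0..1} (\<lambda>_. borel)) (Geo d)"

definition couplings :: "'a::topological_space measure \<Rightarrow> 'a measure \<Rightarrow> ('a \<times> 'a) measure set" where
  "couplings \<mu> \<nu> = {\<pi>. sets \<pi> = sets (borel \<Otimes>\<^sub>M borel)
                       \<and> distr \<pi> borel fst = \<mu> \<and> distr \<pi> borel snd = \<nu>}"

definition W2 :: "('a::topological_space \<Rightarrow> 'a \<Rightarrow> real) \<Rightarrow> 'a measure \<Rightarrow> 'a measure \<Rightarrow> ennreal" where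
  "W2 d \<mu> \<nu> = (let c = (INF \<pi>\<in>couplings \<mu> \<nu>. \<integral>\<^sup>+ z. ennreal ((d (fst z) (snd z))\<^sup>2) \<partial>\<pi>) in
                 if c = \<infinity> then \<infinity> else ennreal (sqrt (enn2real c)))"

definition MCP :: "('a::topological_space \<Rightarrow> 'a \<Rightarrow> real) \<Rightarrow> 'a measure \<Rightarrow> real \<Rightarrow> real \<Rightarrow> bool" where
  "MCP d m K N \<longleftrightarrow>
    (\<forall>x\<in>mm_support d m. \<forall>A\<in>sets borel. 0 < emeasure m A \<and> emeasure m A < \<infinity> \<longrightarrow>
      (\<exists>\<eta>. prob_space \<eta> \<and> sets \<eta> = sets (GeoM d)
         \<and> distr \<eta> borel (\<lambda>\<gamma>. \<gamma> 0) = return borel x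
         \<and> distr \<eta> borel (\<lambda>\<gamma>. \<gamma> 1) = density m (\<lambda>y. indicator A y / emeasure m A)
         \<and> (\<forall>s\<in>{0..1}. \<forall>t\<in>{0..1}.
              W2 d (distr \<eta> borel (\<lambda>\<gamma>. \<gamma> s)) (distr \<eta> borel (\<lambda>\<gamma>. \<gamma> t))
                = ennreal \<bar>t - s\<bar> * W2 d (distr \<eta> borel (\<lambda>\<gamma>. \<gamma> 0)) (distr \<eta> borel (\<lambda>\<gamma>. \<gamma> 1)))
         \<and> (\<forall>t\<in>{0..1}. \<forall>B\<in>sets borel.
              (\<integral>\<^sup>+ \<gamma>. tau_pow_N K N t (d (\<gamma> 0) (\<gamma> 1)) * indicator B (\<gamma> t) \<partial>\<eta>)
                \<le> emeasure m B / emeasure m A)))"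

end

theory Submission
  imports Defs
begin

text \<open>Let \<open>Pc\<close> parametrize the boundary of the polar set by twice the swept area, so that \<open>Pc' = J uc\<close> with
  \<open>uc\<close> the dual point on the unit sphere. Short curves from the origin with control \<open>\<rho> uc\<close> are geodesics: where
  \<open>u1\<close> does not vanish, the covectors \<open>Pc\<close> along such a curve are the horizontal gradient of a function of \<open>x\<close>
  plus a linear function of \<open>y\<close> and \<open>z + x y / 2\<close>, which is a calibration. Strong convexity makes second order
  perturbations of this calibration available, and these show that the intermediate points are unique. Hence
  the measure contraction property yields a bound on the Jacobian of the exponential map,
  \<open>t powr N * jac \<phi> \<psi> \<le> t * jac \<phi> (\<phi> + t * (\<psi> - \<phi>))\<close>.

  Up to positive factors \<open>jac \<phi> \<psi>\<close> is \<open>2 W Y - y\<^sup>2\<close>, where \<open>W\<close> is the increment of the slope \<open>w = u2 / u1\<close> of \<open>uc\<close>,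
  and the bound becomes a Dini estimate: the left derivative of \<open>w\<close> at \<open>\<psi>\<close> is at most a constant times the mean
  slope \<open>(w \<psi> - w \<phi>) / (\<psi> - \<phi>)\<close>. The derivative of \<open>w\<close> vanishes on \<open>Zset\<close>, so near a density point the mean
  slope is small compared with the Lipschitz constant of \<open>w\<close>; the estimate then halves this constant on a fixed
  interval, again and again. Thus \<open>w\<close> is constant there, although \<open>uc\<close> is injective.\<close>

section \<open>Absolutely continuous functions\<close>

text \<open>The measure contraction property only supplies a measure on metric geodesics, which are
  not known to be admissible curves. Uniqueness is therefore proved for points: a point
  \<open>q\<close> is pinned down by its distances to the two ends of an arc, because a sharp
  calibration forces two further functions, flat along the extremal field, to agree at
  \<open>q\<close> and at the origin. The same fact makes the exponential map injective. As
  \<open>uc\<close> is only Lipschitz, the Jacobian bound is not differentiated in \<open>t\<close>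
  but used as a difference inequality for \<open>x = \<phi> + t * (\<psi> - \<phi>)\<close> near
  \<open>\<psi>\<close>. Put \<open>F = 2 W Y - y\<^sup>2\<close>. Up to bounded factors
  \<open>F \<psi> - F x\<close> is at most \<open>C * (1 - t) * F \<psi>\<close> with
  \<open>C\<close> depending on \<open>N\<close>, and \<open>F \<psi> \<le> 2 W Y\<close>; freezing
  the slope shows that it is at least \<open>2 * (w \<psi> - w x) * Y x\<close>. For
  \<open>x\<close> near \<open>\<psi>\<close> the values of \<open>Y\<close> cancel up to a factor,
  and \<open>1 - t = (\<psi> - x) / (\<psi> - \<phi>)\<close> produces the mean slope. The resulting
  constant is independent of \<open>\<phi>\<close> and \<open>\<psi>\<close>, which is what allows
  the halving on one fixed interval.\<close>

lemma abs_continuous_onE: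
  fixes f :: "real \<Rightarrow> 'a::real_normed_vector"
  assumes "abs_continuous_on I f" "e > 0"
  obtains d where "d > 0" "\<And>(n::nat) s t. (\<forall>i<n. s i \<in> I \<and> t i \<in> I \<and> s i \<le> t i)
      \<and> (\<forall>i<n. \<forall>j<n. i \<noteq> j \<longrightarrow> t i \<le> s j \<or> t j \<le> s i)
      \<and> (\<Sum>i<n. t i - s i) < d
      \<Longrightarrow> (\<Sum>i<n. norm (f (t i) - f (s i))) < e"
proof (rule exE[OF assms(1)[unfolded abs_continuous_on_def, THEN spec, THEN mp, OF assms(2)]])
  fix d assume d: "0 < d \<and> (\<forall>(n::nat) s t. (\<forall>i<n. s i \<in> I \<and> t i \<in> I \<and> s i \<le> t i)
      \<and> (\<forall>i<n. \<forall>j<n. i \<noteq> j \<longrightarrow> t i \<le> s j \<or> t j \<le> s i)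
      \<and> (\<Sum>i<n. t i - s i) < d
      \<longrightarrow> (\<Sum>i<n. norm (f (t i) - f (s i))) < e)"
  show thesis
    by (rule that[OF conjunct1[OF d] conjunct2[OF d, THEN spec, THEN spec, THEN spec, THEN mp]])
qed

text \<open>Coordinates of a curve, calibrations along it and perturbed curves all inherit absolute
  continuity in this way; the summand \<open>t - s\<close> admits terms that are Lipschitz in time.
  The sign of \<open>L\<close> is left open, hence \<open>M = max L 1\<close> in the proof.\<close>

lemma abs_continuous_on_comp_Lipschitz:
  fixes f :: "real \<Rightarrow> 'a::real_normed_vector" and g :: "real \<Rightarrow> 'b::real_normed_vector"
  assumes f: "abs_continuous_on I f"
    and L: "\<And>s t. s \<in> I \<Longrightarrow> t \<in> I \<Longrightarrow> s \<le> t \<Longrightarrow> norm (g t - g s) \<le> L * ((t - s) + norm (f t - f s))"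
  shows "abs_continuous_on I g"
  unfolding abs_continuous_on_def
proof (intro allI impI)
  fix e :: real assume "e > 0"
  define M where "M = max L 1"
  have M: "M > 0" "L \<le> M" by (auto simp: M_def)
  have "e / (2 * M) > 0" using M \<open>e > 0\<close> by simp
  then obtain d where d: "d > 0" and df: "\<And>(n::nat) s t. (\<forall>i<n. s i \<in> I \<and> t i \<in> I \<and> s i \<le> t i)
      \<and> (\<forall>i<n. \<forall>j<n. i \<noteq> j \<longrightarrow> t i \<le> s j \<or> t j \<le> s i)
      \<and> (\<Sum>i<n. t i - s i) < d
      \<Longrightarrow> (\<Sum>i<n. norm (f (t i) - f (s i))) < e / (2 * M)"
    using abs_continuous_onE[OF f] by blast
  show "\<exists>d>0. \<forall>(n::nat) s t.
            (\<forall>i<n. s i \<in> I \<and> t i \<in> I \<and> s i \<le> t i) \<and>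
            (\<forall>i<n. \<forall>j<n. i \<noteq> j \<longrightarrow> t i \<le> s j \<or> t j \<le> s i) \<and> (\<Sum>i<n. t i - s i) < d \<longrightarrow>
            (\<Sum>i<n. norm (g (t i) - g (s i))) < e"
  proof (intro exI conjI allI impI)
    show "min d (e / (2 * M)) > 0" using d M \<open>e > 0\<close> by simp
    fix n :: nat and s t :: "nat \<Rightarrow> real"
    assume a: "(\<forall>i<n. s i \<in> I \<and> t i \<in> I \<and> s i \<le> t i) \<and>
            (\<forall>i<n. \<forall>j<n. i \<noteq> j \<longrightarrow> t i \<le> s j \<or> t j \<le> s i) \<and> (\<Sum>i<n. t i - s i) < min d (e / (2 * M))"
    have "(\<Sum>i<n. norm (g (t i) - g (s i))) \<le> (\<Sum>i<n. M * ((t i - s i) + norm (f (t i) - f (s i))))"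
    proof (rule sum_mono)
      fix i assume "i \<in> {..<n}"
      then have "norm (g (t i) - g (s i)) \<le> L * ((t i - s i) + norm (f (t i) - f (s i)))"
        and "s i \<le> t i" using a L by auto
      moreover have "L * ((t i - s i) + norm (f (t i) - f (s i))) \<le> M * ((t i - s i) + norm (f (t i) - f (s i)))"
        using \<open>s i \<le> t i\<close> M by (intro mult_right_mono) auto
      ultimately show "norm (g (t i) - g (s i)) \<le> M * ((t i - s i) + norm (f (t i) - f (s i)))" by linarith
    qed
    also have "\<dots> = M * ((\<Sum>i<n. t i - s i) + (\<Sum>i<n. norm (f (t i) - f (s i))))"
      by (simp only: sum_distrib_left[symmetric] sum.distrib)
    also have "\<dots> < M * (e / (2 * M) + e / (2 * M))"
      using df[of n s t] a M by (intro mult_strict_left_mono add_strict_mono) auto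
    also have "\<dots> = e" using M by (simp add: field_simps)
    finally show "(\<Sum>i<n. norm (g (t i) - g (s i))) < e" .
  qed
qed

lemma abs_continuous_on_subset:
  fixes f :: "real \<Rightarrow> 'a::real_normed_vector"
  assumes f: "abs_continuous_on I f" and J: "J \<subseteq> I"
  shows "abs_continuous_on J f"
  unfolding abs_continuous_on_def
proof (intro allI impI)
  fix e :: real assume "0 < e"
  obtain d where d: "d > 0" "\<And>(n::nat) s t. (\<forall>i<n. s i \<in> I \<and> t i \<in> I \<and> s i \<le> t i)
      \<and> (\<forall>i<n. \<forall>j<n. i \<noteq> j \<longrightarrow> t i \<le> s j \<or> t j \<le> s i)
      \<and> (\<Sum>i<n. t i - s i) < d
      \<Longrightarrow> (\<Sum>i<n. norm (f (t i) - f (s i))) < e"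
    using abs_continuous_onE[OF f \<open>0 < e\<close>] by blast
  show "\<exists>d>0. \<forall>(n::nat) s t.
      (\<forall>i<n. s i \<in> J \<and> t i \<in> J \<and> s i \<le> t i)
      \<and> (\<forall>i<n. \<forall>j<n. i \<noteq> j \<longrightarrow> t i \<le> s j \<or> t j \<le> s i)
      \<and> (\<Sum>i<n. t i - s i) < d
      \<longrightarrow> (\<Sum>i<n. norm (f (t i) - f (s i))) < e"
    using J by (intro exI[of _ d] conjI allI impI d) (simp_all add: subset_eq)
qed

lemma abs_continuous_on_Lipschitz:
  fixes g :: "real \<Rightarrow> 'b::real_normed_vector"
  assumes "\<And>s t. s \<in> I \<Longrightarrow> t \<in> I \<Longrightarrow> s \<le> t \<Longrightarrow> norm (g t - g s) \<le> L * (t - s)"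
  shows "abs_continuous_on I g"
proof (rule abs_continuous_on_comp_Lipschitz[where L = L])
  show "abs_continuous_on I (\<lambda>_. 0 :: real)"
    unfolding abs_continuous_on_def by (auto intro: exI[of _ 1])
qed (use assms in simp)

text \<open>The definition numbers the intervals, whereas a tagged division is a finite set of
  pairs; the estimate is carried over along a bijection.\<close>

lemma abs_continuous_on_finite_family:
  fixes f :: "real \<Rightarrow> 'a::real_normed_vector"
  assumes "abs_continuous_on I f" "e > 0"
  obtains d where "d > 0" "\<And>(D :: 'i set) s t. finite D \<Longrightarrow> (\<And>i. i \<in> D \<Longrightarrow> s i \<in> I \<and> t i \<in> I \<and> s i \<le> t i) \<Longrightarrow>
      (\<And>i j. i \<in> D \<Longrightarrow> j \<in> D \<Longrightarrow> i \<noteq> j \<Longrightarrow> t i \<le> s j \<or> t j \<le> s i) \<Longrightarrow>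
      (\<Sum>i\<in>D. t i - s i) < d \<Longrightarrow> (\<Sum>i\<in>D. norm (f (t i) - f (s i))) < e"
proof -
  obtain d where d: "d > 0" and df: "\<And>(n::nat) s t. (\<forall>i<n. s i \<in> I \<and> t i \<in> I \<and> s i \<le> t i)
      \<and> (\<forall>i<n. \<forall>j<n. i \<noteq> j \<longrightarrow> t i \<le> s j \<or> t j \<le> s i)
      \<and> (\<Sum>i<n. t i - s i) < d
      \<Longrightarrow> (\<Sum>i<n. norm (f (t i) - f (s i))) < e"
    using abs_continuous_onE[OF assms] by blast
  show thesis
  proof (rule that[OF d])
    fix D :: "'i set" and s t
    assume D: "finite D" "\<And>i. i \<in> D \<Longrightarrow> s i \<in> I \<and> t i \<in> I \<and> s i \<le> t i"
      "\<And>i j. i \<in> D \<Longrightarrow> j \<in> D \<Longrightarrow> i \<noteq> j \<Longrightarrow> t i \<le> s j \<or> t j \<le> s i" "(\<Sum>i\<in>D. t i - s i) < d"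
    obtain h where h: "bij_betw h {0..<card D} D" using ex_bij_betw_nat_finite[OF D(1)] by blast
    then have h': "bij_betw h {..<card D} D" by (simp add: atLeast0LessThan)
    have hD: "\<And>i. i < card D \<Longrightarrow> h i \<in> D" using h' by (auto simp: bij_betw_def)
    have inj: "\<And>i j. i < card D \<Longrightarrow> j < card D \<Longrightarrow> i \<noteq> j \<Longrightarrow> h i \<noteq> h j"
      using h' by (auto simp: bij_betw_def inj_on_def)
    have "(\<Sum>i<card D. norm (f ((t \<circ> h) i) - f ((s \<circ> h) i))) < e"
    proof (rule df, intro conjI allI impI)
      show "(\<Sum>i<card D. (t \<circ> h) i - (s \<circ> h) i) < d"
        using D(4) sum.reindex_bij_betw[OF h', of "\<lambda>i. t i - s i"] by simp
    qed (use D hD inj in auto)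
    then show "(\<Sum>i\<in>D. norm (f (t i) - f (s i))) < e"
      using sum.reindex_bij_betw[OF h', of "\<lambda>i. norm (f (t i) - f (s i))"] by simp
  qed
qed

text \<open>Tags in the exceptional null set are controlled by absolute continuity, all other tags by the
  derivative, so the fundamental theorem of calculus holds for the gauge integral.\<close>

theorem abs_continuous_fundamental_theorem:
  fixes f g :: "real \<Rightarrow> real"
  assumes ac: "abs_continuous_on {a..b} f" and "a \<le> b" and E: "negligible E"
    and der: "\<And>t. t \<in> {a..b} - E \<Longrightarrow> (f has_real_derivative g t) (at t within {a..b})"
  shows "(g has_integral (f b - f a)) {a..b}"
proof -
  \<comment> \<open>With the integrand set to zero on \<open>E\<close>, a bad tag contributes
    nothing to the Riemann sum, and only the increment of \<open>f\<close> over its interval has to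
    be estimated.\<close>
  define g0 where "g0 t = (if t \<in> E then 0 else g t)" for t
  have "(g0 has_integral (f b - f a)) {a..b}"
    unfolding has_integral_real
  proof (intro allI impI)
    fix e :: real assume "e > 0"
    \<comment> \<open>Good tags contribute at most \<open>e' * (b - a) < e / 2\<close>, bad tags the
      other half; the \<open>+ 1\<close> covers the case \<open>a = b\<close>.\<close>
    define e' where "e' = e / (2 * (b - a + 1))"
    have e': "e' > 0" using \<open>e > 0\<close> \<open>a \<le> b\<close> by (simp add: e'_def)
    have "e' * (b - a) < e / 2" using \<open>e > 0\<close> \<open>a \<le> b\<close> by (simp add: e'_def field_simps)
    obtain d where d: "d > 0" and df: "\<And>(D :: (real \<times> real set) set) s t. finite D \<Longrightarrow>
      (\<And>i. i \<in> D \<Longrightarrow> s i \<in> {a..b} \<and> t i \<in> {a..b} \<and> s i \<le> t i) \<Longrightarrow>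
      (\<And>i j. i \<in> D \<Longrightarrow> j \<in> D \<Longrightarrow> i \<noteq> j \<Longrightarrow> t i \<le> s j \<or> t j \<le> s i) \<Longrightarrow>
      (\<Sum>i\<in>D. t i - s i) < d \<Longrightarrow> (\<Sum>i\<in>D. norm (f (t i) - f (s i))) < e / 2"
      by (rule abs_continuous_on_finite_family[OF ac half_gt_zero[OF \<open>e > 0\<close>], where ?'i = "real \<times> real set"]) blast
    obtain U where U: "open U" "E \<subseteq> U" "U \<in> lmeasurable" "measure lebesgue U < d"
    proof -
      have "E \<in> sets lebesgue" using E by (simp add: negligible_imp_sets)
      then obtain U where U: "open U" "E \<subseteq> U" "U - E \<in> lmeasurable" "emeasure lebesgue (U - E) < ennreal d"
        using sets_lebesgue_outer_open[of E d] d by blast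
      have EL: "E \<in> lmeasurable" using E by (simp add: negligible_imp_measurable)
      have "U = (U - E) \<union> E" using U by blast
      then have "U \<in> lmeasurable" using U(3) EL fmeasurable.Un by metis
      moreover have "measure lebesgue U \<le> measure lebesgue (U - E) + measure lebesgue E"
        using measure_Un_le[of "U - E" lebesgue E] U EL \<open>U = (U - E) \<union> E\<close> by (metis fmeasurableD)
      moreover have "measure lebesgue E = 0" using E by (simp add: negligible_imp_measure0)
      moreover have "measure lebesgue (U - E) < d"
        using U(3,4) d by (simp add: emeasure_eq_measure2 ennreal_less_iff)
      ultimately show thesis using that U by auto
    qed
    have "\<exists>r>0. t \<in> {a..b} - E \<longrightarrow> (\<forall>y\<in>{a..b}. norm (y - t) < r \<longrightarrow> norm (f y - f t - (y - t) * g t) \<le> e' * norm (y - t))" for t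
      using der[of t] e' unfolding has_field_derivative_def has_derivative_within_alt
      by (metis mult.commute zero_less_one)
    then obtain r where r: "\<And>t. r t > 0" "\<And>t y. t \<in> {a..b} - E \<Longrightarrow> y \<in> {a..b} \<Longrightarrow> norm (y - t) < r t
       \<Longrightarrow> norm (f y - f t - (y - t) * g t) \<le> e' * norm (y - t)" by metis
    define \<gamma> where "\<gamma> t = (if t \<in> E then U else ball t (r t))" for t
    have gauge: "gauge \<gamma>" using U r(1) by (auto simp: gauge_def \<gamma>_def)
    have fine: "norm ((\<Sum>(x, K)\<in>D. measure lborel K *\<^sub>R g0 x) - (f b - f a)) < e"
      if D: "D tagged_division_of {a..b}" "\<gamma> fine D" for D
    proof -
      have fin: "finite D" using D(1) by blast
      have K: "\<exists>u v. K = {u..v} \<and> u \<le> v \<and> x \<in> {u..v} \<and> {u..v} \<subseteq> {a..b} \<and> {u..v} \<subseteq> \<gamma> x" if "(x, K) \<in> D" for x K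
      proof -
        have "x \<in> K" "K \<subseteq> {a..b}" "\<exists>u v. K = cbox u v" "K \<subseteq> \<gamma> x"
          using D that by (blast, blast, blast, blast)
        then show ?thesis by fastforce
      qed
      define G where "G = (\<lambda>(x, K). measure lborel K *\<^sub>R g0 x - (f (Sup K) - f (Inf K)))"
      define D1 where "D1 = {p\<in>D. fst p \<notin> E}"
      \<comment> \<open>Degenerate intervals contribute zero and are discarded: disjoint interiors
        put two intervals in order only if both have positive length.\<close>
      define D2 where "D2 = {p\<in>D. fst p \<in> E \<and> Inf (snd p) < Sup (snd p)}"
      have eq: "(\<Sum>(x, K)\<in>D. measure lborel K *\<^sub>R g0 x) - (f b - f a) = sum G D"
        unfolding G_def additive_tagged_division_1[OF \<open>a \<le> b\<close> D(1), of f, symmetric]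
        by (simp add: sum_subtractf split_def)
      have "sum G D = sum G (D1 \<union> D2)"
      proof (rule sum.mono_neutral_right[OF fin])
        show "\<forall>p\<in>D - (D1 \<union> D2). G p = 0"
        proof
          fix p assume p: "p \<in> D - (D1 \<union> D2)"
          obtain x K' where [simp]: "p = (x, K')" by fastforce
          from p K[of x K'] obtain u v where "K' = {u..v}" "u \<le> v" by auto
          with p show "G p = 0" by (auto simp: D1_def D2_def G_def g0_def)
        qed
      qed (auto simp: D1_def D2_def)
      also have "\<dots> = sum G D1 + sum G D2"
        by (rule sum.union_disjoint) (use fin in \<open>auto simp: D1_def D2_def\<close>)
      finally have s12: "sum G D = sum G D1 + sum G D2" .
      have "norm (sum G D1) \<le> (\<Sum>(x, K)\<in>D1. e' * (Sup K - Inf K))"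
      proof (rule sum_norm_le, clarify)
        fix x K' assume xK: "(x, K') \<in> D1"
        then have xD: "(x, K') \<in> D" and xE: "x \<notin> E" by (auto simp: D1_def)
        from K[OF xD] obtain u v where uv: "K' = {u..v}" "u \<le> v" "x \<in> {u..v}" "{u..v} \<subseteq> {a..b}" "{u..v} \<subseteq> ball x (r x)"
          using xE by (auto simp: \<gamma>_def)
        have x: "x \<in> {a..b} - E" using uv xE by auto
        have "u \<in> {u..v}" "v \<in> {u..v}" using uv(2) by auto
        then have "u \<in> ball x (r x)" "v \<in> ball x (r x)" using uv(5) by blast+
        then have "norm (u - x) < r x" "norm (v - x) < r x" by (auto simp: dist_real_def)
        moreover have "u \<in> {a..b}" "v \<in> {a..b}" using uv by auto
        ultimately have "norm (f u - f x - (u - x) * g x) \<le> e' * norm (u - x)"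
          "norm (f v - f x - (v - x) * g x) \<le> e' * norm (v - x)" by (simp_all only: r(2)[OF x])
        moreover have "norm (u - x) = x - u" "norm (v - x) = v - x" using uv by auto
        ultimately have 1: "\<bar>f u - f x - (u - x) * g x\<bar> \<le> e' * (x - u)" "\<bar>f v - f x - (v - x) * g x\<bar> \<le> e' * (v - x)"
          by simp_all
        have 2: "(v - u) * g x - (f v - f u) = (f u - f x - (u - x) * g x) - (f v - f x - (v - x) * g x)"
          by (simp add: algebra_simps)
        have "\<bar>(v - u) * g x - (f v - f u)\<bar> \<le> e' * (x - u) + e' * (v - x)"
          unfolding 2 using 1 by linarith
        then show "norm (G (x, K')) \<le> e' * (Sup K' - Inf K')"
          using uv xE by (auto simp: G_def g0_def algebra_simps)
      qed
      also have "\<dots> \<le> (\<Sum>(x, K)\<in>D. e' * (Sup K - Inf K))"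
      proof (rule sum_mono2[OF fin])
        show "0 \<le> (case p of (x, K) \<Rightarrow> e' * (Sup K - Inf K))" if "p \<in> D - D1" for p
          using that K[of "fst p" "snd p"] e' by (auto simp: split_def)
      qed (auto simp: D1_def)
      also have "\<dots> = e' * (b - a)"
        using additive_tagged_division_1[OF \<open>a \<le> b\<close> D(1), of "\<lambda>x. x"]
        by (simp add: sum_distrib_left[symmetric] split_def)
      finally have n1: "norm (sum G D1) < e / 2" using \<open>e' * (b - a) < e / 2\<close> by linarith
      have fin2: "finite D2" using fin by (auto simp: D2_def)
      have disj: "Sup (snd p) \<le> Inf (snd q) \<or> Sup (snd q) \<le> Inf (snd p)" if pq: "p \<in> D2" "q \<in> D2" "p \<noteq> q" for p q
      proof -
        obtain x1 K1 x2 K2 where [simp]: "p = (x1, K1)" "q = (x2, K2)" by fastforce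
        have "(x1, K1) \<in> D" "(x2, K2) \<in> D" using pq by (auto simp: D2_def)
        then have "interior K1 \<inter> interior K2 = {}" using D(1) pq(3) by auto
        moreover obtain u1 v1 where 1: "K1 = {u1..v1}" "u1 \<le> v1" using K[OF \<open>(x1, K1) \<in> D\<close>] by auto
        moreover obtain u2 v2 where 2: "K2 = {u2..v2}" "u2 \<le> v2" using K[OF \<open>(x2, K2) \<in> D\<close>] by auto
        ultimately have 3: "{u1<..<v1} \<inter> {u2<..<v2} = {}" by simp
        have "u1 < v1" "u2 < v2" using pq 1 2 by (auto simp: D2_def)
        have "v1 \<le> u2 \<or> v2 \<le> u1"
        proof (rule ccontr)
          assume "\<not> (v1 \<le> u2 \<or> v2 \<le> u1)"
          then have "max u1 u2 < min v1 v2" using \<open>u1 < v1\<close> \<open>u2 < v2\<close> by auto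
          then obtain z where "max u1 u2 < z" "z < min v1 v2" using dense by blast
          then have "z \<in> {u1<..<v1} \<inter> {u2<..<v2}" by auto
          then show False using 3 by blast
        qed
        then show ?thesis using 1 2 by auto
      qed
      have D2sub: "Inf (snd p) \<in> {a..b} \<and> Sup (snd p) \<in> {a..b} \<and> Inf (snd p) \<le> Sup (snd p)
         \<and> {Inf (snd p)<..<Sup (snd p)} \<subseteq> U" if "p \<in> D2" for p
        using that K[of "fst p" "snd p"] by (auto simp: D2_def \<gamma>_def subset_iff)
      have "(\<Sum>p\<in>D2. Sup (snd p) - Inf (snd p)) = (\<Sum>p\<in>D2. measure lebesgue {Inf (snd p)<..<Sup (snd p)})"
        using D2sub by (intro sum.cong) auto
      also have "\<dots> = measure lebesgue (\<Union>p\<in>D2. {Inf (snd p)<..<Sup (snd p)})"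
      proof (rule measure_finite_Union[symmetric, OF fin2])
        show "disjoint_family_on (\<lambda>p. {Inf (snd p)<..<Sup (snd p)}) D2"
          unfolding disjoint_family_on_def
        proof (intro ballI impI)
          fix p q assume "p \<in> D2" "q \<in> D2" "p \<noteq> q"
          from disj[OF this] show "{Inf (snd p)<..<Sup (snd p)} \<inter> {Inf (snd q)<..<Sup (snd q)} = {}" by auto
        qed
        show "emeasure lebesgue {Inf (snd p)<..<Sup (snd p)} \<noteq> \<infinity>" if "p \<in> D2" for p
          using D2sub[OF that] by simp
      qed auto
      also have "\<dots> \<le> measure lebesgue U"
        by (rule measure_mono_fmeasurable) (use D2sub U fin2 in auto)
      also have "\<dots> < d" by (rule U)
      finally have "(\<Sum>p\<in>D2. norm (f (Sup (snd p)) - f (Inf (snd p)))) < e / 2"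
        using disj D2sub by (intro df fin2) auto
      moreover have "norm (sum G D2) \<le> (\<Sum>p\<in>D2. norm (f (Sup (snd p)) - f (Inf (snd p))))"
        by (rule sum_norm_le) (auto simp: D2_def G_def g0_def abs_minus_commute)
      ultimately have "norm (sum G D2) < e / 2" by linarith
      with n1 show ?thesis unfolding eq s12 using norm_triangle_ineq[of "sum G D1" "sum G D2"] by linarith
    qed
    show "\<exists>\<gamma>. gauge \<gamma> \<and> (\<forall>D. D tagged_division_of {a..b} \<and> \<gamma> fine D \<longrightarrow>
          norm ((\<Sum>(x, K)\<in>D. measure lborel K *\<^sub>R g0 x) - (f b - f a)) < e)"
      using gauge fine by (intro exI[of _ \<gamma>] conjI allI impI) simp_all
  qed
  then show ?thesis
    by (rule has_integral_spike[OF E, rotated]) (simp add: g0_def)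
qed


lemma abs_continuous_imp_continuous:
  fixes f :: "real \<Rightarrow> 'a::real_normed_vector"
  assumes f: "abs_continuous_on I f"
  shows "continuous_on I f"
  unfolding continuous_on_iff
proof (intro ballI allI impI)
  fix t e :: real assume t: "t \<in> I" and "0 < e"
  obtain d where d: "d > 0" and D: "\<And>(n::nat) s t. (\<forall>i<n. s i \<in> I \<and> t i \<in> I \<and> s i \<le> t i)
      \<and> (\<forall>i<n. \<forall>j<n. i \<noteq> j \<longrightarrow> t i \<le> s j \<or> t j \<le> s i)
      \<and> (\<Sum>i<n. t i - s i) < d
      \<Longrightarrow> (\<Sum>i<n. norm (f (t i) - f (s i))) < e"
    using abs_continuous_onE[OF f \<open>0 < e\<close>] by blast
  show "\<exists>d>0. \<forall>x'\<in>I. dist x' t < d \<longrightarrow> dist (f x') (f t) < e"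
  proof (intro exI[of _ d] conjI ballI impI)
    show "0 < d" by (rule d)
    fix s assume s: "s \<in> I" "dist s t < d"
    have "norm (f (max s t) - f (min s t)) < e"
      using D[of 1 "\<lambda>_. min s t" "\<lambda>_. max s t"] s t by (auto simp: dist_real_def max_def min_def split: if_splits)
    then show "dist (f s) (f t) < e"
      by (auto simp: dist_norm max_def min_def norm_minus_commute split: if_splits)
  qed
qed

lemma admissibleE:
  assumes "admissible \<gamma> u"
  obtains E where "negligible E"
    "\<And>t. t \<in> {0..1} - E \<Longrightarrow> ((\<lambda>t. fst (\<gamma> t)) has_real_derivative fst (u t)) (at t)"
    "\<And>t. t \<in> {0..1} - E \<Longrightarrow> ((\<lambda>t. fst (snd (\<gamma> t))) has_real_derivative snd (u t)) (at t)"
    "\<And>t. t \<in> {0..1} - E \<Longrightarrow> ((\<lambda>t. snd (snd (\<gamma> t))) has_real_derivative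
        (fst (\<gamma> t) * snd (u t) - fst (snd (\<gamma> t)) * fst (u t)) / 2) (at t)"
proof -
  have "AE t in lebesgue_on {0..1}.
          (\<gamma> has_vector_derivative (fst (u t) *\<^sub>R X1 (\<gamma> t) + snd (u t) *\<^sub>R X2 (\<gamma> t))) (at t)"
    using assms by (simp add: admissible_def)
  then have "AE t in lebesgue. t \<in> {0..1} \<longrightarrow>
          (\<gamma> has_vector_derivative (fst (u t) *\<^sub>R X1 (\<gamma> t) + snd (u t) *\<^sub>R X2 (\<gamma> t))) (at t)"
    by (subst (asm) AE_restrict_space_iff) auto
  then obtain E where E: "negligible E" and *: "\<And>t. t \<in> {0..1} - E \<Longrightarrow>
          (\<gamma> has_vector_derivative (fst (u t) *\<^sub>R X1 (\<gamma> t) + snd (u t) *\<^sub>R X2 (\<gamma> t))) (at t)"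
    unfolding eventually_ae_filter_negligible by blast
  have fs: "bounded_linear (\<lambda>p. fst (snd p))" "bounded_linear (\<lambda>p. snd (snd p))" for p :: R3
    using bounded_linear_compose[OF bounded_linear_fst bounded_linear_snd]
      bounded_linear_compose[OF bounded_linear_snd bounded_linear_snd] by auto
  show thesis
  proof (rule that[OF E])
    fix t assume t: "t \<in> {0..1} - E"
    show "((\<lambda>t. fst (\<gamma> t)) has_real_derivative fst (u t)) (at t)"
      using bounded_linear.has_vector_derivative[OF bounded_linear_fst *[OF t]]
      by (simp add: has_real_derivative_iff_has_vector_derivative X1_def X2_def)
    show "((\<lambda>t. fst (snd (\<gamma> t))) has_real_derivative snd (u t)) (at t)"
      using bounded_linear.has_vector_derivative[OF fs(1) *[OF t]]
      by (simp add: has_real_derivative_iff_has_vector_derivative X1_def X2_def)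
    show "((\<lambda>t. snd (snd (\<gamma> t))) has_real_derivative
        (fst (\<gamma> t) * snd (u t) - fst (snd (\<gamma> t)) * fst (u t)) / 2) (at t)"
      using bounded_linear.has_vector_derivative[OF fs(2) *[OF t]]
      by (simp add: has_real_derivative_iff_has_vector_derivative X1_def X2_def algebra_simps diff_divide_distrib)
  qed
qed

section \<open>Admissible curves and calibrations\<close>

lemma abs_component_le_norm:
  fixes p :: R3
  shows "\<bar>fst p\<bar> \<le> norm p" "\<bar>fst (snd p)\<bar> \<le> norm p" "\<bar>snd (snd p)\<bar> \<le> norm p"
proof -
  have "norm (fst p) \<le> norm p" "norm (snd p) \<le> norm p"
    "norm (fst (snd p)) \<le> norm (snd p)" "norm (snd (snd p)) \<le> norm (snd p)"
    using norm_fst_le[of "fst p" "snd p"] norm_snd_le[of "snd p" "fst p"]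
      norm_fst_le[of "fst (snd p)" "snd (snd p)"] norm_snd_le[of "snd (snd p)" "fst (snd p)"] by simp_all
  then show "\<bar>fst p\<bar> \<le> norm p" "\<bar>fst (snd p)\<bar> \<le> norm p" "\<bar>snd (snd p)\<bar> \<le> norm p" by simp_all
qed

text \<open>The norm axioms stand alone because this locale is instantiated twice, for the given
  norm and for its dual \<open>Nd\<close>.\<close>

locale plane_norm =
  fixes Nm :: "real \<times> real \<Rightarrow> real"
  assumes is_norm: "is_norm Nm"
begin

lemma Nm_ge_0 [simp]: "0 \<le> Nm x" and Nm_eq_0_iff [simp]: "Nm x = 0 \<longleftrightarrow> x = 0"
  and Nm_scale: "Nm (c *\<^sub>R x) = \<bar>c\<bar> * Nm x" and Nm_add: "Nm (x + y) \<le> Nm x + Nm y"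
  using is_norm unfolding is_norm_def by blast+

lemma Nm_zero [simp]: "Nm 0 = 0"
  by simp

lemma Nm_pos: "x \<noteq> 0 \<Longrightarrow> 0 < Nm x"
  using Nm_ge_0[of x] Nm_eq_0_iff[of x] by linarith

lemma Nm_minus [simp]: "Nm (- x) = Nm x"
  using Nm_scale[of "-1" x] by simp

lemma Nm_diff_le: "Nm x - Nm y \<le> Nm (x - y)"
  using Nm_add[of "x - y" y] by simp

lemma Nm_le_norm: obtains k where "k > 0" "\<And>x. Nm x \<le> k * norm x"
proof
  show "0 < Nm (1, 0) + Nm (0, 1)" by (intro add_pos_pos Nm_pos) (auto simp: zero_prod_def)
  fix x :: "real \<times> real"
  have "Nm x \<le> Nm (fst x *\<^sub>R (1, 0)) + Nm (snd x *\<^sub>R (0, 1))"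
    using Nm_add[of "fst x *\<^sub>R (1, 0)" "snd x *\<^sub>R (0, 1)"] by simp
  also have "\<dots> = \<bar>fst x\<bar> * Nm (1, 0) + \<bar>snd x\<bar> * Nm (0, 1)" by (simp only: Nm_scale)
  also have "\<dots> \<le> norm x * Nm (1, 0) + norm x * Nm (0, 1)"
    using norm_fst_le[of "fst x" "snd x"] norm_snd_le[of "snd x" "fst x"]
    by (intro add_mono mult_right_mono) auto
  finally show "Nm x \<le> (Nm (1, 0) + Nm (0, 1)) * norm x" by (simp add: algebra_simps)
qed

lemma continuous_on_Nm: "continuous_on S Nm"
proof -
  obtain k where k: "k > 0" "\<And>x. Nm x \<le> k * norm x" using Nm_le_norm by blast
  have "dist (Nm x) (Nm y) \<le> k * dist x y" for x y
    using k(2)[of "x - y"] k(2)[of "y - x"] Nm_diff_le[of x y] Nm_diff_le[of y x]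
    by (auto simp: dist_norm norm_minus_commute)
  then have "k-lipschitz_on UNIV Nm" using k by (intro lipschitz_onI) auto
  then show ?thesis using lipschitz_on_continuous_on continuous_on_subset by blast
qed

lemma norm_le_Nm: obtains k where "k > 0" "\<And>x. norm x \<le> k * Nm x"
proof -
  have "compact (sphere 0 1 :: (real \<times> real) set)" "(1, 0) \<in> (sphere 0 1 :: (real \<times> real) set)" by auto
  then obtain x0 where x0: "x0 \<in> sphere 0 1" "\<And>x. x \<in> sphere 0 1 \<Longrightarrow> Nm x0 \<le> Nm x"
    using continuous_attains_inf[OF _ _ continuous_on_Nm, of "sphere 0 1"] by (metis empty_iff)
  have p: "Nm x0 > 0" using x0(1) by (intro Nm_pos) auto
  show thesis
  proof (rule that[of "1 / Nm x0"])
    fix x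
    show "norm x \<le> 1 / Nm x0 * Nm x"
    proof (cases "x = 0")
      case False
      then have "Nm x0 \<le> Nm ((1 / norm x) *\<^sub>R x)" by (intro x0) auto
      then show ?thesis using p False by (simp add: Nm_scale field_simps)
    qed simp
  qed (use p in simp)
qed

lemma Nm_measurable [measurable]: "Nm \<in> borel_measurable borel"
  by (intro borel_measurable_continuous_onI continuous_on_Nm)

text \<open>Square integrability on an interval of length one suffices through the elementary bound
  \<open>norm v \<le> 1 + (norm v)\<^sup>2\<close>.\<close>

lemma admissible_integrable:
  assumes "admissible \<gamma> u"
  shows "integrable (lebesgue_on {0..1}) (\<lambda>t. Nm (u t))"
proof -
  obtain k where k: "k > 0" "\<And>x. Nm x \<le> k * norm x" using Nm_le_norm by blast
  have [measurable]: "u \<in> borel_measurable (lebesgue_on {0..1})"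
    and u2: "integrable (lebesgue_on {0..1}) (\<lambda>t. (norm (u t))\<^sup>2)"
    using assms by (auto simp: admissible_def)
  have "integrable (lebesgue_on {0..1}) (\<lambda>t::real. 1::real)"
    by (intro continuous_imp_integrable_real continuous_intros)
  then have "integrable (lebesgue_on {0..1}) (\<lambda>t. k * (1 + (norm (u t))\<^sup>2))"
    using u2 by (intro integrable_mult_right Bochner_Integration.integrable_add)
  then show ?thesis
  proof (rule Bochner_Integration.integrable_bound)
    show "AE t in lebesgue_on {0..1}. norm (Nm (u t)) \<le> norm (k * (1 + (norm (u t))\<^sup>2))"
    proof (rule AE_I2)
      fix t
      have "norm (u t) \<le> 1 + (norm (u t))\<^sup>2"
        using zero_le_power2[of "norm (u t) - 1"] norm_ge_zero[of "u t"]
        unfolding power2_diff one_power2 mult_1_right by linarith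
      then have "k * norm (u t) \<le> k * (1 + (norm (u t))\<^sup>2)" using k by simp
      then show "norm (Nm (u t)) \<le> norm (k * (1 + (norm (u t))\<^sup>2))" using k(2)[of "u t"] by simp
    qed
  qed measurable
qed

lemma control_length_has_integral:
  assumes "admissible \<gamma> u"
  shows "((\<lambda>t. Nm (u t)) has_integral control_length Nm u) {0..1}"
  unfolding control_length_def
  by (intro has_integral_integral_lebesgue_on admissible_integrable[OF assms]) auto

lemma control_length_nonneg: "0 \<le> control_length Nm u"
  unfolding control_length_def by (rule Bochner_Integration.integral_nonneg) simp

lemma sf_dist_le: "admissible \<gamma> u \<Longrightarrow> \<gamma> 0 = p \<Longrightarrow> \<gamma> 1 = q \<Longrightarrow> sf_dist Nm p q \<le> control_length Nm u"
  unfolding sf_dist_def by (rule cInf_lower) (auto intro!: bdd_belowI[of _ 0] control_length_nonneg)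

text \<open>A calibration will be defined only on a strip \<open>\<bar>x\<bar> < r\<close>. The
  first coordinate is the integral of the first control, so short curves cannot leave that
  strip.\<close>

lemma admissible_x_le:
  assumes \<kappa>: "\<And>v. norm v \<le> \<kappa> * Nm v" and adm: "admissible \<gamma> u" and t: "t \<in> {0..1}"
  shows "\<bar>fst (\<gamma> t) - fst (\<gamma> 0)\<bar> \<le> \<kappa> * control_length Nm u"
proof -
  obtain E where E: "negligible E"
    "\<And>t. t \<in> {0..1} - E \<Longrightarrow> ((\<lambda>t. fst (\<gamma> t)) has_real_derivative fst (u t)) (at t)"
    using admissibleE[OF adm] by metis
  have "norm (1::real, 0::real) \<le> \<kappa> * Nm (1, 0)" by (rule \<kappa>)
  then have "0 < \<kappa> * Nm (1, 0)" by simp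
  then have \<kappa>0: "0 \<le> \<kappa>" using Nm_ge_0[of "(1, 0)"] by (auto simp: zero_less_mult_iff)
  have ac: "abs_continuous_on {0..1} (\<lambda>t. fst (\<gamma> t))"
    by (rule abs_continuous_on_comp_Lipschitz[where f = \<gamma> and L = 1])
       (use adm abs_component_le_norm(1)[of "\<gamma> t - \<gamma> s" for s t] in \<open>auto simp: admissible_def intro: add_increasing\<close>)
  have int: "((\<lambda>t. fst (u t)) has_integral (fst (\<gamma> t) - fst (\<gamma> 0))) {0..t}"
  proof (rule abs_continuous_fundamental_theorem[OF _ _ E(1)])
    show "abs_continuous_on {0..t} (\<lambda>t. fst (\<gamma> t))"
      by (rule abs_continuous_on_subset[OF ac]) (use t in auto)
  qed (use t E(2) in \<open>auto intro: has_field_derivative_at_within\<close>)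
  have "(\<lambda>t. Nm (u t)) integrable_on {0..1}" using control_length_has_integral[OF adm] by blast
  then have "(\<lambda>t. Nm (u t)) integrable_on {0..t}"
    by (rule integrable_on_subinterval) (use t in auto)
  then obtain l where l: "((\<lambda>t. Nm (u t)) has_integral l) {0..t}" by blast
  have "l \<le> control_length Nm u"
    by (rule has_integral_subset_le[OF _ l control_length_has_integral[OF adm]]) (use t in auto)
  have kl: "((\<lambda>t. \<kappa> * Nm (u t)) has_integral \<kappa> * l) {0..t}" using l by (rule has_integral_mult_right)
  have b: "\<bar>fst v\<bar> \<le> \<kappa> * Nm v" for v
    using norm_fst_le[of "fst v" "snd v"] \<kappa>[of v] by simp
  have "fst (\<gamma> t) - fst (\<gamma> 0) \<le> \<kappa> * l"
    by (rule has_integral_le[OF int kl]) (use b abs_le_iff in blast)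
  moreover have "- (fst (\<gamma> t) - fst (\<gamma> 0)) \<le> \<kappa> * l"
    by (rule has_integral_le[OF has_integral_neg[OF int] kl]) (use b abs_le_iff in blast)
  moreover have "\<kappa> * l \<le> \<kappa> * control_length Nm u"
    using \<open>l \<le> control_length Nm u\<close> \<kappa>0 by (rule mult_left_mono)
  ultimately show ?thesis by linarith
qed

text \<open>The function \<open>z + x * y / 2\<close> is annihilated by \<open>X1\<close> and has
  \<open>X2\<close>-derivative \<open>x\<close>. Hence \<open>H\<close> has horizontal gradient
  \<open>(K' x, k1 + k2 * x)\<close>, a function of \<open>x\<close> alone, and only the first
  coordinate of the curve has to be confined. Integrating the pointwise bound along the curve gives
  the claim.\<close>

lemma calibration_admissible:
  assumes K: "\<And>x. \<bar>x\<bar> < r \<Longrightarrow> (K has_real_derivative K' x) (at x)"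
    and bd: "\<And>x v1 v2. \<bar>x\<bar> < r \<Longrightarrow> K' x * v1 + (k1 + k2 * x) * v2 \<le> L * Nm (v1, v2)"
    and \<kappa>: "\<And>v. norm v \<le> \<kappa> * Nm v" and adm: "admissible \<gamma> u"
    and strip: "\<bar>fst (\<gamma> 0)\<bar> + \<kappa> * control_length Nm u < r"
    and H: "\<And>x y z. H (x, y, z) = K x + k1 * y + k2 * (z + x * y / 2)"
  shows "H (\<gamma> 1) - H (\<gamma> 0) \<le> L * control_length Nm u"
proof -
  obtain E where E: "negligible E"
    and d1: "\<And>t. t \<in> {0..1} - E \<Longrightarrow> ((\<lambda>t. fst (\<gamma> t)) has_real_derivative fst (u t)) (at t)"
    and d2: "\<And>t. t \<in> {0..1} - E \<Longrightarrow> ((\<lambda>t. fst (snd (\<gamma> t))) has_real_derivative snd (u t)) (at t)"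
    and d3: "\<And>t. t \<in> {0..1} - E \<Longrightarrow> ((\<lambda>t. snd (snd (\<gamma> t))) has_real_derivative
        (fst (\<gamma> t) * snd (u t) - fst (snd (\<gamma> t)) * fst (u t)) / 2) (at t)"
    using admissibleE[OF adm] by metis
  define x y z where "x t = fst (\<gamma> t)" and "y t = fst (snd (\<gamma> t))" and "z t = snd (snd (\<gamma> t))" for t
  note xyz = x_def y_def z_def
  have ac: "abs_continuous_on {0..1} \<gamma>" using adm by (simp add: admissible_def)
  have xr: "\<bar>x t\<bar> < r" if "t \<in> {0..1}" for t
    using admissible_x_le[OF \<kappa> adm that] strip by (auto simp: x_def)
  have "compact (\<gamma> ` {0..1})"
    by (intro compact_continuous_image abs_continuous_imp_continuous[OF ac]) auto
  then obtain B where B: "B > 0" "\<And>t. t \<in> {0..1} \<Longrightarrow> norm (\<gamma> t) \<le> B"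
    using compact_imp_bounded bounded_pos by (metis imageI)
  have nrm: "\<bar>x t\<bar> \<le> norm (\<gamma> t)" "\<bar>y t\<bar> \<le> norm (\<gamma> t)"
     "\<bar>x t - x s\<bar> \<le> norm (\<gamma> t - \<gamma> s)" "\<bar>y t - y s\<bar> \<le> norm (\<gamma> t - \<gamma> s)" "\<bar>z t - z s\<bar> \<le> norm (\<gamma> t - \<gamma> s)" for s t
    using abs_component_le_norm[of "\<gamma> t"] abs_component_le_norm[of "\<gamma> t - \<gamma> s"] by (simp_all add: xyz)
  \<comment> \<open>Testing \<open>bd\<close> with \<open>(1, 0)\<close> and \<open>(-1, 0)\<close>
    bounds \<open>K'\<close>; this makes \<open>K\<close> Lipschitz and \<open>H\<close> absolutely
    continuous along the curve.\<close>
  define M where "M = \<bar>L\<bar> * Nm (1, 0)"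
  have K'M: "\<bar>K' x\<bar> \<le> M" if "\<bar>x\<bar> < r" for x
  proof -
    have "L * Nm (1, 0) \<le> M" unfolding M_def by (intro mult_right_mono) auto
    moreover have "Nm (-1, 0) = Nm (1, 0)" using Nm_minus[of "(1, 0)"] by simp
    ultimately show ?thesis using bd[OF that, of 1 0] bd[OF that, of "-1" 0] by auto
  qed
  have KL: "\<bar>K b - K a\<bar> \<le> M * \<bar>b - a\<bar>" if ab: "\<bar>a\<bar> < r" "\<bar>b\<bar> < r" for a b
  proof -
    have "norm (K b - K a) \<le> M * norm (b - a)"
    proof (rule field_differentiable_bound[of "{-r<..<r}" K K'])
      show "(K has_field_derivative K' c) (at c within {-r<..<r})" if "c \<in> {-r<..<r}" for c
        using K[of c] that by (auto intro: has_field_derivative_at_within)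
      show "norm (K' c) \<le> M" if "c \<in> {-r<..<r}" for c using K'M[of c] that by auto
    qed (use ab in auto)
    then show ?thesis by simp
  qed
  define C where "C = M + \<bar>k1\<bar> + \<bar>k2\<bar> * (1 + B)"
  have "M \<ge> 0" by (simp add: M_def)
  have acH: "abs_continuous_on {0..1} (\<lambda>t. H (\<gamma> t))"
  proof (rule abs_continuous_on_comp_Lipschitz[OF ac, of _ C])
    fix s t :: real assume st: "s \<in> {0..1}" "t \<in> {0..1}" "s \<le> t"
    define n where "n = norm (\<gamma> t - \<gamma> s)"
    have Heq: "H (\<gamma> t) = K (x t) + k1 * y t + k2 * (z t + x t * y t / 2)" for t
      using H[of "x t" "y t" "z t"] by (simp add: xyz)
    have "\<bar>K (x t) - K (x s)\<bar> \<le> M * n"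
      using KL[OF xr xr, OF st(1,2)] nrm(3)[of t s] \<open>M \<ge> 0\<close> unfolding n_def by (meson mult_left_mono order_trans)
    moreover have "\<bar>k1 * y t - k1 * y s\<bar> \<le> \<bar>k1\<bar> * n"
      using nrm(4)[of t s] by (simp add: n_def right_diff_distrib[symmetric] abs_mult mult_left_mono)
    moreover have "\<bar>k2 * (z t + x t * y t / 2) - k2 * (z s + x s * y s / 2)\<bar> \<le> \<bar>k2\<bar> * ((1 + B) * n)"
    proof -
      have "\<bar>x t * y t - x s * y s\<bar> = \<bar>x t * (y t - y s) + y s * (x t - x s)\<bar>" by (simp add: algebra_simps)
      also have "\<dots> \<le> \<bar>x t\<bar> * \<bar>y t - y s\<bar> + \<bar>y s\<bar> * \<bar>x t - x s\<bar>"
        using abs_triangle_ineq by (metis abs_mult)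
      also have "\<dots> \<le> B * n + B * n"
        using nrm(1)[of t] nrm(2)[of s] nrm(3,4)[of t s] B(2)[OF st(1)] B(2)[OF st(2)] unfolding n_def
        by (intro add_mono mult_mono) auto
      finally have "\<bar>(z t + x t * y t / 2) - (z s + x s * y s / 2)\<bar> \<le> n + B * n"
        using nrm(5)[of t s] unfolding n_def by (auto simp: abs_le_iff field_simps)
      then show ?thesis
        unfolding right_diff_distrib[symmetric] abs_mult
        by (intro mult_left_mono) (auto simp: algebra_simps)
    qed
    ultimately have "\<bar>H (\<gamma> t) - H (\<gamma> s)\<bar> \<le> C * n"
      unfolding Heq C_def by (simp add: algebra_simps) linarith
    moreover have "C \<ge> 0" using \<open>M \<ge> 0\<close> B by (simp add: C_def)
    ultimately show "norm (H (\<gamma> t) - H (\<gamma> s)) \<le> C * (t - s + norm (\<gamma> t - \<gamma> s))"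
      unfolding n_def real_norm_def using st(3) by (elim order_trans) (intro mult_left_mono, auto)
  qed
  define g where "g t = K' (x t) * fst (u t) + (k1 + k2 * x t) * snd (u t)" for t
  have "(g has_integral (H (\<gamma> 1) - H (\<gamma> 0))) {0..1}"
  proof (rule abs_continuous_fundamental_theorem[OF acH _ E])
    fix t :: real assume t: "t \<in> {0..1} - E"
    have "((\<lambda>t. K (x t) + k1 * y t + k2 * (z t + x t * y t / 2)) has_real_derivative g t) (at t)"
    proof -
      have dx: "(x has_real_derivative fst (u t)) (at t)" and dy: "(y has_real_derivative snd (u t)) (at t)"
        and dz: "(z has_real_derivative (x t * snd (u t) - y t * fst (u t)) / 2) (at t)"
        using d1[OF t] d2[OF t] d3[OF t] unfolding xyz .
      have dK: "((\<lambda>t. K (x t)) has_real_derivative K' (x t) * fst (u t)) (at t)"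
        by (rule DERIV_chain2[OF K[OF xr] dx]) (use t in auto)
      have "((\<lambda>t. K (x t) + k1 * y t + k2 * (z t + x t * y t / 2)) has_real_derivative
          (K' (x t) * fst (u t) + k1 * snd (u t) + k2 * ((x t * snd (u t) - y t * fst (u t)) / 2
             + (fst (u t) * y t + snd (u t) * x t) / 2))) (at t)"
        by (intro dK dx dy dz DERIV_add DERIV_cmult DERIV_mult DERIV_cdivide)
      then show ?thesis unfolding g_def by (rule DERIV_cong) (simp add: field_simps)
    qed
    moreover have "(\<lambda>t. H (\<gamma> t)) = (\<lambda>t. K (x t) + k1 * y t + k2 * (z t + x t * y t / 2))"
      using H[of "x t" "y t" "z t" for t] by (simp add: xyz)
    ultimately show "((\<lambda>t. H (\<gamma> t)) has_real_derivative g t) (at t within {0..1})"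
      by (simp add: has_field_derivative_at_within)
  qed simp
  then show ?thesis
  proof (rule has_integral_le[OF _ has_integral_mult_right[OF control_length_has_integral[OF adm]]])
    show "g t \<le> L * Nm (u t)" if "t \<in> {0..1}" for t
      using bd[OF xr[OF that], of "fst (u t)" "snd (u t)"] by (simp add: g_def)
  qed
qed


lemma admissible_C1:
  assumes \<gamma>: "\<And>t. (\<gamma> has_vector_derivative (fst (u t) *\<^sub>R X1 (\<gamma> t) + snd (u t) *\<^sub>R X2 (\<gamma> t))) (at t)"
    and u: "continuous_on UNIV u"
  shows "admissible \<gamma> u"
proof -
  define D where "D t = fst (u t) *\<^sub>R X1 (\<gamma> t) + snd (u t) *\<^sub>R X2 (\<gamma> t)" for t
  have c\<gamma>: "continuous_on {0..1} \<gamma>"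
    by (meson \<gamma> continuous_at_imp_continuous_on has_vector_derivative_continuous)
  have cu: "continuous_on {0..1} u" using u by (rule continuous_on_subset) simp
  have cD: "continuous_on {0..1} D"
    unfolding D_def X1_def X2_def by (intro continuous_intros c\<gamma> cu) auto
  then have "compact (D ` {0..1})" by (intro compact_continuous_image) auto
  then obtain B where B: "B > 0" "\<And>t. t \<in> {0..1} \<Longrightarrow> norm (D t) \<le> B"
    using compact_imp_bounded bounded_pos by (metis imageI)
  have "abs_continuous_on {0..1} \<gamma>"
  proof (rule abs_continuous_on_Lipschitz[where L = B])
    fix s t :: real assume st: "s \<in> {0..1}" "t \<in> {0..1}" "s \<le> t"
    have "(D has_integral (\<gamma> t - \<gamma> s)) {s..t}"
      by (rule fundamental_theorem_of_calculus[OF st(3)])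
         (use \<gamma> in \<open>auto simp: D_def intro: has_vector_derivative_at_within\<close>)
    then have "norm (\<gamma> t - \<gamma> s) \<le> B * measure lborel {s..t}"
      using B st by (intro has_integral_bound_real[where f = D]) auto
    then show "norm (\<gamma> t - \<gamma> s) \<le> B * (t - s)" using st by simp
  qed
  moreover have "u \<in> borel_measurable (lebesgue_on {0..1})"
    by (rule continuous_imp_measurable_on_sets_lebesgue[OF cu]) auto
  moreover have "integrable (lebesgue_on {0..1}) (\<lambda>t. (norm (u t))\<^sup>2)"
    by (intro continuous_imp_integrable_real continuous_intros cu)
  ultimately show ?thesis using \<gamma> by (simp add: admissible_def)
qed

text \<open>Adding \<open>(\<xi>1, \<xi>2)\<close> to the horizontal projection changes the vertical
  speed by products of \<open>\<xi>1\<close> and \<open>\<xi>2\<close> with the old control.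
  Integration by parts moves these into the boundary term and leaves the continuous integrand
  \<open>h\<close>, in which \<open>u\<close> no longer occurs.\<close>

lemma admissible_add:
  fixes \<xi>1 \<xi>2 v1 v2 :: "real \<Rightarrow> real"
  assumes adm: "admissible \<gamma> u"
    and \<xi>: "\<And>t. (\<xi>1 has_real_derivative v1 t) (at t)" "\<And>t. (\<xi>2 has_real_derivative v2 t) (at t)"
    and v: "continuous_on UNIV v1" "continuous_on UNIV v2" and 0: "\<xi>1 0 = 0" "\<xi>2 0 = 0"
    and h: "h = (\<lambda>t. fst (\<gamma> t) * v2 t - fst (snd (\<gamma> t)) * v1 t + (\<xi>1 t * v2 t - \<xi>2 t * v1 t) / 2)"
  shows "\<exists>\<gamma>'. admissible \<gamma>' (\<lambda>t. u t + (v1 t, v2 t)) \<and> \<gamma>' 0 = \<gamma> 0 \<and>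
     \<gamma>' 1 = (fst (\<gamma> 1) + \<xi>1 1, fst (snd (\<gamma> 1)) + \<xi>2 1, snd (snd (\<gamma> 1)) +
       (\<xi>1 1 * fst (snd (\<gamma> 1)) - \<xi>2 1 * fst (\<gamma> 1)) / 2 + integral {0..1} h)"
proof -
  obtain E where E: "negligible E"
    and d1: "\<And>t. t \<in> {0..1} - E \<Longrightarrow> ((\<lambda>t. fst (\<gamma> t)) has_real_derivative fst (u t)) (at t)"
    and d2: "\<And>t. t \<in> {0..1} - E \<Longrightarrow> ((\<lambda>t. fst (snd (\<gamma> t))) has_real_derivative snd (u t)) (at t)"
    and d3: "\<And>t. t \<in> {0..1} - E \<Longrightarrow> ((\<lambda>t. snd (snd (\<gamma> t))) has_real_derivative
        (fst (\<gamma> t) * snd (u t) - fst (snd (\<gamma> t)) * fst (u t)) / 2) (at t)"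
    using admissibleE[OF adm] by metis
  define x y z where "x t = fst (\<gamma> t)" and "y t = fst (snd (\<gamma> t))" and "z t = snd (snd (\<gamma> t))" for t
  note xyz = x_def y_def z_def
  have ac: "abs_continuous_on {0..1} \<gamma>" and um: "u \<in> borel_measurable (lebesgue_on {0..1})"
    and u2: "integrable (lebesgue_on {0..1}) (\<lambda>t. (norm (u t))\<^sup>2)" using adm by (auto simp: admissible_def)
  have c\<gamma>: "continuous_on {0..1} \<gamma>" by (rule abs_continuous_imp_continuous[OF ac])
  have c\<xi>: "continuous_on S \<xi>1" "continuous_on S \<xi>2" for S
    using \<xi> by (meson DERIV_isCont continuous_at_imp_continuous_on)+
  have cv: "continuous_on S v1" "continuous_on S v2" for S
    using v by (meson continuous_on_subset subset_UNIV)+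
  have ch: "continuous_on {0..1} h"
    unfolding h by (intro continuous_intros c\<gamma> c\<xi> cv) auto
  define G where "G t = integral {0..t} h" for t
  have dG: "(G has_real_derivative h t) (at t within {0..1})" if "t \<in> {0..1}" for t
    unfolding G_def by (rule integral_has_real_derivative[OF ch that])
  have bex: "\<exists>B>0. \<forall>t\<in>{0..1}. norm (f t) \<le> B" if "continuous_on {0..1} f" for f :: "real \<Rightarrow> 'x::real_normed_vector"
    using compact_imp_bounded[OF compact_continuous_image[OF that]] bounded_pos by (metis compact_Icc imageI)
  obtain B where B: "B > 0" "\<And>t. t \<in> {0..1} \<Longrightarrow> norm (\<gamma> t) \<le> B" using bex[OF c\<gamma>] by auto
  have "continuous_on {0..1} (\<lambda>t. \<bar>v1 t\<bar> + \<bar>v2 t\<bar>)" "continuous_on {0..1} (\<lambda>t. \<bar>\<xi>1 t\<bar> + \<bar>\<xi>2 t\<bar>)"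
    by (intro continuous_intros cv c\<xi>)+
  from bex[OF this(1)] bex[OF this(2)] obtain V X where
    V: "V > 0" "\<And>t. t \<in> {0..1} \<Longrightarrow> \<bar>v1 t\<bar> \<le> V" "\<And>t. t \<in> {0..1} \<Longrightarrow> \<bar>v2 t\<bar> \<le> V" and
    X: "X > 0" "\<And>t. t \<in> {0..1} \<Longrightarrow> \<bar>\<xi>1 t\<bar> \<le> X" "\<And>t. t \<in> {0..1} \<Longrightarrow> \<bar>\<xi>2 t\<bar> \<le> X" by fastforce
  obtain Hb where Hb: "Hb > 0" "\<And>t. t \<in> {0..1} \<Longrightarrow> \<bar>h t\<bar> \<le> Hb" using bex[OF ch] by auto
  have L\<xi>1: "\<bar>\<xi>1 t - \<xi>1 s\<bar> \<le> V * \<bar>t - s\<bar>" and L\<xi>2: "\<bar>\<xi>2 t - \<xi>2 s\<bar> \<le> V * \<bar>t - s\<bar>"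
    and LG: "\<bar>G t - G s\<bar> \<le> Hb * \<bar>t - s\<bar>" if "s \<in> {0..1}" "t \<in> {0..1}" for s t
    using field_differentiable_bound[of "{0..1}" \<xi>1 v1 V t s] field_differentiable_bound[of "{0..1}" \<xi>2 v2 V t s]
      field_differentiable_bound[of "{0..1}" G h Hb t s] that V Hb dG has_field_derivative_at_within[OF \<xi>(1)]
      has_field_derivative_at_within[OF \<xi>(2)] by auto
  define \<gamma>' where "\<gamma>' t = (x t + \<xi>1 t, y t + \<xi>2 t, z t + (\<xi>1 t * y t - \<xi>2 t * x t) / 2 + G t)" for t
  define v where "v t = (v1 t, v2 t)" for t
  have "abs_continuous_on {0..1} \<gamma>'"
  proof (rule abs_continuous_on_comp_Lipschitz[OF ac, of _ "3 + X + 2 * V + B * V + Hb"])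
    fix s t :: real assume st: "s \<in> {0..1}" "t \<in> {0..1}" "s \<le> t"
    define n d where "n = norm (\<gamma> t - \<gamma> s)" and "d = t - s"
    have nd: "0 \<le> n" "0 \<le> d" using st by (auto simp: n_def d_def)
    have nrm: "\<bar>x t - x s\<bar> \<le> n" "\<bar>y t - y s\<bar> \<le> n" "\<bar>z t - z s\<bar> \<le> n" "\<bar>x s\<bar> \<le> B" "\<bar>y s\<bar> \<le> B"
      using abs_component_le_norm[of "\<gamma> t - \<gamma> s"] abs_component_le_norm[of "\<gamma> s"] B(2)[OF st(1)]
      by (simp_all add: xyz n_def)
    have lx: "\<bar>\<xi>1 t - \<xi>1 s\<bar> \<le> V * d" "\<bar>\<xi>2 t - \<xi>2 s\<bar> \<le> V * d" "\<bar>G t - G s\<bar> \<le> Hb * d"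
      using L\<xi>1[OF st(1,2)] L\<xi>2[OF st(1,2)] LG[OF st(1,2)] st(3) by (simp_all add: d_def)
    have pr: "\<bar>\<xi> t * w t - \<xi> s * w s\<bar> \<le> X * n + B * (V * d)"
      if "\<bar>\<xi> t\<bar> \<le> X" "\<bar>w s\<bar> \<le> B" "\<bar>w t - w s\<bar> \<le> n" "\<bar>\<xi> t - \<xi> s\<bar> \<le> V * d" for \<xi> w :: "real \<Rightarrow> real"
    proof -
      have "\<bar>\<xi> t * w t - \<xi> s * w s\<bar> = \<bar>\<xi> t * (w t - w s) + w s * (\<xi> t - \<xi> s)\<bar>" by (simp add: algebra_simps)
      also have "\<dots> \<le> \<bar>\<xi> t\<bar> * \<bar>w t - w s\<bar> + \<bar>w s\<bar> * \<bar>\<xi> t - \<xi> s\<bar>"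
        using abs_triangle_ineq by (metis abs_mult)
      also have "\<dots> \<le> X * n + B * (V * d)" using that X B by (intro add_mono mult_mono) auto
      finally show ?thesis .
    qed
    have "norm (\<gamma>' t - \<gamma>' s) \<le> \<bar>fst (\<gamma>' t - \<gamma>' s)\<bar> + (\<bar>fst (snd (\<gamma>' t - \<gamma>' s))\<bar> + \<bar>snd (snd (\<gamma>' t - \<gamma>' s))\<bar>)"
      using norm_Pair_le[of "fst (\<gamma>' t - \<gamma>' s)" "snd (\<gamma>' t - \<gamma>' s)"]
        norm_Pair_le[of "fst (snd (\<gamma>' t - \<gamma>' s))" "snd (snd (\<gamma>' t - \<gamma>' s))"]
      unfolding prod.collapse real_norm_def by linarith
    moreover have "\<bar>fst (\<gamma>' t - \<gamma>' s)\<bar> \<le> n + V * d" "\<bar>fst (snd (\<gamma>' t - \<gamma>' s))\<bar> \<le> n + V * d"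
      using nrm(1,2) lx(1,2) unfolding \<gamma>'_def fst_diff snd_diff fst_conv snd_conv by linarith+
    moreover have "\<bar>snd (snd (\<gamma>' t - \<gamma>' s))\<bar> \<le> n + (X * n + B * (V * d)) + Hb * d"
    proof -
      have "\<bar>\<xi>1 t * y t - \<xi>1 s * y s\<bar> \<le> X * n + B * (V * d)" "\<bar>\<xi>2 t * x t - \<xi>2 s * x s\<bar> \<le> X * n + B * (V * d)"
        by (intro pr X(2,3) st nrm lx)+
      moreover have *: "\<bar>z1 + (a1 - b1) / 2 + g1 - (z0 + (a0 - b0) / 2 + g0)\<bar> \<le> n + Q + h"
        if "\<bar>a1 - a0\<bar> \<le> Q" "\<bar>b1 - b0\<bar> \<le> Q" "\<bar>z1 - z0\<bar> \<le> n" "\<bar>g1 - g0\<bar> \<le> h" for z1 a1 b1 g1 z0 a0 b0 g0 n Q h :: real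
        using that unfolding abs_le_iff by (simp add: field_simps)
      ultimately show ?thesis
        using nrm(3) lx(3) unfolding \<gamma>'_def fst_diff snd_diff fst_conv snd_conv by blast
    qed
    ultimately have "norm (\<gamma>' t - \<gamma>' s) \<le> (3 + X) * n + (2 * V + B * V + Hb) * d"
      by (simp add: algebra_simps)
    also have "\<dots> \<le> (3 + X + 2 * V + B * V + Hb) * n + (3 + X + 2 * V + B * V + Hb) * d"
    proof (rule add_mono)
      show "(3 + X) * n \<le> (3 + X + 2 * V + B * V + Hb) * n"
        using V(1) Hb(1) mult_pos_pos[OF B(1) V(1)] by (intro mult_right_mono nd) linarith
      show "(2 * V + B * V + Hb) * d \<le> (3 + X + 2 * V + B * V + Hb) * d"
        using X(1) by (intro mult_right_mono nd) linarith
    qed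
    finally show "norm (\<gamma>' t - \<gamma>' s) \<le> (3 + X + 2 * V + B * V + Hb) * (t - s + norm (\<gamma> t - \<gamma> s))"
      by (simp add: n_def d_def algebra_simps)
  qed
  moreover have vm: "(\<lambda>t. u t + v t) \<in> borel_measurable (lebesgue_on {0..1})"
    by (intro borel_measurable_add um continuous_imp_measurable_on_sets_lebesgue) (auto simp: v_def intro!: continuous_intros cv)
  moreover have "integrable (lebesgue_on {0..1}) (\<lambda>t. (norm (u t + v t))\<^sup>2)"
  proof (rule Bochner_Integration.integrable_bound)
    show "integrable (lebesgue_on {0..1}) (\<lambda>t. 2 * (norm (u t))\<^sup>2 + 2 * (norm (v t))\<^sup>2)"
      by (intro Bochner_Integration.integrable_add integrable_mult_right u2 continuous_imp_integrable_real)
         (auto simp: v_def intro!: continuous_intros cv)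
    show "(\<lambda>t. (norm (u t + v t))\<^sup>2) \<in> borel_measurable (lebesgue_on {0..1})" using vm by measurable
    show "AE t in lebesgue_on {0..1}. norm ((norm (u t + v t))\<^sup>2) \<le> norm (2 * (norm (u t))\<^sup>2 + 2 * (norm (v t))\<^sup>2)"
    proof (rule AE_I2)
      fix t
      have "(norm (u t + v t))\<^sup>2 \<le> (norm (u t) + norm (v t))\<^sup>2"
        by (intro power_mono norm_triangle_ineq) auto
      also have "\<dots> \<le> 2 * (norm (u t))\<^sup>2 + 2 * (norm (v t))\<^sup>2"
        using zero_le_power2[of "norm (u t) - norm (v t)"] by (simp add: power2_eq_square algebra_simps)
      finally show "norm ((norm (u t + v t))\<^sup>2) \<le> norm (2 * (norm (u t))\<^sup>2 + 2 * (norm (v t))\<^sup>2)" by simp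
    qed
  qed
  moreover have "AE t in lebesgue_on {0..1}. (\<gamma>' has_vector_derivative
       (fst (u t + v t) *\<^sub>R X1 (\<gamma>' t) + snd (u t + v t) *\<^sub>R X2 (\<gamma>' t))) (at t)"
  proof -
    \<comment> \<open>The end points \<open>0\<close> and \<open>1\<close> join the exceptional set
      because the derivative of \<open>G\<close> is available there from one side only.\<close>
    have der: "(\<gamma>' has_vector_derivative
       (fst (u t + v t) *\<^sub>R X1 (\<gamma>' t) + snd (u t + v t) *\<^sub>R X2 (\<gamma>' t))) (at t)" if t: "t \<in> {0..1} - (E \<union> {0, 1})" for t
    proof -
      have tE: "t \<in> {0..1} - E" and t01: "t \<in> {0<..<1}" using t by auto
      have dG': "(G has_real_derivative h t) (at t)"
        using dG[of t] t01 at_within_Icc_at[of 0 t 1] by simp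
      have e1: "((\<lambda>t. x t + \<xi>1 t) has_real_derivative fst (u t) + v1 t) (at t)"
        unfolding xyz by (intro derivative_intros d1[OF tE] \<xi>)
      have e2: "((\<lambda>t. y t + \<xi>2 t) has_real_derivative snd (u t) + v2 t) (at t)"
        unfolding xyz by (intro derivative_intros d2[OF tE] \<xi>)
      have dx: "(x has_real_derivative fst (u t)) (at t)" and dy: "(y has_real_derivative snd (u t)) (at t)"
        and dz: "(z has_real_derivative (x t * snd (u t) - y t * fst (u t)) / 2) (at t)"
        using d1[OF tE] d2[OF tE] d3[OF tE] unfolding xyz .
      have "((\<lambda>t. z t + (\<xi>1 t * y t - \<xi>2 t * x t) / 2 + G t) has_real_derivative
          ((x t * snd (u t) - y t * fst (u t)) / 2 + ((v1 t * y t + snd (u t) * \<xi>1 t) - (v2 t * x t + fst (u t) * \<xi>2 t)) / 2 + h t)) (at t)"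
        by (intro dx dy dz \<xi> dG' DERIV_add DERIV_diff DERIV_mult DERIV_cdivide)
      then have e3: "((\<lambda>t. z t + (\<xi>1 t * y t - \<xi>2 t * x t) / 2 + G t) has_real_derivative
          ((x t + \<xi>1 t) * (snd (u t) + v2 t) - (y t + \<xi>2 t) * (fst (u t) + v1 t)) / 2) (at t)"
        by (rule DERIV_cong) (simp add: h xyz field_simps)
      have "(\<gamma>' has_vector_derivative (fst (u t) + v1 t, snd (u t) + v2 t,
          ((x t + \<xi>1 t) * (snd (u t) + v2 t) - (y t + \<xi>2 t) * (fst (u t) + v1 t)) / 2)) (at t)"
        unfolding \<gamma>'_def using e1 e2 e3 unfolding has_real_derivative_iff_has_vector_derivative
        by (intro has_vector_derivative_Pair)
      then show ?thesis by (simp add: X1_def X2_def \<gamma>'_def v_def algebra_simps diff_divide_distrib add_divide_distrib)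
    qed
    have "negligible (E \<union> {0, 1})" using E by (simp add: negligible_Un)
    then have "AE t in lebesgue. t \<in> {0..1} \<longrightarrow> (\<gamma>' has_vector_derivative
       (fst (u t + v t) *\<^sub>R X1 (\<gamma>' t) + snd (u t + v t) *\<^sub>R X2 (\<gamma>' t))) (at t)"
      unfolding eventually_ae_filter_negligible using der by blast
    then show ?thesis by (subst AE_restrict_space_iff) auto
  qed
  ultimately have "admissible \<gamma>' (\<lambda>t. u t + v t)" by (simp add: admissible_def)
  then show ?thesis
    by (intro exI[of _ \<gamma>']) (simp add: v_def \<gamma>'_def 0 G_def xyz)
qed


text \<open>The root with the sign of \<open>J\<close> is taken: then \<open>m * J \<ge> 0\<close>,
  so \<open>c * m\<^sup>2 \<le> d\<close> however large \<open>J\<close> is.\<close>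

lemma quadratic_root_bound:
  fixes J d c :: real
  assumes "d \<ge> 0" "c > 0"
  obtains m where "m * J + c * m\<^sup>2 = d" "\<bar>m\<bar> \<le> sqrt (d / c)"
proof -
  have *: "\<exists>m. m * J + c * m\<^sup>2 = d \<and> \<bar>m\<bar> \<le> sqrt (d / c)" if "J \<ge> 0" for J :: real
  proof -
    define s where "s = sqrt (J\<^sup>2 + 4 * c * d)"
    define m where "m = (s - J) / (2 * c)"
    have s2: "s\<^sup>2 = J\<^sup>2 + 4 * c * d" using assms by (simp add: s_def)
    have "J \<le> s" unfolding s_def using assms that by (intro real_le_rsqrt) simp
    then have "m \<ge> 0" using assms by (simp add: m_def)
    have "s = 2 * c * m + J" using assms by (simp add: m_def)
    then have "c * (m * J + c * m\<^sup>2 - d) = 0" using s2 by (simp add: power2_eq_square algebra_simps)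
    then have eq: "m * J + c * m\<^sup>2 = d" using assms by simp
    then have "c * m\<^sup>2 \<le> d" using \<open>m \<ge> 0\<close> that by (smt (verit) mult_nonneg_nonneg)
    then have "\<bar>m\<bar> \<le> sqrt (d / c)" using assms \<open>m \<ge> 0\<close> by (simp add: real_le_rsqrt field_simps)
    then show ?thesis using eq by blast
  qed
  show thesis
  proof (cases "J \<ge> 0")
    case True then show thesis using * that by blast
  next
    case False
    then obtain m where "m * - J + c * m\<^sup>2 = d" "\<bar>m\<bar> \<le> sqrt (d / c)" using *[of "- J"] by auto
    then show thesis using that[of "- m"] by simp
  qed
qed

text \<open>The end point of an admissible curve is corrected by adding a linear motion and a small round loop to
  its projection: the loop contributes \<open>\<plusminus> pi * m\<^sup>2\<close> to the vertical coordinate, and its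
  orientation and radius are free.\<close>

lemma admissible_perturb:
  assumes adm: "admissible \<gamma> u"
  obtains k B where "k > 0" "B > 0"
    "\<And>q. \<exists>\<gamma>' u'. admissible \<gamma>' u' \<and> \<gamma>' 0 = \<gamma> 0 \<and> \<gamma>' 1 = q \<and> control_length Nm u' \<le>
        control_length Nm u + k * (2 * norm (q - \<gamma> 1) + 4 * pi * sqrt ((1 + 3 * B) * norm (q - \<gamma> 1) / pi))"
proof -
  obtain k where k: "k > 0" "\<And>x. Nm x \<le> k * norm x" using Nm_le_norm by blast
  have c\<gamma>: "continuous_on {0..1} \<gamma>" using adm by (simp add: admissible_def abs_continuous_imp_continuous)
  obtain B where B: "B > 0" "\<And>t. t \<in> {0..1} \<Longrightarrow> norm (\<gamma> t) \<le> B"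
    using compact_imp_bounded[OF compact_continuous_image[OF c\<gamma>]] bounded_pos by (metis compact_Icc imageI)
  have main: "\<exists>\<gamma>' u'. admissible \<gamma>' u' \<and> \<gamma>' 0 = \<gamma> 0 \<and> \<gamma>' 1 = q \<and> control_length Nm u' \<le>
        control_length Nm u + k * (2 * norm (q - \<gamma> 1) + 4 * pi * sqrt ((1 + 3 * B) * norm (q - \<gamma> 1) / pi))" for q
  proof -
    define D where "D = norm (q - \<gamma> 1)"
    define x y where "x t = fst (\<gamma> t)" and "y t = fst (snd (\<gamma> t))" for t
    define dx dy where "dx = fst q - x 1" and "dy = fst (snd q) - y 1"
    define I0 where "I0 = integral {0..1} (\<lambda>t. x t * dy - y t * dx)"
    \<comment> \<open>The vertical defect that remains after the linear motion
      \<open>(t * dx, t * dy)\<close> has been added.\<close>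
    define dz where "dz = snd (snd q) - snd (snd (\<gamma> 1)) - (dx * y 1 - dy * x 1) / 2 - I0"
    define \<sigma> :: real where "\<sigma> = (if dz \<ge> 0 then 1 else -1)"
    have \<sigma>: "\<sigma> * \<sigma> = 1" "\<bar>\<sigma>\<bar> = 1" "\<sigma> * dz = \<bar>dz\<bar>" by (auto simp: \<sigma>_def)
    have cxy: "continuous_on {0..1} x" "continuous_on {0..1} y"
      unfolding x_def y_def by (intro continuous_intros c\<gamma>)+
    \<comment> \<open>This is the coefficient of the amplitude \<open>m\<close> in the vertical
      integrand. The quadratic coefficient is \<open>\<sigma> * pi * (1 - cos (2 * pi * t))\<close>,
      with integral \<open>\<sigma> * pi\<close>. So the end point is hit when
      \<open>m * J + \<sigma> * pi * m\<^sup>2 = dz\<close>, which is solvable because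
      \<open>\<sigma>\<close> has the sign of \<open>dz\<close>.\<close>
    define j where "j t = 2 * pi * \<sigma> * x t * sin (2 * pi * t) - 2 * pi * y t * cos (2 * pi * t)
      + (t * dx * \<sigma> * 2 * pi * sin (2 * pi * t) + dy * sin (2 * pi * t)
         - \<sigma> * (1 - cos (2 * pi * t)) * dx - t * dy * 2 * pi * cos (2 * pi * t)) / 2" for t
    define J where "J = integral {0..1} j"
    obtain m where m: "m * (\<sigma> * J) + pi * m\<^sup>2 = \<bar>dz\<bar>" "\<bar>m\<bar> \<le> sqrt (\<bar>dz\<bar> / pi)"
      using quadratic_root_bound[of "\<bar>dz\<bar>" pi "\<sigma> * J"] by auto
    have meq: "m * J + \<sigma> * pi * m\<^sup>2 = dz"
      using m(1) by (cases "dz \<ge> 0") (auto simp: \<sigma>_def)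
    define \<xi>1 \<xi>2 v1 v2 where "\<xi>1 t = t * dx + m * sin (2 * pi * t)" and "\<xi>2 t = t * dy + \<sigma> * m * (1 - cos (2 * pi * t))"
      and "v1 t = dx + m * (2 * pi) * cos (2 * pi * t)" and "v2 t = dy + \<sigma> * m * (2 * pi) * sin (2 * pi * t)" for t
    define h where "h = (\<lambda>t. fst (\<gamma> t) * v2 t - fst (snd (\<gamma> t)) * v1 t + (\<xi>1 t * v2 t - \<xi>2 t * v1 t) / 2)"
    have "\<exists>\<gamma>'. admissible \<gamma>' (\<lambda>t. u t + (v1 t, v2 t)) \<and> \<gamma>' 0 = \<gamma> 0 \<and>
     \<gamma>' 1 = (fst (\<gamma> 1) + \<xi>1 1, fst (snd (\<gamma> 1)) + \<xi>2 1, snd (snd (\<gamma> 1)) +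
       (\<xi>1 1 * fst (snd (\<gamma> 1)) - \<xi>2 1 * fst (\<gamma> 1)) / 2 + integral {0..1} h)"
    proof (rule admissible_add[OF adm _ _ _ _ _ _ h_def])
      show "(\<xi>1 has_real_derivative v1 t) (at t)" "(\<xi>2 has_real_derivative v2 t) (at t)" for t
        unfolding \<xi>1_def \<xi>2_def v1_def v2_def by (auto intro!: derivative_eq_intros simp: algebra_simps)
      show "continuous_on UNIV v1" "continuous_on UNIV v2"
        unfolding v1_def v2_def by (intro continuous_intros)+
    qed (simp_all add: \<xi>1_def \<xi>2_def)
    then obtain \<gamma>' where \<gamma>': "admissible \<gamma>' (\<lambda>t. u t + (v1 t, v2 t))" "\<gamma>' 0 = \<gamma> 0"
     "\<gamma>' 1 = (fst (\<gamma> 1) + \<xi>1 1, fst (snd (\<gamma> 1)) + \<xi>2 1, snd (snd (\<gamma> 1)) +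
       (\<xi>1 1 * fst (snd (\<gamma> 1)) - \<xi>2 1 * fst (\<gamma> 1)) / 2 + integral {0..1} h)" by blast
    have int1: "((\<lambda>t. x t * dy - y t * dx) has_integral I0) {0..1}"
      unfolding I0_def by (intro integrable_integral integrable_continuous_interval continuous_intros cxy)
    have int2: "(j has_integral J) {0..1}"
      unfolding J_def j_def
      by (intro integrable_integral integrable_continuous_interval continuous_intros cxy) auto
    have "((\<lambda>t. 1 - cos (2 * pi * t)) has_integral ((1 - sin (2 * pi * 1) / (2 * pi)) - (0 - sin (2 * pi * 0) / (2 * pi)))) {0..1::real}"
      by (rule fundamental_theorem_of_calculus)
         (auto intro!: derivative_eq_intros simp: has_real_derivative_iff_has_vector_derivative[symmetric])
    then have int3: "((\<lambda>t. 1 - cos (2 * pi * t)) has_integral 1) {0..1::real}" by simp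
    have "((\<lambda>t. (x t * dy - y t * dx) + m * j t + (\<sigma> * pi * m\<^sup>2) * (1 - cos (2 * pi * t)))
       has_integral (I0 + m * J + (\<sigma> * pi * m\<^sup>2) * 1)) {0..1}"
      by (intro has_integral_add has_integral_mult_right int1 int2 int3)
    moreover have "h = (\<lambda>t. (x t * dy - y t * dx) + m * j t + (\<sigma> * pi * m\<^sup>2) * (1 - cos (2 * pi * t)))"
    proof
      fix t
      have sc: "sin (pi * (t * 2)) * sin (pi * (t * 2)) = 1 - cos (pi * (t * 2)) * cos (pi * (t * 2))"
        using sin_cos_squared_add[of "pi * (t * 2)"] by (simp add: power2_eq_square)
      show "h t = (x t * dy - y t * dx) + m * j t + (\<sigma> * pi * m\<^sup>2) * (1 - cos (2 * pi * t))"
        unfolding h_def j_def x_def y_def \<xi>1_def \<xi>2_def v1_def v2_def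
        by (simp add: field_simps power2_eq_square, simp add: sc, simp add: algebra_simps)
    qed
    ultimately have "integral {0..1} h = I0 + m * J + (\<sigma> * pi * m\<^sup>2) * 1" by (simp only: integral_unique)
    then have "integral {0..1} h = I0 + (m * J + \<sigma> * pi * m\<^sup>2)" by simp
    then have "integral {0..1} h = I0 + dz" by (simp only: meq)
    then have q: "\<gamma>' 1 = q"
      unfolding \<gamma>'(3) by (simp add: prod_eq_iff \<xi>1_def \<xi>2_def dz_def dx_def dy_def x_def y_def)
    have D: "\<bar>dx\<bar> \<le> D" "\<bar>dy\<bar> \<le> D" "\<bar>snd (snd q) - snd (snd (\<gamma> 1))\<bar> \<le> D" "D \<ge> 0"
      using abs_component_le_norm[of "q - \<gamma> 1"] by (simp_all add: D_def dx_def dy_def x_def y_def)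
    have xyB: "\<bar>x t\<bar> \<le> B" "\<bar>y t\<bar> \<le> B" if "t \<in> {0..1}" for t
      using abs_component_le_norm[of "\<gamma> t"] B(2)[OF that] by (simp_all add: x_def y_def)
    have pB: "\<bar>x t * dy - y t * dx\<bar> \<le> 2 * (B * D)" if "t \<in> {0..1}" for t
    proof -
      have "\<bar>x t * dy\<bar> \<le> B * D" "\<bar>y t * dx\<bar> \<le> B * D"
        unfolding abs_mult using xyB[OF that] D B by (auto intro!: mult_mono)
      then show ?thesis by linarith
    qed
    have "norm I0 \<le> 2 * (B * D) * measure lborel {0..1::real}"
      using pB B D by (intro has_integral_bound_real[OF _ finite.emptyI int1]) auto
    then have "\<bar>I0\<bar> \<le> 2 * (B * D)" by simp
    moreover have "\<bar>(dx * y 1 - dy * x 1) / 2\<bar> \<le> B * D" using pB[of 1] by (simp add: algebra_simps abs_minus_commute)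
    moreover have "\<bar>a - b - c - e\<bar> \<le> r + s + t"
      if "\<bar>a - b\<bar> \<le> r" "\<bar>c\<bar> \<le> s" "\<bar>e\<bar> \<le> t" for a b c e r s t :: real
      using that unfolding abs_le_iff by linarith
    ultimately have "\<bar>dz\<bar> \<le> D + B * D + 2 * (B * D)" using D(3) unfolding dz_def by blast
    then have dz: "\<bar>dz\<bar> \<le> (1 + 3 * B) * D" by (simp add: algebra_simps)
    have mle: "\<bar>m\<bar> \<le> sqrt ((1 + 3 * B) * D / pi)"
      using dz by (intro order_trans[OF m(2)] real_sqrt_le_mono divide_right_mono) auto
    have Nv: "Nm (v1 t, v2 t) \<le> k * (2 * D + 4 * pi * \<bar>m\<bar>)" for t
    proof -
      have "\<bar>v1 t\<bar> \<le> \<bar>dx\<bar> + \<bar>m * (2 * pi) * cos (2 * pi * t)\<bar>" unfolding v1_def by (rule abs_triangle_ineq)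
      also have "\<dots> \<le> D + \<bar>m\<bar> * (2 * pi) * 1" unfolding abs_mult by (intro add_mono D mult_mono) auto
      finally have v1: "\<bar>v1 t\<bar> \<le> D + 2 * pi * \<bar>m\<bar>" by (simp add: mult_ac)
      have "\<bar>v2 t\<bar> \<le> \<bar>dy\<bar> + \<bar>\<sigma> * m * (2 * pi) * sin (2 * pi * t)\<bar>" unfolding v2_def by (rule abs_triangle_ineq)
      also have "\<dots> \<le> D + \<bar>m\<bar> * (2 * pi) * 1" unfolding abs_mult \<sigma> by (intro add_mono D mult_mono) auto
      finally have v2: "\<bar>v2 t\<bar> \<le> D + 2 * pi * \<bar>m\<bar>" by (simp add: mult_ac)
      have "norm (v1 t, v2 t) \<le> 2 * D + 4 * pi * \<bar>m\<bar>"
        using norm_Pair_le[of "v1 t" "v2 t"] v1 v2 by simp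
      then show ?thesis using k(2)[of "(v1 t, v2 t)"] k(1) by (meson mult_left_mono less_imp_le order_trans)
    qed
    have "control_length Nm (\<lambda>t. u t + (v1 t, v2 t)) \<le> control_length Nm u + k * (2 * D + 4 * pi * \<bar>m\<bar>)"
    proof (rule has_integral_le[OF control_length_has_integral[OF \<gamma>'(1)]])
      show "((\<lambda>t. Nm (u t) + k * (2 * D + 4 * pi * \<bar>m\<bar>)) has_integral control_length Nm u + k * (2 * D + 4 * pi * \<bar>m\<bar>)) {0..1}"
        using has_integral_add[OF control_length_has_integral[OF adm] has_integral_const_real[of "k * (2 * D + 4 * pi * \<bar>m\<bar>)" 0 1]]
        by simp
      show "Nm (u t + (v1 t, v2 t)) \<le> Nm (u t) + k * (2 * D + 4 * pi * \<bar>m\<bar>)" for t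
        using Nm_add[of "u t" "(v1 t, v2 t)"] Nv[of t] by linarith
    qed
    also have "\<dots> \<le> control_length Nm u + k * (2 * D + 4 * pi * sqrt ((1 + 3 * B) * D / pi))"
      using mle k by (intro add_left_mono mult_left_mono) auto
    finally show ?thesis using \<gamma>'(1,2) q unfolding D_def by blast
  qed
  show thesis by (rule that[OF k(1) B(1) main])
qed

section \<open>Basic properties of the sub-Finsler distance\<close>

lemma admissible_const: "admissible (\<lambda>_. p) (\<lambda>_. 0)"
  by (rule admissible_C1) (auto intro!: continuous_intros)

lemma admissible_connected: "\<exists>\<gamma> u. admissible \<gamma> u \<and> \<gamma> 0 = p \<and> \<gamma> 1 = q"
proof -
  obtain k B where "\<And>q. \<exists>\<gamma>' u'. admissible \<gamma>' u' \<and> \<gamma>' 0 = p \<and> \<gamma>' 1 = q \<and> control_length Nm u' \<le>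
        control_length Nm (\<lambda>_. 0) + k * (2 * norm (q - p) + 4 * pi * sqrt ((1 + 3 * B) * norm (q - p) / pi))"
    using admissible_perturb[OF admissible_const[of p]] by blast
  then show ?thesis by blast
qed

lemma sf_dist_less:
  assumes "sf_dist Nm p q < l"
  obtains \<gamma> u where "admissible \<gamma> u" "\<gamma> 0 = p" "\<gamma> 1 = q" "control_length Nm u < l"
proof -
  have "{L. \<exists>\<gamma> u. admissible \<gamma> u \<and> \<gamma> 0 = p \<and> \<gamma> 1 = q \<and> L = control_length Nm u} \<noteq> {}"
    using admissible_connected[of p q] by blast
  from cInf_lessD[OF this assms[unfolded sf_dist_def]] show thesis using that by blast
qed

lemma sf_dist_nonneg: "0 \<le> sf_dist Nm p q"
  by (meson control_length_nonneg not_le order_trans sf_dist_less less_imp_le)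

lemma sf_dist_refl: "sf_dist Nm p p = 0"
proof -
  have "control_length Nm (\<lambda>_. 0) = 0" by (simp add: control_length_def)
  then show ?thesis using sf_dist_le[OF admissible_const, of p p p] sf_dist_nonneg[of p p] by simp
qed

text \<open>A curve to \<open>q\<close> of length below \<open>r\<close> is corrected so as to end
  at a nearby point, at an extra cost that tends to zero with the Euclidean distance. Openness will
  give metric balls positive Lebesgue measure.\<close>

lemma open_sf_ball: "open {q. sf_dist Nm p q < r}"
  unfolding open_dist
proof (intro ballI, unfold mem_Collect_eq)
  fix q assume "sf_dist Nm p q < r"
  then obtain \<gamma> u where adm: "admissible \<gamma> u" and \<gamma>: "\<gamma> 0 = p" "\<gamma> 1 = q" and l: "control_length Nm u < r"
    by (rule sf_dist_less)
  obtain k B where k: "k > 0" "B > 0"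
    and kB: "\<And>q. \<exists>\<gamma>' u'. admissible \<gamma>' u' \<and> \<gamma>' 0 = \<gamma> 0 \<and> \<gamma>' 1 = q \<and> control_length Nm u' \<le>
        control_length Nm u + k * (2 * norm (q - \<gamma> 1) + 4 * pi * sqrt ((1 + 3 * B) * norm (q - \<gamma> 1) / pi))"
    using admissible_perturb[OF adm] by blast
  have "((\<lambda>D. control_length Nm u + k * (2 * D + 4 * pi * sqrt ((1 + 3 * B) * D / pi))) \<longlongrightarrow>
     control_length Nm u + k * (2 * 0 + 4 * pi * sqrt ((1 + 3 * B) * 0 / pi))) (nhds 0)"
    by (intro tendsto_intros filterlim_ident) auto
  then have "\<forall>\<^sub>F D in nhds 0. control_length Nm u + k * (2 * D + 4 * pi * sqrt ((1 + 3 * B) * D / pi)) < r"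
    by (rule order_tendstoD(2)) (use l in simp)
  then obtain d where d: "d > 0" "\<And>D. dist D 0 < d \<Longrightarrow> control_length Nm u + k * (2 * D + 4 * pi * sqrt ((1 + 3 * B) * D / pi)) < r"
    unfolding eventually_nhds_metric by blast
  show "\<exists>e>0. \<forall>y. dist y q < e \<longrightarrow> sf_dist Nm p y < r"
  proof (intro exI conjI allI impI, rule d(1))
    fix y assume "dist y q < d"
    then have "control_length Nm u + k * (2 * norm (y - q) + 4 * pi * sqrt ((1 + 3 * B) * norm (y - q) / pi)) < r"
      by (intro d(2)) (simp add: dist_norm)
    moreover obtain \<gamma>' u' where "admissible \<gamma>' u'" "\<gamma>' 0 = p" "\<gamma>' 1 = y" "control_length Nm u' \<le>
        control_length Nm u + k * (2 * norm (y - q) + 4 * pi * sqrt ((1 + 3 * B) * norm (y - q) / pi))"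
      using kB[of y] unfolding \<gamma> by blast
    ultimately show "sf_dist Nm p y < r" using sf_dist_le[of \<gamma>' u' p y] by linarith
  qed
qed

text \<open>The strict strip condition leaves room for curves of length \<open>d + e\<close>, which
  then stay in the strip as well; afterwards \<open>e\<close> tends to zero. The error is
  \<open>\<bar>L\<bar> * e\<close> because \<open>L\<close> may have either sign.\<close>

lemma sf_dist_calibration:
  assumes K: "\<And>x. \<bar>x\<bar> < r \<Longrightarrow> (K has_real_derivative K' x) (at x)"
    and bd: "\<And>x v1 v2. \<bar>x\<bar> < r \<Longrightarrow> K' x * v1 + (k1 + k2 * x) * v2 \<le> L * Nm (v1, v2)"
    and \<kappa>: "\<And>v. norm v \<le> \<kappa> * Nm v"
    and strip: "\<bar>fst p\<bar> + \<kappa> * sf_dist Nm p q < r"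
    and H: "\<And>x y z. H (x, y, z) = K x + k1 * y + k2 * (z + x * y / 2)"
  shows "H q - H p \<le> L * sf_dist Nm p q"
proof -
  define d where "d = sf_dist Nm p q"
  have ev: "\<forall>\<^sub>F l in at_right d. \<bar>fst p\<bar> + \<kappa> * l < r"
  proof (rule order_tendstoD(2))
    show "((\<lambda>l. \<bar>fst p\<bar> + \<kappa> * l) \<longlongrightarrow> \<bar>fst p\<bar> + \<kappa> * d) (at_right d)" by (intro tendsto_intros)
  qed (use strip in \<open>simp add: d_def\<close>)
  have n1: "norm (1::real, 0::real) \<le> \<kappa> * Nm (1, 0)" by (rule \<kappa>)
  then have "0 < \<kappa> * Nm (1, 0)" by simp
  then have \<kappa>0: "0 \<le> \<kappa>" using Nm_ge_0[of "(1, 0)"] by (auto simp: zero_less_mult_iff)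
  have L0: "H q - H p \<le> \<bar>L\<bar> * e + L * d" if e: "\<bar>fst p\<bar> + \<kappa> * (d + e) < r" "e > 0" for e
  proof -
    obtain \<gamma> u where g: "admissible \<gamma> u" "\<gamma> 0 = p" "\<gamma> 1 = q" "control_length Nm u < d + e"
      by (rule sf_dist_less[of p q "d + e"]) (use e in \<open>simp_all add: d_def\<close>)
    have "\<kappa> * control_length Nm u \<le> \<kappa> * (d + e)" using g(4) \<kappa>0 by (intro mult_left_mono) auto
    then have "H (\<gamma> 1) - H (\<gamma> 0) \<le> L * control_length Nm u"
      by (intro calibration_admissible[OF K bd \<kappa> g(1) _ H]) (use e g in auto)
    also have "\<dots> = L * (control_length Nm u - d) + L * d" by (simp add: algebra_simps)
    also have "\<dots> \<le> \<bar>L\<bar> * e + L * d"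
    proof -
      have "d \<le> control_length Nm u" unfolding d_def by (rule sf_dist_le[OF g(1-3)])
      then have "L * (control_length Nm u - d) \<le> \<bar>L\<bar> * (control_length Nm u - d)" by (intro mult_right_mono) auto
      also have "\<dots> \<le> \<bar>L\<bar> * e" using g(4) by (intro mult_left_mono) auto
      finally show ?thesis by simp
    qed
    finally show ?thesis using g by simp
  qed
  have "\<forall>\<^sub>F l in at_right d. H q - H p \<le> \<bar>L\<bar> * (l - d) + L * d"
    using ev eventually_at_right_less[of d] by eventually_elim (use L0[of "l - d" for l] in auto)
  moreover have "((\<lambda>l. \<bar>L\<bar> * (l - d) + L * d) \<longlongrightarrow> \<bar>L\<bar> * (d - d) + L * d) (at_right d)"
    by (intro tendsto_intros)
  ultimately have "H q - H p \<le> \<bar>L\<bar> * (d - d) + L * d"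
    using tendsto_lowerbound trivial_limit_at_right_real by blast
  then show ?thesis by (simp add: d_def)
qed

end

section \<open>The dual norm\<close>

context plane_norm begin

definition Nd :: "real \<times> real \<Rightarrow> real" where
  "Nd p = Sup ((\<lambda>x. p \<bullet> x) ` {x. Nm x \<le> 1})"

lemma compact_unit_ball: "compact (unit_ball_of Nm)"
proof -
  obtain k where k: "k > 0" "\<And>x. norm x \<le> k * Nm x" using norm_le_Nm by blast
  have "norm x \<le> k" if "Nm x \<le> 1" for x
    using order_trans[OF k(2)[of x] mult_left_mono[OF that, of k]] k(1) by simp
  then have "bounded {x. Nm x \<le> 1}" by (auto simp: bounded_iff)
  moreover have "closed {x. Nm x \<le> 1}" by (intro closed_Collect_le continuous_on_Nm continuous_intros)
  ultimately show ?thesis by (simp add: compact_eq_bounded_closed unit_ball_of_def)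
qed

lemma Nd_attained: obtains x where "Nm x \<le> 1" "p \<bullet> x = Nd p" "\<And>y. Nm y \<le> 1 \<Longrightarrow> p \<bullet> y \<le> Nd p"
proof -
  have "0 \<in> {x. Nm x \<le> 1}" by simp
  then have "{x. Nm x \<le> 1} \<noteq> {}" by blast
  then obtain x where x: "Nm x \<le> 1" "\<And>y. Nm y \<le> 1 \<Longrightarrow> p \<bullet> y \<le> p \<bullet> x"
    using continuous_attains_sup[OF compact_unit_ball[unfolded unit_ball_of_def] _ continuous_on_inner[OF continuous_on_const continuous_on_id], of p]
    by blast
  have "Nd p = p \<bullet> x" unfolding Nd_def using x by (intro cSup_eq_maximum) auto
  then show thesis using that x by metis
qed

lemma Nd_le_iff: "Nd p \<le> c \<longleftrightarrow> (\<forall>x. Nm x \<le> 1 \<longrightarrow> p \<bullet> x \<le> c)"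
  using Nd_attained[of p] by (metis order_trans)

lemma inner_le_Nd: "p \<bullet> x \<le> Nd p * Nm x"
proof (cases "x = 0")
  case False
  then have "p \<bullet> ((1 / Nm x) *\<^sub>R x) \<le> Nd p"
    using Nd_le_iff[of p "Nd p"] Nm_pos[of x] Nm_scale[of "1 / Nm x" x] by (metis abs_of_pos divide_self less_irrefl
        nonzero_eq_divide_eq order_refl zero_less_divide_1_iff)
  then show ?thesis using Nm_pos[OF False] by (simp add: field_simps)
qed simp

lemma abs_inner_le_Nd: "\<bar>p \<bullet> x\<bar> \<le> Nd p * Nm x"
  using inner_le_Nd[of p x] inner_le_Nd[of p "- x"] by simp

lemma is_norm_Nd: "is_norm Nd"
proof -
  have ge: "0 \<le> Nd p" for p
    using Nd_le_iff[of p "Nd p"] Nm_eq_0_iff[of 0] by (metis inner_zero_right order_refl zero_le_one)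
  have "p = 0" if "Nd p = 0" for p
    using inner_le_Nd[of p p] that by (metis inner_gt_zero_iff mult_zero_left not_le)
  moreover have "Nd 0 = 0"
    using ge[of 0] Nd_le_iff[of 0 0] by auto
  moreover have "Nd (c *\<^sub>R p) = \<bar>c\<bar> * Nd p" for c p
  proof -
    have le: "Nd (c *\<^sub>R p) \<le> \<bar>c\<bar> * Nd p" for c p
      unfolding Nd_le_iff
    proof (intro allI impI)
      fix x assume x: "Nm x \<le> 1"
      have "c * (p \<bullet> x) \<le> \<bar>c\<bar> * \<bar>p \<bullet> x\<bar>" by (metis abs_ge_self abs_mult)
      also have "\<dots> \<le> \<bar>c\<bar> * (Nd p * Nm x)" by (intro mult_left_mono abs_inner_le_Nd) auto
      also have "\<dots> \<le> \<bar>c\<bar> * (Nd p * 1)" using x ge by (intro mult_left_mono) auto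
      finally show "c *\<^sub>R p \<bullet> x \<le> \<bar>c\<bar> * Nd p" by simp
    qed
    show ?thesis
    proof (cases "c = 0")
      case True then show ?thesis using \<open>Nd 0 = 0\<close> by simp
    next
      case False
      have "\<bar>c\<bar> * Nd p = \<bar>c\<bar> * Nd ((1 / c) *\<^sub>R (c *\<^sub>R p))" using False by simp
      also have "\<dots> \<le> \<bar>c\<bar> * (\<bar>1 / c\<bar> * Nd (c *\<^sub>R p))" by (intro mult_left_mono le) auto
      also have "\<dots> = Nd (c *\<^sub>R p)" using False by simp
      finally show ?thesis using le[of c p] by simp
    qed
  qed
  moreover have "Nd (p + q) \<le> Nd p + Nd q" for p q
    unfolding Nd_le_iff[of "p + q"]
  proof (intro allI impI)
    fix x assume "Nm x \<le> 1"
    then have "p \<bullet> x \<le> Nd p" "q \<bullet> x \<le> Nd q" using Nd_le_iff by blast+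
    then show "(p + q) \<bullet> x \<le> Nd p + Nd q" by (simp add: inner_add_left)
  qed
  ultimately show ?thesis using ge unfolding is_norm_def by blast
qed

lemma polar_unit_ball: "polar_set (unit_ball_of Nm) = unit_ball_of Nd"
  by (auto simp: polar_set_def unit_ball_of_def Nd_le_iff)

end

section \<open>Strong convexity and the gradient of the dual norm\<close>

locale regular_norm = plane_norm +
  assumes C1: "norm_C1 Nm" and sconvex: "norm_strongly_convex Nm"
begin

sublocale dual: plane_norm Nd by unfold_locales (rule is_norm_Nd)

definition conv where
  "conv = (SOME \<alpha>. \<alpha> > 0 \<and> (\<forall>x y. \<forall>t\<in>{0..1}.
      (Nm (t *\<^sub>R x + (1 - t) *\<^sub>R y))\<^sup>2 / 2
        \<le> t * ((Nm x)\<^sup>2 / 2) + (1 - t) * ((Nm y)\<^sup>2 / 2) - \<alpha> / 2 * t * (1 - t) * (Nm (x - y))\<^sup>2))"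

lemma conv: "conv > 0" "t \<in> {0..1} \<Longrightarrow>
      (Nm (t *\<^sub>R x + (1 - t) *\<^sub>R y))\<^sup>2 / 2
        \<le> t * ((Nm x)\<^sup>2 / 2) + (1 - t) * ((Nm y)\<^sup>2 / 2) - conv / 2 * t * (1 - t) * (Nm (x - y))\<^sup>2"
proof -
  have "\<exists>\<alpha>>0. (\<forall>x y. \<forall>t\<in>{0..1}.
      (Nm (t *\<^sub>R x + (1 - t) *\<^sub>R y))\<^sup>2 / 2
        \<le> t * ((Nm x)\<^sup>2 / 2) + (1 - t) * ((Nm y)\<^sup>2 / 2) - \<alpha> / 2 * t * (1 - t) * (Nm (x - y))\<^sup>2)"
    using sconvex unfolding norm_strongly_convex_def by blast
  from someI_ex[OF this] show "conv > 0" "t \<in> {0..1} \<Longrightarrow>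
      (Nm (t *\<^sub>R x + (1 - t) *\<^sub>R y))\<^sup>2 / 2
        \<le> t * ((Nm x)\<^sup>2 / 2) + (1 - t) * ((Nm y)\<^sup>2 / 2) - conv / 2 * t * (1 - t) * (Nm (x - y))\<^sup>2"
    unfolding conv_def by blast+
qed

text \<open>On the segment from \<open>u\<close> to \<open>v\<close> the covector takes the value
  \<open>1 - t * \<delta>\<close>, whose modulus bounds the norm from below. Comparing its square
  with the strong convexity inequality, dividing by \<open>t\<close> and letting \<open>t\<close>
  tend to zero leaves the quadratic gap.\<close>

lemma strong_convexity_gap_unit:
  assumes P: "Nd P \<le> 1" "P \<bullet> u = 1" and u: "Nm u = 1" and v: "Nm v = 1"
  shows "P \<bullet> v \<le> 1 - conv / 2 * (Nm (v - u))\<^sup>2"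
proof -
  define \<delta> D where "\<delta> = 1 - P \<bullet> v" and "D = (Nm (v - u))\<^sup>2"
  have step: "conv / 2 * (1 - t) * D \<le> \<delta>" if t: "0 < t" "t \<le> 1" for t
  proof -
    have "\<bar>P \<bullet> (t *\<^sub>R v + (1 - t) *\<^sub>R u)\<bar> \<le> Nm (t *\<^sub>R v + (1 - t) *\<^sub>R u)"
      using abs_inner_le_Nd[of P "t *\<^sub>R v + (1 - t) *\<^sub>R u"] mult_right_mono[OF P(1) Nm_ge_0] by (metis mult_1 order_trans)
    then have "(P \<bullet> (t *\<^sub>R v + (1 - t) *\<^sub>R u))\<^sup>2 \<le> (Nm (t *\<^sub>R v + (1 - t) *\<^sub>R u))\<^sup>2"
      using abs_le_square_iff by fastforce
    also have "\<dots> \<le> 1 - conv * t * (1 - t) * D"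
      using conv(2)[of t v u] t u v by (simp add: D_def field_simps)
    finally have "(1 - t * \<delta>)\<^sup>2 \<le> 1 - conv * t * (1 - t) * D"
      using P(2) by (simp add: inner_add_right \<delta>_def algebra_simps)
    then have "t * (conv * (1 - t) * D) \<le> t * (2 * \<delta>) - (t * \<delta>)\<^sup>2" by (simp add: power2_eq_square algebra_simps)
    then have "t * (conv * (1 - t) * D) \<le> t * (2 * \<delta>)" using zero_le_power2[of "t * \<delta>"] by linarith
    then show ?thesis using t by simp
  qed
  have "((\<lambda>t. conv / 2 * (1 - t) * D) \<longlongrightarrow> conv / 2 * (1 - 0) * D) (at_right 0)" by (intro tendsto_intros)
  moreover have "\<forall>\<^sub>F t in at_right 0. conv / 2 * (1 - t) * D \<le> \<delta>"
    unfolding eventually_at_right_field using step by (intro exI[of _ 1]) auto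
  ultimately have "conv / 2 * (1 - 0) * D \<le> \<delta>" using tendsto_upperbound trivial_limit_at_right_real by blast
  then show ?thesis by (simp add: \<delta>_def D_def)
qed

text \<open>Tilting the supporting covector \<open>P\<close> by \<open>w\<close>, which annihilates the maximizer \<open>u\<close>,
  increases its dual norm only to second order.\<close>

lemma tilted_covector_le:
  assumes P: "Nd P \<le> 1" "P \<bullet> u = 1" and u: "Nm u = 1" and w: "w \<bullet> u = 0" "Nd w \<le> C"
  shows "P \<bullet> v + a * (w \<bullet> v) \<le> (1 + a\<^sup>2 * C\<^sup>2 / (2 * conv)) * Nm v"
proof (cases "v = 0")
  case False
  define m where "m = Nm v"
  have m: "m > 0" using Nm_pos[OF False] by (simp add: m_def)
  define v' where "v' = (1 / m) *\<^sub>R v"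
  have v': "Nm v' = 1" "v = m *\<^sub>R v'" using m unfolding v'_def Nm_scale by (simp_all add: m_def[symmetric])
  define D where "D = Nm (v' - u)"
  have D: "D \<ge> 0" by (simp add: D_def)
  have "\<bar>w \<bullet> (v' - u)\<bar> \<le> C * D"
    using abs_inner_le_Nd[of w "v' - u"] mult_right_mono[OF w(2) D] by (simp add: D_def)
  then have "\<bar>w \<bullet> v'\<bar> \<le> C * D" using w(1) by (simp add: inner_diff_right)
  then have "a * (w \<bullet> v') \<le> \<bar>a\<bar> * (C * D)"
    by (metis abs_ge_self abs_ge_zero abs_mult mult_left_mono order_trans)
  moreover have "P \<bullet> v' \<le> 1 - conv / 2 * D\<^sup>2"
    unfolding D_def by (rule strong_convexity_gap_unit[OF P u v'(1)])
  \<comment> \<open>The constant is the maximum over \<open>D\<close> of the linear gain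
    \<open>\<bar>a\<bar> * C * D\<close> minus the quadratic loss
    \<open>conv / 2 * D\<^sup>2\<close>, found by completing the square.\<close>
  moreover have "\<bar>a\<bar> * (C * D) \<le> conv / 2 * D\<^sup>2 + a\<^sup>2 * C\<^sup>2 / (2 * conv)"
  proof -
    have "0 \<le> (conv * D - \<bar>a\<bar> * C)\<^sup>2 / (2 * conv)" using conv(1) by simp
    also have "\<dots> = conv / 2 * D\<^sup>2 + a\<^sup>2 * C\<^sup>2 / (2 * conv) - \<bar>a\<bar> * (C * D)"
      using conv(1) by (simp add: power2_diff power_mult_distrib field_simps) (simp add: power2_eq_square field_simps)
    finally show ?thesis by simp
  qed
  ultimately have "P \<bullet> v' + a * (w \<bullet> v') \<le> 1 + a\<^sup>2 * C\<^sup>2 / (2 * conv)" by linarith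
  then have "m * (P \<bullet> v' + a * (w \<bullet> v')) \<le> m * (1 + a\<^sup>2 * C\<^sup>2 / (2 * conv))"
    using m by (intro mult_left_mono) auto
  then show ?thesis unfolding v'(2) using v'(1) m by (simp add: Nm_scale algebra_simps)
qed simp

lemma maximizer_ex: assumes "Nd P = 1" shows "\<exists>u. Nm u = 1 \<and> P \<bullet> u = 1"
proof -
  obtain x where x: "Nm x \<le> 1" "P \<bullet> x = Nd P" using Nd_attained by metis
  then have "Nm x = 1" using inner_le_Nd[of P x] assms by simp
  then show ?thesis using x assms by metis
qed

text \<open>Adding the gap inequalities of the two covectors gives strong monotonicity, from which
  the Cauchy-Schwarz inequality will make the maximizer a Lipschitz function of the
  covector.\<close>

lemma maximizers_close:
  assumes "Nd P = 1" "Nd Q = 1" "P \<bullet> u = 1" "Q \<bullet> v = 1" "Nm u = 1" "Nm v = 1"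
  shows "conv * (Nm (u - v))\<^sup>2 \<le> (P - Q) \<bullet> (u - v)"
proof -
  have "P \<bullet> v \<le> 1 - conv / 2 * (Nm (v - u))\<^sup>2" "Q \<bullet> u \<le> 1 - conv / 2 * (Nm (u - v))\<^sup>2"
    using strong_convexity_gap_unit assms by auto
  moreover have "Nm (v - u) = Nm (u - v)" using Nm_minus[of "u - v"] by simp
  ultimately have "P \<bullet> v \<le> 1 - conv / 2 * (Nm (u - v))\<^sup>2" "Q \<bullet> u \<le> 1 - conv / 2 * (Nm (u - v))\<^sup>2" by simp_all
  then show ?thesis using assms by (simp add: inner_diff_left inner_diff_right)
qed

text \<open>The covector is normalized first, so \<open>dir\<close> is constant on open rays from
  the origin; away from the origin it is the gradient of \<open>Nd\<close>.\<close>

definition dir where "dir p = (SOME u. Nm u = 1 \<and> ((1 / Nd p) *\<^sub>R p) \<bullet> u = 1)"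

lemma dir: assumes "p \<noteq> 0" shows "Nm (dir p) = 1" "p \<bullet> dir p = Nd p"
proof -
  have "Nd ((1 / Nd p) *\<^sub>R p) = 1" using dual.Nm_pos[OF assms] unfolding dual.Nm_scale by (metis abs_of_pos divide_self less_irrefl
        nonzero_eq_divide_eq zero_less_divide_1_iff)
  from someI_ex[OF maximizer_ex[OF this]] have "Nm (dir p) = 1 \<and> ((1 / Nd p) *\<^sub>R p) \<bullet> dir p = 1"
    unfolding dir_def .
  then show "Nm (dir p) = 1" "p \<bullet> dir p = Nd p" using dual.Nm_pos[OF assms] by (auto simp: field_simps)
qed

lemma dir_Lipschitz:
  obtains L where "L > 0" "\<And>p q. Nd p = 1 \<Longrightarrow> Nd q = 1 \<Longrightarrow> norm (dir p - dir q) \<le> L * norm (p - q)"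
proof -
  obtain k where k: "k > 0" "\<And>x. norm x \<le> k * Nm x" using norm_le_Nm by blast
  show thesis
  proof (rule that[of "k * k / conv"])
    fix p q assume pq: "Nd p = 1" "Nd q = 1"
    define u v where "u = dir p" and "v = dir q"
    have "p \<noteq> 0" "q \<noteq> 0" using pq dual.Nm_eq_0_iff by (metis zero_neq_one)+
    from dir[OF this(1)] dir[OF this(2)] have "conv * (Nm (u - v))\<^sup>2 \<le> (p - q) \<bullet> (u - v)"
      using pq by (intro maximizers_close) (auto simp: u_def v_def)
    also have "\<dots> \<le> norm (p - q) * norm (u - v)" by (rule norm_cauchy_schwarz)
    finally have *: "conv * (Nm (u - v))\<^sup>2 \<le> norm (p - q) * norm (u - v)" .
    have "(norm (u - v))\<^sup>2 \<le> (k * Nm (u - v))\<^sup>2" by (intro power_mono k) auto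
    then have "conv * (norm (u - v))\<^sup>2 \<le> k\<^sup>2 * (conv * (Nm (u - v))\<^sup>2)"
      using conv(1) by (simp add: power_mult_distrib mult.left_commute)
    also have "\<dots> \<le> k\<^sup>2 * (norm (p - q) * norm (u - v))" using * by (intro mult_left_mono) auto
    finally have "norm (u - v) * (conv * norm (u - v)) \<le> norm (u - v) * (k * k * norm (p - q))"
      by (simp add: power2_eq_square mult_ac)
    then have "conv * norm (u - v) \<le> k * k * norm (p - q)"
      using k(1) by (cases "u = v") auto
    then show "norm (dir p - dir q) \<le> k * k / conv * norm (p - q)"
      using conv(1) by (simp add: u_def v_def field_simps)
  qed (use k conv in simp)
qed

lemma maximizer_unique:
  assumes "Nd P = 1" "P \<bullet> u = 1" "P \<bullet> v = 1" "Nm u = 1" "Nm v = 1"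
  shows "u = v"
  using strong_convexity_gap_unit[of P u v] assms conv(1)
  by (simp add: zero_le_mult_iff mult_le_0_iff)

lemma dir_eqI: "Nd P = 1 \<Longrightarrow> P \<bullet> u = 1 \<Longrightarrow> Nm u = 1 \<Longrightarrow> dir P = u"
  using maximizer_unique[of P "dir P" u] dir[of P] dual.Nm_eq_0_iff by (metis zero_neq_one)

lemma continuous_dir: assumes "p \<noteq> 0" shows "isCont dir p"
proof -
  obtain L where L: "L > 0" "\<And>p q. Nd p = 1 \<Longrightarrow> Nd q = 1 \<Longrightarrow> norm (dir p - dir q) \<le> L * norm (p - q)"
    using dir_Lipschitz by metis
  define nz where "nz q = (1 / Nd q) *\<^sub>R q" for q
  have N1: "Nd (nz q) = 1" if "q \<noteq> 0" for q using dual.Nm_pos[OF that] unfolding nz_def dual.Nm_scale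
    by (metis abs_of_pos divide_self less_irrefl nonzero_eq_divide_eq zero_less_divide_1_iff)
  have dnz: "dir (nz q) = dir q" if "q \<noteq> 0" for q
    using dir[OF that] N1[OF that] dual.Nm_pos[OF that] by (intro dir_eqI) (auto simp: nz_def)
  have "isCont Nd p" using dual.continuous_on_Nm[of UNIV] continuous_on_eq_continuous_at open_UNIV UNIV_I by blast
  then have nz: "isCont nz p" unfolding nz_def using dual.Nm_pos[OF assms] by (intro continuous_intros) auto
  have "((\<lambda>q. L * norm (nz q - nz p)) \<longlongrightarrow> L * norm (nz p - nz p)) (at p)"
    using nz by (intro tendsto_intros) (simp add: isCont_def)
  then have "((\<lambda>q. L * norm (nz q - nz p)) \<longlongrightarrow> 0) (at p)" by simp
  moreover have "\<forall>\<^sub>F q in at p. norm (dir q - dir p) \<le> L * norm (nz q - nz p)"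
  proof -
    have "\<forall>\<^sub>F q in at p. q \<noteq> 0" using assms by (intro eventually_neq_at_within) 
    then show ?thesis by eventually_elim (metis L(2) N1 assms dnz)
  qed
  ultimately have "((\<lambda>q. dir q - dir p) \<longlongrightarrow> 0) (at p)" by (rule Lim_null_comparison[rotated])
  then show ?thesis unfolding isCont_def using LIM_zero_iff by blast
qed

text \<open>Each maximizer is a competitor for the other covector, which traps the first-order
  remainder between \<open>0\<close> and \<open>(dir q - dir p) \<bullet> (q - p)\<close>.
  Continuity of \<open>dir\<close> makes this small compared with the increment.\<close>

lemma Nd_has_derivative:
  assumes "p \<noteq> 0"
  shows "(Nd has_derivative (\<lambda>h. dir p \<bullet> h)) (at p)"
proof (rule has_derivativeI_sandwich[where e = "norm p" and H = "\<lambda>q. norm (dir q - dir p)"])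
  show "bounded_linear (\<lambda>h. dir p \<bullet> h)" by (rule bounded_linear_inner_right)
  show "0 < norm p" using assms by simp
  have "((\<lambda>q. norm (dir q - dir p)) \<longlongrightarrow> norm (dir p - dir p)) (at p)"
    using continuous_dir[OF assms] by (intro tendsto_intros) (simp add: isCont_def)
  then show "((\<lambda>q. norm (dir q - dir p)) \<longlongrightarrow> 0) (at p within UNIV)" by simp
  fix q assume q: "q \<noteq> p" "dist q p < norm p"
  then have "q \<noteq> 0" by (auto simp: dist_norm)
  have "Nd q = q \<bullet> dir q" "Nd p = p \<bullet> dir p" "Nm (dir p) = 1" "Nm (dir q) = 1"
    using dir[OF \<open>q \<noteq> 0\<close>] dir[OF assms] by auto
  moreover have "p \<bullet> dir q \<le> Nd p" "q \<bullet> dir p \<le> Nd q"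
    using inner_le_Nd[of p "dir q"] inner_le_Nd[of q "dir p"] calculation by auto
  ultimately have "0 \<le> Nd q - Nd p - dir p \<bullet> (q - p)" "Nd q - Nd p - dir p \<bullet> (q - p) \<le> (dir q - dir p) \<bullet> (q - p)"
    by (auto simp: inner_diff_left inner_diff_right inner_commute)
  moreover have "(dir q - dir p) \<bullet> (q - p) \<le> norm (dir q - dir p) * norm (q - p)" by (rule norm_cauchy_schwarz)
  ultimately have "norm (Nd q - Nd p - dir p \<bullet> (q - p)) \<le> norm (dir q - dir p) * norm (q - p)" by simp
  then show "norm (Nd q - Nd p - dir p \<bullet> (q - p)) / norm (q - p) \<le> norm (dir q - dir p)"
    using q by (simp add: divide_le_eq)
qed

text \<open>Differentiability of the norm enters here: \<open>Nm x - R \<bullet> x\<close> is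
  minimal at \<open>u\<close>, so every such \<open>R\<close> is the gradient at \<open>u\<close>.
  In other words, distinct covectors of the dual unit sphere have distinct maximizers.\<close>

lemma dual_unit_determined:
  assumes "Nd P = 1" "Nd Q = 1" "P \<bullet> u = 1" "Q \<bullet> u = 1" "Nm u = 1"
  shows "P = Q"
proof -
  have "u \<noteq> 0" using assms(5) by auto
  then obtain g where g: "(Nm has_derivative (\<lambda>h. g \<bullet> h)) (at u)"
    using C1 unfolding norm_C1_def by blast
  have "R = g" if R: "Nd R = 1" "R \<bullet> u = 1" for R
  proof -
    have "((\<lambda>x. Nm x - R \<bullet> x) has_derivative (\<lambda>h. g \<bullet> h - R \<bullet> h)) (at u)"
      by (intro has_derivative_diff g bounded_linear.has_derivative[OF bounded_linear_inner_right] has_derivative_ident)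
    moreover have "Nm u - R \<bullet> u \<le> Nm x - R \<bullet> x" for x
      using inner_le_Nd[of R x] R assms(5) by simp
    ultimately have "(\<lambda>h. g \<bullet> h - R \<bullet> h) = (\<lambda>h. 0)"
      by (intro has_derivative_local_min always_eventually allI)
    from fun_cong[OF this, of "g - R"] have "(g - R) \<bullet> (g - R) = 0" by (simp add: inner_diff_left)
    then show ?thesis by simp
  qed
  then show ?thesis using assms by metis
qed

end

section \<open>Area in polar coordinates\<close>

text \<open>Preimages of boxes are boxes with the same side lengths, because \<open>T\<close>
  carries the basis to the basis; boxes determine Lebesgue measure.\<close>

lemma distr_lborel_isometry:
  fixes T :: "'a::euclidean_space \<Rightarrow> 'b::euclidean_space"
  assumes lin: "linear T" and inner: "\<And>x y. T x \<bullet> T y = x \<bullet> y" and basis: "T ` Basis = Basis" and "surj T"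
  shows "distr lborel borel T = lborel"
proof (rule lborel_eqI[symmetric])
  have [measurable]: "T \<in> borel_measurable borel"
    using lin by (intro borel_measurable_continuous_onI linear_continuous_on linear_conv_bounded_linear[THEN iffD1])
  have inj: "inj_on T Basis"
    by (rule inj_onI) (metis inner inner_eq_zero_iff inner_commute inner_diff_left inner_diff_right right_minus_eq)
  fix l u :: 'b assume lu: "\<And>b. b \<in> Basis \<Longrightarrow> l \<bullet> b \<le> u \<bullet> b"
  obtain l' u' where T: "l = T l'" "u = T u'" using \<open>surj T\<close> by (metis surjD)
  have box: "T -` box l u = box l' u'"
    by (auto simp: mem_box T basis[symmetric] inner)
  have "emeasure (distr lborel borel T) (box l u) = emeasure lborel (box l' u')"
    by (subst emeasure_distr) (auto simp: box)
  also have "\<dots> = (\<Prod>b\<in>Basis. (u' - l') \<bullet> b)"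
    using lu by (intro emeasure_lborel_box) (metis T basis imageI inner)
  also have "(\<Prod>b\<in>Basis. (u' - l') \<bullet> b) = (\<Prod>b\<in>T ` Basis. (u - l) \<bullet> b)"
    unfolding prod.reindex[OF inj] by (simp add: T inner inner_diff_left)
  finally show "emeasure (distr lborel borel T) (box l u) = (\<Prod>b\<in>Basis. (u - l) \<bullet> b)" by (simp add: basis)
qed simp

lemma measure_vimage_isometry:
  fixes T :: "'a::euclidean_space \<Rightarrow> 'b::euclidean_space"
  assumes "linear T" "\<And>x y. T x \<bullet> T y = x \<bullet> y" "T ` Basis = Basis" "surj T" and A: "A \<in> sets borel"
  shows "measure lborel (T -` A) = measure lborel A" "T -` A \<in> sets borel"
proof -
  have [measurable]: "T \<in> borel_measurable borel"
    using assms(1) by (intro borel_measurable_continuous_onI linear_continuous_on linear_conv_bounded_linear[THEN iffD1])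
  have "measure (distr lborel borel T) A = measure lborel (T -` A)"
    by (subst measure_distr) (use A in auto)
  then show "measure lborel (T -` A) = measure lborel A"
    by (simp add: distr_lborel_isometry[OF assms(1-4)])
  show "T -` A \<in> sets borel" using measurable_sets[OF _ A, of T borel] by simp
qed

text \<open>Change of variables is carried out in \<open>real^2\<close> and \<open>real^3\<close>;
  these coordinate maps transport sets, measures and derivatives to and from the product
  types.\<close>

definition of_vec2 :: "real^2 \<Rightarrow> real \<times> real" where "of_vec2 v = (v $ 1, v $ 2)"
definition of_vec3 :: "real^3 \<Rightarrow> real \<times> real \<times> real" where "of_vec3 v = (v $ 1, v $ 2, v $ 3)"
definition to_vec2 :: "real \<times> real \<Rightarrow> real^2" where "to_vec2 p = vector [fst p, snd p]"
definition to_vec3 :: "real \<times> real \<times> real \<Rightarrow> real^3" where "to_vec3 p = vector [fst p, fst (snd p), snd (snd p)]"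

lemma to_of_vec [simp]: "to_vec2 (of_vec2 v) = v" "of_vec2 (to_vec2 p) = p" "to_vec3 (of_vec3 w) = w" "of_vec3 (to_vec3 q) = q"
  by (auto simp: to_vec2_def of_vec2_def to_vec3_def of_vec3_def vec_eq_iff forall_2 forall_3)

lemma linear_of_vec: "linear of_vec2" "linear of_vec3"
  unfolding of_vec2_def of_vec3_def by (auto intro!: linearI)

lemma linear_to_vec: "linear to_vec2" "linear to_vec3"
  unfolding to_vec2_def to_vec3_def by (auto intro!: linearI simp: vec_eq_iff forall_2 forall_3)

lemma of_vec2_isometry: "of_vec2 x \<bullet> of_vec2 y = x \<bullet> y" "of_vec2 ` Basis = Basis" "surj of_vec2"
proof -
  show "of_vec2 x \<bullet> of_vec2 y = x \<bullet> y" by (simp add: of_vec2_def inner_vec_def sum_2)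
  have "(Basis :: (real^2) set) = {axis 1 1, axis 2 1}"
    by (auto simp: Basis_vec_def) (metis (full_types) exhaust_2)
  moreover have "of_vec2 (axis 1 1) = (1, 0)" "of_vec2 (axis 2 1) = (0, 1)" by (simp_all add: of_vec2_def axis_def)
  moreover have "(Basis :: (real \<times> real) set) = {(1, 0), (0, 1)}" by (auto simp: Basis_prod_def)
  ultimately show "of_vec2 ` Basis = Basis" by (metis image_insert image_empty)
  show "surj of_vec2" by (metis surjI to_of_vec(2))
qed

lemma of_vec3_isometry: "of_vec3 x \<bullet> of_vec3 y = x \<bullet> y" "of_vec3 ` Basis = Basis" "surj of_vec3"
proof -
  show "of_vec3 x \<bullet> of_vec3 y = x \<bullet> y" by (simp add: of_vec3_def inner_vec_def sum_3)
  have "(Basis :: (real^3) set) = {axis 1 1, axis 2 1, axis 3 1}"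
    by (auto simp: Basis_vec_def) (metis (full_types) exhaust_3)
  moreover have "of_vec3 (axis 1 1) = (1, 0, 0)" "of_vec3 (axis 2 1) = (0, 1, 0)" "of_vec3 (axis 3 1) = (0, 0, 1)"
    by (simp_all add: of_vec3_def axis_def)
  moreover have "(Basis :: (real \<times> real \<times> real) set) = {(1, 0, 0), (0, 1, 0), (0, 0, 1)}"
    by (auto simp: Basis_prod_def zero_prod_def)
  ultimately show "of_vec3 ` Basis = Basis" by (metis image_insert image_empty)
  show "surj of_vec3" by (metis surjI to_of_vec(4))
qed

lemmas measure_of_vec2 = measure_vimage_isometry[OF linear_of_vec(1) of_vec2_isometry]
lemmas measure_of_vec3 = measure_vimage_isometry[OF linear_of_vec(2) of_vec3_isometry]

lemma conj_derivative_vec2: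
  assumes "(g has_derivative (\<lambda>h. (a * fst h + b * snd h, c * fst h + d * snd h))) (at (of_vec2 x))"
  shows "((\<lambda>v. to_vec2 (g (of_vec2 v))) has_derivative
     (\<lambda>h. to_vec2 (a * h $ 1 + b * h $ 2, c * h $ 1 + d * h $ 2))) (at x within S)"
    (is "(_ has_derivative ?D) _")
  and "det (matrix (\<lambda>h. to_vec2 (a * h $ 1 + b * h $ 2, c * h $ 1 + d * h $ 2))) = a * d - b * c"
proof -
  have "((g \<circ> of_vec2) has_derivative (\<lambda>h. (a * fst h + b * snd h, c * fst h + d * snd h)) \<circ> of_vec2) (at x)"
    by (intro diff_chain_at linear_imp_has_derivative linear_of_vec assms)
  then have "((to_vec2 \<circ> (g \<circ> of_vec2)) has_derivative to_vec2 \<circ> ((\<lambda>h. (a * fst h + b * snd h, c * fst h + d * snd h)) \<circ> of_vec2)) (at x)"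
    by (rule diff_chain_at[OF _ linear_imp_has_derivative[OF linear_to_vec(1)]])
  then show "((\<lambda>v. to_vec2 (g (of_vec2 v))) has_derivative ?D) (at x within S)"
    by (auto simp: o_def of_vec2_def intro: has_derivative_at_withinI)
  show "det (matrix ?D) = a * d - b * c"
    by (simp add: det_2 matrix_def axis_def to_vec2_def)
qed

lemma conj_derivative_vec3:
  fixes a :: "real \<times> real \<times> real"
  assumes "(g has_derivative (\<lambda>h. (a \<bullet> h, b \<bullet> h, c \<bullet> h))) (at (of_vec3 x))"
  shows "((\<lambda>v. to_vec3 (g (of_vec3 v))) has_derivative (\<lambda>h. to_vec3 (a \<bullet> of_vec3 h, b \<bullet> of_vec3 h, c \<bullet> of_vec3 h))) (at x within S)"
    (is "(_ has_derivative ?D) _")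
  and "det (matrix (\<lambda>h. to_vec3 (a \<bullet> of_vec3 h, b \<bullet> of_vec3 h, c \<bullet> of_vec3 h))) =
     fst a * (fst (snd b) * snd (snd c) - snd (snd b) * fst (snd c))
     - fst (snd a) * (fst b * snd (snd c) - snd (snd b) * fst c)
     + snd (snd a) * (fst b * fst (snd c) - fst (snd b) * fst c)"
proof -
  have "((g \<circ> of_vec3) has_derivative (\<lambda>h. (a \<bullet> h, b \<bullet> h, c \<bullet> h)) \<circ> of_vec3) (at x)"
    by (intro diff_chain_at linear_imp_has_derivative linear_of_vec assms)
  then have "((to_vec3 \<circ> (g \<circ> of_vec3)) has_derivative to_vec3 \<circ> ((\<lambda>h. (a \<bullet> h, b \<bullet> h, c \<bullet> h)) \<circ> of_vec3)) (at x)"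
    by (rule diff_chain_at[OF _ linear_imp_has_derivative[OF linear_to_vec(2)]])
  then show "((\<lambda>v. to_vec3 (g (of_vec3 v))) has_derivative ?D) (at x within S)"
    by (auto simp: o_def intro: has_derivative_at_withinI)
  obtain a1 a2 a3 b1 b2 b3 c1 c2 c3 where [simp]: "a = (a1, a2, a3)" "b = (b1, b2, b3)" "c = (c1, c2, c3)"
    by (metis prod.exhaust)
  show "det (matrix ?D) = fst a * (fst (snd b) * snd (snd c) - snd (snd b) * fst (snd c))
     - fst (snd a) * (fst b * snd (snd c) - snd (snd b) * fst c)
     + snd (snd a) * (fst b * fst (snd c) - fst (snd b) * fst c)"
    by (simp add: det_3 matrix_def axis_def to_vec3_def of_vec3_def algebra_simps)
qed

lemma antiderivative_ex:
  fixes f :: "real \<Rightarrow> real"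
  assumes "continuous_on UNIV f"
  obtains F where "F 0 = 0" "\<And>x. (F has_real_derivative f x) (at x)"
proof -
  define F where "F x = (if 0 \<le> x then integral {0..x} f else - integral {x..0} f)" for x
  have cont: "continuous_on S f" for S using assms continuous_on_subset by blast
  have eq: "F x = integral {-M..x} f - integral {-M..0} f" if "\<bar>x\<bar> \<le> M" for x M
  proof (cases "0 \<le> x")
    case True
    then show ?thesis using that Henstock_Kurzweil_Integration.integral_combine[where a = "-M" and c = 0 and b = x and f = f] integrable_continuous_interval[OF cont]
      by (simp add: F_def)
  next
    case False
    then show ?thesis using that Henstock_Kurzweil_Integration.integral_combine[where a = "-M" and c = x and b = 0 and f = f] integrable_continuous_interval[OF cont]
      by (simp add: F_def)
  qed
  have "(F has_real_derivative f x) (at x)" for x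
  proof -
    define M where "M = \<bar>x\<bar> + 1"
    have x: "x \<in> {-M<..<M}" by (auto simp: M_def)
    have "((\<lambda>x. integral {-M..x} f) has_real_derivative f x) (at x within {-M..M})"
      using x by (intro integral_has_real_derivative cont) auto
    then have "((\<lambda>x. integral {-M..x} f) has_real_derivative f x) (at x)"
      using x by (simp add: at_within_Icc_at)
    then have "((\<lambda>x. integral {-M..x} f - integral {-M..0} f) has_real_derivative f x) (at x)"
      using DERIV_diff[OF _ DERIV_const] by fastforce
    then show ?thesis
      by (rule has_field_derivative_transform_within_open[of _ _ _ "{-M<..<M}"]) (use x in \<open>auto intro!: eq[symmetric]\<close>)
  qed
  then show thesis using that[of F] by (simp add: F_def)
qed


section \<open>Polar description of the unit ball\<close>

context plane_norm begin

definition radius :: "real \<Rightarrow> real" where "radius a = 1 / Nm (cos a, sin a)"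

lemma cis_nonzero: "(cos a, sin a) \<noteq> (0 :: R2)"
proof
  assume "(cos a, sin a) = (0 :: R2)"
  then have "cos a = 0" "sin a = 0" by (simp_all add: zero_prod_def)
  then show False using sin_cos_squared_add[of a] by (metis add_0 power_zero_numeral zero_neq_one)
qed

lemma radius_pos: "0 < radius a"
  using Nm_pos[OF cis_nonzero] by (simp add: radius_def)

lemma continuous_on_radius: "continuous_on S radius"
proof -
  have "continuous_on S (\<lambda>a. Nm (cos a, sin a))"
    by (rule continuous_on_compose2[OF continuous_on_Nm[of UNIV]]) (auto intro!: continuous_intros)
  then show ?thesis unfolding radius_def
    using Nm_pos[OF cis_nonzero] by (intro continuous_intros) (metis less_irrefl)+
qed

lemma Nm_polar: "\<rho> \<ge> 0 \<Longrightarrow> Nm (\<rho> * cos a, \<rho> * sin a) = \<rho> / radius a"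
  using Nm_scale[of \<rho> "(cos a, sin a)"] by (simp add: radius_def)

lemma Nm_polar_le_1_iff: "\<rho> \<ge> 0 \<Longrightarrow> Nm (\<rho> * cos a, \<rho> * sin a) \<le> 1 \<longleftrightarrow> \<rho> \<le> radius a"
  using radius_pos[of a] by (simp add: Nm_polar)

lemma Nm_polar_radius: "Nm (radius a * cos a, radius a * sin a) = 1"
  using radius_pos[of a] by (simp add: Nm_polar)

lemma radius_add_2pi: "radius (a + 2 * pi * of_int k) = radius a"
  by (simp add: radius_def cos_add sin_add)

text \<open>Twice the swept area, extended to all real angles as an antiderivative of
  \<open>(radius a)\<^sup>2\<close> so that full turns are counted; the two conditions determine it
  uniquely.\<close>

definition swept :: "real \<Rightarrow> real" where
  "swept = (SOME F. F 0 = 0 \<and> (\<forall>a. (F has_real_derivative (radius a)\<^sup>2) (at a)))"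

lemma swept: "swept 0 = 0" "(swept has_real_derivative (radius a)\<^sup>2) (at a)"
proof -
  have "continuous_on UNIV (\<lambda>a. (radius a)\<^sup>2)" by (intro continuous_intros continuous_on_radius)
  then have "\<exists>F. F 0 = 0 \<and> (\<forall>a. (F has_real_derivative (radius a)\<^sup>2) (at a))"
    using antiderivative_ex by blast
  from someI_ex[OF this] show "swept 0 = 0" "(swept has_real_derivative (radius a)\<^sup>2) (at a)"
    unfolding swept_def by blast+
qed

lemma radius_bounds: obtains r1 r2 where "0 < r1" "\<And>a. r1 \<le> radius a" "\<And>a. radius a \<le> r2"
proof -
  obtain k where k: "k > 0" "\<And>x. Nm x \<le> k * norm x" using Nm_le_norm by blast
  obtain l where l: "l > 0" "\<And>x. norm x \<le> l * Nm x" using norm_le_Nm by blast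
  have n: "norm (cos a, sin a) = 1" for a :: real by (simp add: norm_Pair)
  show thesis
  proof (rule that[of "1 / k" l])
    fix a
    have p: "0 < Nm (cos a, sin a)" using Nm_pos[OF cis_nonzero] .
    show "1 / k \<le> radius a" using k(2)[of "(cos a, sin a)"] p k(1) by (simp add: n radius_def field_simps)
    show "radius a \<le> l" using l(2)[of "(cos a, sin a)"] p by (simp add: n radius_def field_simps)
  qed (use k in simp)
qed

lemma sector_polar:
  "sector (unit_ball_of Nm) \<alpha> = (\<lambda>(\<rho>, a). (\<rho> * cos a, \<rho> * sin a)) ` {(\<rho>, a). 0 \<le> \<rho> \<and> \<rho> \<le> radius a \<and> 0 \<le> a \<and> a \<le> \<alpha>}"
  (is "_ = ?f ` ?S")
proof (intro equalityI subsetI)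
  fix x assume "x \<in> sector (unit_ball_of Nm) \<alpha>"
  then obtain \<rho> a where "x \<in> unit_ball_of Nm" "\<rho> \<ge> 0" "0 \<le> a" "a \<le> \<alpha>" "x = (\<rho> * cos a, \<rho> * sin a)"
    unfolding sector_def by auto
  then show "x \<in> ?f ` ?S" using Nm_polar_le_1_iff[of \<rho> a]
    by (intro image_eqI[of _ _ "(\<rho>, a)"]) (auto simp: unit_ball_of_def)
next
  fix x assume "x \<in> ?f ` ?S"
  then obtain \<rho> a where "0 \<le> \<rho>" "\<rho> \<le> radius a" "0 \<le> a" "a \<le> \<alpha>" and x: "x = (\<rho> * cos a, \<rho> * sin a)" by auto
  then show "x \<in> sector (unit_ball_of Nm) \<alpha>" using Nm_polar_le_1_iff[of \<rho> a]
    unfolding sector_def by (auto simp: unit_ball_of_def intro!: exI[of _ \<rho>] bexI[of _ a])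
qed

lemma compact_sector: "compact (sector (unit_ball_of Nm) \<alpha>)"
proof -
  obtain r1 r2 where r: "0 < r1" "\<And>a. r1 \<le> radius a" "\<And>a. radius a \<le> r2" using radius_bounds by metis
  have "closed {x :: real \<times> real. 0 \<le> fst x \<and> fst x \<le> radius (snd x) \<and> 0 \<le> snd x \<and> snd x \<le> \<alpha>}"
    by (intro closed_Collect_conj closed_Collect_le continuous_intros
      continuous_on_compose2[OF continuous_on_radius[of UNIV]]) auto
  moreover have "{(\<rho>, a). 0 \<le> \<rho> \<and> \<rho> \<le> radius a \<and> 0 \<le> a \<and> a \<le> \<alpha>} \<subseteq> {0..r2} \<times> {0..\<alpha>}"
    using r(3) order_trans by fastforce
  then have "bounded {(\<rho>, a). 0 \<le> \<rho> \<and> \<rho> \<le> radius a \<and> 0 \<le> a \<and> a \<le> \<alpha>}"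
    by (rule bounded_subset[rotated]) (intro bounded_Times bounded_closed_interval)
  ultimately have "compact {(\<rho>, a). 0 \<le> \<rho> \<and> \<rho> \<le> radius a \<and> 0 \<le> a \<and> a \<le> \<alpha>}"
    by (simp add: compact_eq_bounded_closed case_prod_unfold)
  then show ?thesis
    unfolding sector_polar by (rule compact_continuous_image[rotated]) (auto simp: case_prod_unfold intro!: continuous_intros)
qed

text \<open>In the coordinates \<open>(\<rho>\<^sup>2 / 2, angle)\<close> polar coordinates preserve area, and a sector
  becomes the region under the graph of \<open>radius\<^sup>2 / 2\<close>.\<close>

lemma measure_sector:
  assumes \<alpha>: "0 \<le> \<alpha>" "\<alpha> \<le> 2 * pi"
  shows "2 * measure lborel (sector (unit_ball_of Nm) \<alpha>) = swept \<alpha>"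
proof -
  \<comment> \<open>The vertex and the ray of angle \<open>0\<close> are left out:
    \<open>sqrt\<close> is differentiable only at positive arguments, and the angle of a nonzero
    point is unique in \<open>{0<..2 * pi}\<close>.\<close>
  define W where "W = {p :: real \<times> real. 0 < fst p \<and> fst p \<le> (radius (snd p))\<^sup>2 / 2 \<and> 0 < snd p \<and> snd p \<le> \<alpha>}"
  define g where "g p = (sqrt (2 * fst p) * cos (snd p), sqrt (2 * fst p) * sin (snd p))" for p :: "real \<times> real"
  define V where "V = of_vec2 -` sector (unit_ball_of Nm) \<alpha>"
  define W' where "W' = of_vec2 -` W"
  define g' where "g' v = to_vec2 (g (of_vec2 v))" for v
  have Wb: "W \<in> sets borel"
  proof -
    have "open {p :: real \<times> real. 0 < fst p}" "open {p :: real \<times> real. 0 < snd p}"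
      by (intro open_Collect_less continuous_intros)+
    moreover have "closed {p :: real \<times> real. fst p \<le> (radius (snd p))\<^sup>2 / 2}" "closed {p :: real \<times> real. snd p \<le> \<alpha>}"
      by (intro closed_Collect_le continuous_intros continuous_on_compose2[OF continuous_on_radius[of UNIV]]; simp)+
    ultimately show ?thesis unfolding W_def Collect_conj_eq by (intro sets.Int) (auto intro: borel_open borel_closed)
  qed
  have W': "W' \<in> sets borel" "measure lborel W' = measure lborel W"
    unfolding W'_def using measure_of_vec2[OF Wb] by auto
  have mW: "measure lborel W = swept \<alpha> / 2"
  proof -
    have "emeasure lborel W = emeasure (lborel \<Otimes>\<^sub>M lborel) W" by (simp add: lborel_prod)
    also have "\<dots> = (\<integral>\<^sup>+ a. emeasure lborel ((\<lambda>b. (b, a)) -` W) \<partial>lborel)"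
      by (rule lborel_pair.emeasure_pair_measure_alt2) (use Wb in \<open>simp add: borel_prod[symmetric]\<close>)
    also have "\<dots> = (\<integral>\<^sup>+ a. ennreal ((radius a)\<^sup>2 / 2) * indicator {0..\<alpha>} a \<partial>lborel)"
    proof (rule nn_integral_cong_AE)
      have "AE a in lborel. a \<noteq> (0::real)" by (rule AE_lborel_singleton)
      then show "AE a in lborel. emeasure lborel ((\<lambda>b. (b, a)) -` W) = ennreal ((radius a)\<^sup>2 / 2) * indicator {0..\<alpha>} a"
      proof eventually_elim
        fix a :: real assume "a \<noteq> 0"
        then have "(\<lambda>b. (b, a)) -` W = (if a \<in> {0..\<alpha>} then {0<..(radius a)\<^sup>2 / 2} else {})" by (auto simp: W_def)
        then show "emeasure lborel ((\<lambda>b. (b, a)) -` W) = ennreal ((radius a)\<^sup>2 / 2) * indicator {0..\<alpha>} a" by simp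
      qed
    qed
    also have "\<dots> = ennreal (swept \<alpha> / 2 - swept 0 / 2)"
      by (rule nn_integral_FTC_Icc) (use \<alpha> in \<open>auto intro!: derivative_eq_intros swept(2) borel_measurable_continuous_onI continuous_intros continuous_on_radius has_field_derivative_at_within[OF DERIV_cdivide[OF swept(2)]]\<close>)
    finally have em: "emeasure lborel W = ennreal (swept \<alpha> / 2)" by (simp add: swept)
    have "0 \<le> swept \<alpha>"
      using DERIV_nonneg_imp_nondecreasing[OF \<alpha>(1), of swept] swept by (metis zero_le_power2)
    then show ?thesis using em by (simp add: measure_def)
  qed
  have der: "(g' has_derivative (\<lambda>h. to_vec2
       (cos (v $ 2) / sqrt (2 * v $ 1) * h $ 1 + - (sqrt (2 * v $ 1) * sin (v $ 2)) * h $ 2,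
        sin (v $ 2) / sqrt (2 * v $ 1) * h $ 1 + sqrt (2 * v $ 1) * cos (v $ 2) * h $ 2))) (at v within W')"
    and det: "det (matrix (\<lambda>h. to_vec2
       (cos (v $ 2) / sqrt (2 * v $ 1) * h $ 1 + - (sqrt (2 * v $ 1) * sin (v $ 2)) * h $ 2,
        sin (v $ 2) / sqrt (2 * v $ 1) * h $ 1 + sqrt (2 * v $ 1) * cos (v $ 2) * h $ 2))) = 1" if v: "v \<in> W'" for v
  proof -
    have v1: "v $ 1 > 0" using v by (simp add: W'_def W_def of_vec2_def)
    have g: "(g has_derivative (\<lambda>h. (cos (v $ 2) / sqrt (2 * v $ 1) * fst h + - (sqrt (2 * v $ 1) * sin (v $ 2)) * snd h,
        sin (v $ 2) / sqrt (2 * v $ 1) * fst h + sqrt (2 * v $ 1) * cos (v $ 2) * snd h))) (at (of_vec2 v))"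
      unfolding g_def of_vec2_def using v1
      by (auto intro!: derivative_eq_intros has_derivative_Pair simp: field_simps)
    show "(g' has_derivative (\<lambda>h. to_vec2
       (cos (v $ 2) / sqrt (2 * v $ 1) * h $ 1 + - (sqrt (2 * v $ 1) * sin (v $ 2)) * h $ 2,
        sin (v $ 2) / sqrt (2 * v $ 1) * h $ 1 + sqrt (2 * v $ 1) * cos (v $ 2) * h $ 2))) (at v within W')"
      unfolding g'_def by (rule conj_derivative_vec2(1)[OF g])
    have "cos (v $ 2) / sqrt (2 * v $ 1) * (sqrt (2 * v $ 1) * cos (v $ 2)) - - (sqrt (2 * v $ 1) * sin (v $ 2)) * (sin (v $ 2) / sqrt (2 * v $ 1)) = 1"
      using v1 sin_cos_squared_add[of "v $ 2"] by (simp add: power2_eq_square)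
    then show "det (matrix (\<lambda>h. to_vec2
       (cos (v $ 2) / sqrt (2 * v $ 1) * h $ 1 + - (sqrt (2 * v $ 1) * sin (v $ 2)) * h $ 2,
        sin (v $ 2) / sqrt (2 * v $ 1) * h $ 1 + sqrt (2 * v $ 1) * cos (v $ 2) * h $ 2))) = 1"
      using conj_derivative_vec2(2)[OF g] by simp
  qed
  have polar_eq: "\<rho> = \<sigma> \<and> (\<rho> > 0 \<longrightarrow> a = b)"
    if "\<rho> * cos a = \<sigma> * cos b" "\<rho> * sin a = \<sigma> * sin b" "0 \<le> \<rho>" "0 \<le> \<sigma>" "0 < a" "a \<le> 2 * pi" "0 < b" "b \<le> 2 * pi"
    for \<rho> \<sigma> a b :: real
  proof -
    have "\<rho>\<^sup>2 * ((cos a)\<^sup>2 + (sin a)\<^sup>2) = \<sigma>\<^sup>2 * ((cos b)\<^sup>2 + (sin b)\<^sup>2)"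
      using that(1,2) by (simp only: distrib_left power_mult_distrib[symmetric])
    then have "\<rho> = \<sigma>" using that(3,4) by (simp add: sin_cos_squared_add2)
    moreover have "a = b" if "\<rho> > 0"
    proof -
      have "cos a = cos b" "sin a = sin b" using \<open>\<rho> * cos a = _\<close> \<open>\<rho> * sin a = _\<close> \<open>\<rho> = \<sigma>\<close> that by auto
      then obtain n :: int where n: "a = b + 2 * pi * n" using sin_cos_eq_iff[of a b] by auto
      have "2 * pi * n = a - b" using n by simp
      moreover have "\<bar>a - b\<bar> < 2 * pi" using \<open>0 < a\<close> \<open>a \<le> 2 * pi\<close> \<open>0 < b\<close> \<open>b \<le> 2 * pi\<close> by (auto simp: abs_less_iff)
      ultimately have "\<bar>2 * pi * n\<bar> < 2 * pi" by simp
      then have "\<bar>real_of_int n\<bar> < 1" by (simp add: abs_mult)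
      then show ?thesis using n by simp
    qed
    ultimately show ?thesis by blast
  qed
  have inj: "inj_on g' W'"
  proof (rule inj_onI)
    fix v w assume v: "v \<in> W'" and w: "w \<in> W'" and eq: "g' v = g' w"
    have "g (of_vec2 v) = g (of_vec2 w)" using arg_cong[OF eq, of of_vec2] by (simp add: g'_def)
    then have "sqrt (2 * v $ 1) = sqrt (2 * w $ 1) \<and> (sqrt (2 * v $ 1) > 0 \<longrightarrow> v $ 2 = w $ 2)"
      using v w \<alpha> by (intro polar_eq) (auto simp: g_def of_vec2_def W'_def W_def)
    then show "v = w" using v by (simp add: vec_eq_iff forall_2 W'_def W_def of_vec2_def)
  qed
  have Wm: "W' \<in> sets lebesgue" using W'(1) by simp
  have emW: "emeasure lborel W' < \<infinity>"
  proof (rule emeasure_bounded_finite)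
    obtain r1 r2 where r: "0 < r1" "\<And>a. r1 \<le> radius a" "\<And>a. radius a \<le> r2" using radius_bounds by metis
    have "norm v \<le> r2\<^sup>2 / 2 + \<alpha>" if "v \<in> W'" for v
    proof -
      have "\<bar>v $ 1\<bar> \<le> (radius (v $ 2))\<^sup>2 / 2" "\<bar>v $ 2\<bar> \<le> \<alpha>" using that by (auto simp: W'_def W_def of_vec2_def)
      moreover have "(radius (v $ 2))\<^sup>2 \<le> r2\<^sup>2" by (intro power_mono r) (use radius_pos[of "v $ 2"] in simp)
      moreover have "norm v \<le> \<bar>v $ 1\<bar> + \<bar>v $ 2\<bar>" using norm_le_l1_cart[of v] by (simp add: sum_2)
      ultimately show ?thesis by linarith
    qed
    then show "bounded W'" by (auto simp: bounded_iff)
  qed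
  have "((\<lambda>v. 1 :: real) has_integral measure lebesgue W') W'"
    using has_integral_measure_lborel[OF W'(1) emW] W'(1) by simp
  then have "((\<lambda>v. \<bar>det (matrix (\<lambda>h. to_vec2
       (cos (v $ 2) / sqrt (2 * v $ 1) * h $ 1 + - (sqrt (2 * v $ 1) * sin (v $ 2)) * h $ 2,
        sin (v $ 2) / sqrt (2 * v $ 1) * h $ 1 + sqrt (2 * v $ 1) * cos (v $ 2) * h $ 2)))\<bar>) has_integral measure lebesgue W') W'"
    by (rule has_integral_eq[rotated]) (simp only: det abs_one)
  then have img: "g' ` W' \<in> lmeasurable" "measure lebesgue (g' ` W') = measure lebesgue W'"
    using has_measure_differentiable_image[OF Wm der inj] by auto
  have Vb: "V \<in> sets borel" "measure lborel V = measure lborel (sector (unit_ball_of Nm) \<alpha>)"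
    unfolding V_def using measure_of_vec2[of "sector (unit_ball_of Nm) \<alpha>"] compact_sector compact_imp_closed borel_closed by auto
  have sub: "g' ` W' \<subseteq> V"
  proof (clarify)
    fix v assume v: "v \<in> W'"
    have "sqrt (2 * v $ 1) \<le> sqrt ((radius (v $ 2))\<^sup>2)" using v by (intro real_sqrt_le_mono) (simp add: W'_def W_def of_vec2_def)
    then show "g' v \<in> V"
      unfolding V_def g'_def vimage_eq to_of_vec sector_polar g_def
      using v radius_pos[of "v $ 2"]
      by (intro image_eqI[of _ _ "(sqrt (2 * v $ 1), v $ 2)"]) (auto simp: W'_def W_def of_vec2_def)
  qed
  \<comment> \<open>A point missed by the image has radius or angle \<open>0\<close>, hence lies on
    the horizontal axis, which is a null set.\<close>
  have "V - g' ` W' \<subseteq> {v. v $ 2 = 0}"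
  proof
    fix v assume v: "v \<in> V - g' ` W'"
    then obtain \<rho> a where \<rho>: "0 \<le> \<rho>" "\<rho> \<le> radius a" "0 \<le> a" "a \<le> \<alpha>" "of_vec2 v = (\<rho> * cos a, \<rho> * sin a)"
      unfolding V_def sector_polar by auto
    have "\<not> (\<rho> > 0 \<and> a > 0)"
    proof
      assume "\<rho> > 0 \<and> a > 0"
      then have "to_vec2 (\<rho>\<^sup>2 / 2, a) \<in> W'"
        using \<rho> power_mono[OF \<rho>(2,1), of 2] by (simp add: W'_def W_def)
      moreover have "g' (to_vec2 (\<rho>\<^sup>2 / 2, a)) = v"
        using \<rho>(1,5) by (simp add: g'_def g_def) (metis to_of_vec(1))
      ultimately show False using v by blast
    qed
    then show "v \<in> {v. v $ 2 = 0}" using \<rho> by (auto simp: of_vec2_def)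
  qed
  moreover have "negligible {v :: real^2. v $ 2 = 0}" by (rule negligible_standard_hyperplane_cart)
  ultimately have neg: "negligible (V - g' ` W')" using negligible_subset by blast
  have "measure lebesgue V = measure lebesgue (g' ` W')"
    by (rule measure_negligible_symdiff) (use sub neg img in \<open>auto simp: Diff_eq_empty_iff[THEN iffD2]\<close>)
  then show ?thesis using img(2) W' Vb mW by simp
qed

lemma area_unit_ball: "2 * area (unit_ball_of Nm) = swept (2 * pi)"
proof -
  have "sector (unit_ball_of Nm) (2 * pi) = unit_ball_of Nm"
  proof (intro equalityI subsetI)
    fix x assume x: "x \<in> unit_ball_of Nm"
    define z where "z = Complex (fst x) (snd x)"
    have "0 \<le> Arg2pi z" "Arg2pi z < 2 * pi" "z = cmod z * cis (Arg2pi z)"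
      using Arg2pi[of z] by (simp_all add: cis_conv_exp is_Arg_def)
    moreover have "x = (Re z, Im z)" by (simp add: z_def)
    ultimately have "\<exists>\<rho>\<ge>0. \<exists>\<beta>\<in>{0..2 * pi}. x = (\<rho> * cos \<beta>, \<rho> * sin \<beta>)"
      by (intro exI[of _ "cmod z"] conjI bexI[of _ "Arg2pi z"]) (auto simp: complex_eq_iff)
    then show "x \<in> sector (unit_ball_of Nm) (2 * pi)"
      using x unfolding sector_def by blast
  qed (auto simp: sector_def)
  then show ?thesis using measure_sector[of "2 * pi"] by (simp add: area_def)
qed

end

section \<open>The swept area as a coordinate on the unit sphere\<close>

context plane_norm begin

text \<open>The positive lower bound of \<open>radius\<close> makes \<open>swept\<close> grow at
  least linearly, which will give surjectivity and a Lipschitz inverse.\<close>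

lemma swept_growth: obtains c where "c > 0" "\<And>a b. a \<le> b \<Longrightarrow> c * (b - a) \<le> swept b - swept a"
proof -
  obtain r1 r2 where r: "0 < r1" "\<And>a. r1 \<le> radius a" "\<And>a. radius a \<le> r2" using radius_bounds by metis
  show thesis
  proof (rule that[of "r1\<^sup>2"])
    fix a b :: real assume ab: "a \<le> b"
    have "(\<lambda>x. swept x - r1\<^sup>2 * x) a \<le> (\<lambda>x. swept x - r1\<^sup>2 * x) b"
    proof (rule DERIV_nonneg_imp_nondecreasing[OF ab])
      fix x
      have "((\<lambda>x. swept x - r1\<^sup>2 * x) has_real_derivative (radius x)\<^sup>2 - r1\<^sup>2) (at x)"
        by (auto intro!: derivative_eq_intros swept(2))
      moreover have "r1\<^sup>2 \<le> (radius x)\<^sup>2" using r by (intro power_mono) auto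
      ultimately show "\<exists>y. ((\<lambda>x. swept x - r1\<^sup>2 * x) has_real_derivative y) (at x) \<and> 0 \<le> y"
        by (intro exI[of _ "(radius x)\<^sup>2 - r1\<^sup>2"]) simp
    qed
    then show "r1\<^sup>2 * (b - a) \<le> swept b - swept a" by (simp add: algebra_simps)
  qed (use r in simp)
qed

lemma swept_strict_mono: "a < b \<Longrightarrow> swept a < swept b"
proof -
  assume "a < b"
  obtain c where "c > 0" "\<And>a b. a \<le> b \<Longrightarrow> c * (b - a) \<le> swept b - swept a" using swept_growth by blast
  then have "0 < c * (b - a)" "c * (b - a) \<le> swept b - swept a" using \<open>a < b\<close> by auto
  then show "swept a < swept b" by linarith
qed

lemma swept_less_iff: "swept a < swept b \<longleftrightarrow> a < b"
  using swept_strict_mono[of a b] swept_strict_mono[of b a] by (cases a b rule: linorder_cases) auto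

lemma swept_eq_iff: "swept a = swept b \<longleftrightarrow> a = b"
  using swept_strict_mono[of a b] swept_strict_mono[of b a] by (cases a b rule: linorder_cases) auto

lemma swept_surj: "\<exists>a. swept a = s"
proof -
  obtain c where c: "c > 0" "\<And>a b. a \<le> b \<Longrightarrow> c * (b - a) \<le> swept b - swept a" using swept_growth by blast
  define M where "M = \<bar>s\<bar> / c"
  have M: "M \<ge> 0" "c * M = \<bar>s\<bar>" using c by (simp_all add: M_def)
  have "swept (- M) \<le> s" "s \<le> swept M" using c(2)[of 0 M] c(2)[of "- M" 0] M swept(1) by auto
  then show ?thesis
    using IVT[of swept "- M" s M] M(1) DERIV_isCont[OF swept(2)] by auto
qed

definition angle :: "real \<Rightarrow> real" where "angle s = (THE a. swept a = s)"

lemma swept_angle [simp]: "swept (angle s) = s"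
proof -
  obtain a where a: "swept a = s" using swept_surj by blast
  then have "(THE a. swept a = s) = a" using swept_eq_iff by (intro the_equality) auto
  then show ?thesis using a by (simp add: angle_def)
qed

lemma angle_swept [simp]: "angle (swept a) = a"
  using swept_eq_iff[of "angle (swept a)" a] by simp

lemma angle_less_iff: "angle s < angle t \<longleftrightarrow> s < t"
  using swept_less_iff[of "angle s" "angle t"] by simp

lemma angle_Lipschitz: obtains L where "L > 0" "\<And>s t. \<bar>angle s - angle t\<bar> \<le> L * \<bar>s - t\<bar>"
proof -
  obtain c where c: "c > 0" "\<And>a b. a \<le> b \<Longrightarrow> c * (b - a) \<le> swept b - swept a" using swept_growth by blast
  show thesis
  proof (rule that[of "1 / c"])
    fix s t
    show "\<bar>angle s - angle t\<bar> \<le> 1 / c * \<bar>s - t\<bar>"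
      using c(2)[of "angle s" "angle t"] c(2)[of "angle t" "angle s"] c(1)
      by (cases "angle s \<le> angle t") (auto simp: field_simps)
  qed (use c in simp)
qed

lemma angle_has_derivative: "(angle has_real_derivative 1 / (radius (angle s))\<^sup>2) (at s)"
proof -
  obtain L where L: "L > 0" "\<And>s t. \<bar>angle s - angle t\<bar> \<le> L * \<bar>s - t\<bar>" using angle_Lipschitz by blast
  have "L-lipschitz_on UNIV angle" using L by (intro lipschitz_onI) (auto simp: dist_real_def)
  then have "isCont angle s"
    using lipschitz_on_continuous_on continuous_on_eq_continuous_at open_UNIV UNIV_I by blast
  then have "(angle has_real_derivative inverse ((radius (angle s))\<^sup>2)) (at s)"
    by (intro DERIV_inverse_function[OF swept(2), of _ _ "s - 1" "s + 1"]) (use radius_pos[of "angle s"] in auto)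
  then show ?thesis by (simp add: divide_inverse)
qed

lemma swept_add_2pi: "swept (a + 2 * pi * of_int k) = swept a + of_int k * swept (2 * pi)"
proof -
  have step: "swept (a + 2 * pi) = swept a + swept (2 * pi)" for a
  proof -
    have "((\<lambda>x. swept (x + 2 * pi) - swept x) has_real_derivative 0) (at x)" for x
    proof -
      have "((\<lambda>x. swept (x + 2 * pi)) has_real_derivative (radius (x + 2 * pi))\<^sup>2) (at x)"
        using DERIV_shift[of swept "(radius (x + 2 * pi))\<^sup>2" x "2 * pi"] swept(2) by simp
      from DERIV_diff[OF this swept(2)[of x]] show ?thesis using radius_add_2pi[of x 1] by simp
    qed
    then have "swept (a + 2 * pi) - swept a = swept (0 + 2 * pi) - swept 0"
      using DERIV_isconst_all[of "\<lambda>x. swept (x + 2 * pi) - swept x" a 0] by blast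
    then show ?thesis by (simp add: swept)
  qed
  show ?thesis
  proof (induction k rule: int_induct[where k = 0])
    case (step1 i)
    then show ?case using step[of "a + 2 * pi * of_int i"] by (simp add: algebra_simps)
  next
    case (step2 i)
    then show ?case using step[of "a + 2 * pi * of_int (i - 1)"] by (simp add: algebra_simps)
  qed simp
qed

lemma angle_add_area: "angle (s + 2 * of_int k * area (unit_ball_of Nm)) = angle s + 2 * pi * of_int k"
proof -
  have "s + 2 * of_int k * area (unit_ball_of Nm) = swept (angle s + 2 * pi * of_int k)"
    unfolding swept_add_2pi area_unit_ball[symmetric] by simp
  then show ?thesis by simp
qed

lemma frontier_unit_ball: "frontier (unit_ball_of Nm) = {x. Nm x = 1}"
proof -
  have "interior (unit_ball_of Nm) = {x. Nm x < 1}"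
  proof (rule interior_unique)
    show "open {x. Nm x < 1}" by (intro open_Collect_less continuous_on_Nm continuous_intros)
    fix T assume T: "T \<subseteq> unit_ball_of Nm" "open T"
    show "T \<subseteq> {x. Nm x < 1}"
    proof
      fix x assume x: "x \<in> T"
      show "x \<in> {x. Nm x < 1}"
      proof (rule ccontr)
        assume "x \<notin> {x. Nm x < 1}"
        then have x1: "Nm x = 1" using T x by (force simp: unit_ball_of_def)
        obtain e where e: "e > 0" "ball x e \<subseteq> T" using T(2) x open_contains_ball by blast
        define d where "d = e / (2 * (norm x + 1))"
        have d: "d > 0" using e(1) by (simp add: d_def add_nonneg_pos)
        have "d * norm x < e"
        proof -
          have "e * norm x < e * (2 * (norm x + 1))" using e(1) by (intro mult_strict_left_mono) (auto simp: add_nonneg_pos intro: le_less_trans[of _ "2 * norm x"])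
          then show ?thesis by (simp add: d_def add_nonneg_pos divide_less_eq)
        qed
        then have "(1 + d) *\<^sub>R x \<in> ball x e"
          using d by (simp add: dist_norm algebra_simps)
        then have "Nm ((1 + d) *\<^sub>R x) \<le> 1" using e T by (auto simp: unit_ball_of_def)
        then show False using d x1 by (simp only: Nm_scale) simp
      qed
    qed
  qed (auto simp: unit_ball_of_def)
  moreover have "closure (unit_ball_of Nm) = unit_ball_of Nm"
    using compact_unit_ball compact_imp_closed closure_closed by blast
  ultimately have "frontier (unit_ball_of Nm) = {x. Nm x \<le> 1} - {x. Nm x < 1}"
    by (simp add: frontier_def unit_ball_of_def)
  then show ?thesis by force
qed

text \<open>The floor in \<open>trig_pt\<close> counts the same full turns as the floor of the
  lifted angle, because \<open>swept\<close> maps \<open>{0..<2 * pi}\<close> into one area period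
  and gains one such period per turn. After this reduction, injectivity of \<open>swept\<close>
  identifies the point described by \<open>THE\<close>.\<close>

theorem trig_pt_unit_ball:
  "trig_pt (unit_ball_of Nm) s = (radius (angle s) * cos (angle s), radius (angle s) * sin (angle s))"
proof -
  let ?S = "unit_ball_of Nm"
  define a where "a = angle s"
  define k where "k = \<lfloor>a / (2 * pi)\<rfloor>"
  define b where "b = a - 2 * pi * of_int k"
  define M where "M = swept (2 * pi)"
  have M: "2 * area ?S = M" by (simp add: area_unit_ball M_def)
  have "of_int k \<le> a / (2 * pi)" "a / (2 * pi) < of_int k + 1" unfolding k_def by linarith+
  then have b: "0 \<le> b" "b < 2 * pi" by (auto simp: b_def field_simps)
  have a: "a = b + 2 * pi * of_int k" by (simp add: b_def)
  have s: "s = swept b + of_int k * M" using swept_add_2pi[of b k] a by (simp add: a_def[symmetric] M_def) (metis a_def swept_angle)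
  have M0: "M > 0" using swept_strict_mono[of 0 "2 * pi"] swept by (simp add: M_def)
  have sb: "0 \<le> swept b" "swept b < M"
    using swept_less_iff[of b "2 * pi"] swept_less_iff[of b 0] swept b by (auto simp: M_def not_less[symmetric])
  have "\<lfloor>s / M\<rfloor> = k"
    by (rule floor_unique) (use s sb M0 in \<open>auto simp: field_simps\<close>)
  then have th: "s - 2 * area ?S * of_int \<lfloor>s / (2 * area ?S)\<rfloor> = swept b" by (simp add: M s)
  have rb: "radius b = radius a" using radius_add_2pi[of b k] by (simp add: a)
  have cs: "cos b = cos a" "sin b = sin a" using a by (simp_all add: cos_add sin_add)
  define Q where "Q = (radius b * cos b, radius b * sin b)"
  have nQ: "norm (r * cos c, r * sin c) = r" if "r \<ge> 0" for r c :: real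
    using that by (simp add: norm_Pair power_mult_distrib flip: distrib_left)
  have "(THE P. P \<in> frontier ?S \<and> (\<exists>\<alpha>\<in>{0..<2*pi}. P = (norm P * cos \<alpha>, norm P * sin \<alpha>)
      \<and> 2 * measure lborel (sector ?S \<alpha>) = swept b)) = Q"
  proof (rule the_equality)
    show "Q \<in> frontier ?S \<and> (\<exists>\<alpha>\<in>{0..<2*pi}. Q = (norm Q * cos \<alpha>, norm Q * sin \<alpha>)
      \<and> 2 * measure lborel (sector ?S \<alpha>) = swept b)"
    proof (intro conjI bexI[of _ b])
      show "Q \<in> frontier ?S" by (simp add: frontier_unit_ball Q_def Nm_polar_radius)
      show "Q = (norm Q * cos b, norm Q * sin b)" using nQ[of "radius b" b] radius_pos[of b] by (simp add: Q_def)
      show "2 * measure lborel (sector ?S b) = swept b" using b by (intro measure_sector) auto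
    qed (use b in auto)
    fix P assume P: "P \<in> frontier ?S \<and> (\<exists>\<alpha>\<in>{0..<2*pi}. P = (norm P * cos \<alpha>, norm P * sin \<alpha>)
      \<and> 2 * measure lborel (sector ?S \<alpha>) = swept b)"
    then obtain c where c: "c \<in> {0..<2*pi}" "P = (norm P * cos c, norm P * sin c)" "2 * measure lborel (sector ?S c) = swept b"
      by blast
    have "swept c = swept b" using c measure_sector[of c] by simp
    then have "c = b" by (simp add: swept_eq_iff)
    moreover have "Nm P = norm P / radius c" using Nm_polar[of "norm P" c] c(2) by (metis norm_ge_zero)
    then have "norm P = radius c" using P radius_pos[of c] by (simp add: frontier_unit_ball)
    ultimately show "P = Q" unfolding Q_def using c(2) by metis
  qed
  then show ?thesis
    unfolding trig_pt_def Let_def th by (simp add: Q_def rb cs a_def)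
qed

lemma Nm_trig_pt: "Nm (trig_pt (unit_ball_of Nm) s) = 1"
  by (simp add: trig_pt_unit_ball Nm_polar_radius)

end

section \<open>The polar curve and its maximizers\<close>

lemma R2_norm_bounds:
  fixes p :: R2
  shows "\<bar>fst p\<bar> \<le> norm p" "\<bar>snd p\<bar> \<le> norm p" "norm p \<le> \<bar>fst p\<bar> + \<bar>snd p\<bar>"
  using norm_fst_le[of "fst p" "snd p"] norm_snd_le[of "snd p" "fst p"] norm_Pair_le[of "fst p" "snd p"]
  unfolding prod.collapse real_norm_def .

lemma Lipschitz_mult_real:
  fixes f g :: "real \<Rightarrow> real"
  assumes "\<And>x y. \<bar>f x - f y\<bar> \<le> L * \<bar>x - y\<bar>" "\<And>x y. \<bar>g x - g y\<bar> \<le> M * \<bar>x - y\<bar>"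
    and "\<And>x. \<bar>f x\<bar> \<le> A" "\<And>x. \<bar>g x\<bar> \<le> B"
  shows "\<bar>f x * g x - f y * g y\<bar> \<le> (A * M + B * L) * \<bar>x - y\<bar>"
proof -
  have AB: "0 \<le> A" "0 \<le> B" using assms(3,4)[of 0] by auto
  have "f x * g x - f y * g y = f x * (g x - g y) + g y * (f x - f y)" by (simp add: algebra_simps)
  then have "\<bar>f x * g x - f y * g y\<bar> \<le> \<bar>f x\<bar> * \<bar>g x - g y\<bar> + \<bar>g y\<bar> * \<bar>f x - f y\<bar>"
    using abs_triangle_ineq by (metis abs_mult)
  also have "\<dots> \<le> A * (M * \<bar>x - y\<bar>) + B * (L * \<bar>x - y\<bar>)"
    by (intro add_mono mult_mono assms AB) auto
  finally show ?thesis by (simp add: algebra_simps)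
qed

lemma sin_cos_Lipschitz: "\<bar>sin x - sin y\<bar> \<le> 1 * \<bar>x - y :: real\<bar>" "\<bar>cos x - cos y\<bar> \<le> 1 * \<bar>x - y\<bar>"
proof -
  have "norm (sin x - sin y) \<le> 1 * norm (x - y)"
    by (rule field_differentiable_bound[of UNIV _ cos]) (simp_all add: DERIV_sin)
  then show "\<bar>sin x - sin y\<bar> \<le> 1 * \<bar>x - y\<bar>" by simp
  have "norm (cos x - cos y) \<le> 1 * norm (x - y)"
    by (rule field_differentiable_bound[of UNIV _ "\<lambda>x. - sin x"]) (simp_all add: DERIV_cos)
  then show "\<bar>cos x - cos y\<bar> \<le> 1 * \<bar>x - y\<bar>" by simp
qed

lemma arctan_Lipschitz: "\<bar>arctan x - arctan y\<bar> \<le> \<bar>x - y\<bar>"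
proof -
  have "norm (arctan x - arctan y) \<le> 1 * norm (x - y)"
  proof (rule field_differentiable_bound[of UNIV arctan "\<lambda>x. inverse (1 + x\<^sup>2)"])
    fix z :: real
    have "1 \<le> 1 + z\<^sup>2" by simp
    then show "norm (inverse (1 + z\<^sup>2)) \<le> 1" by (simp add: inverse_le_1_iff)
  qed (auto intro: DERIV_arctan)
  then show ?thesis by simp
qed

lemma mono_of_locally_mono:
  fixes f :: "real \<Rightarrow> real"
  assumes "d > 0" "\<And>s t. s < t \<Longrightarrow> t - s < d \<Longrightarrow> f s \<le> f t"
  shows "mono f"
proof (rule monoI)
  fix s t :: real assume st: "s \<le> t"
  obtain n :: nat where n: "(t - s) / d < n" using reals_Archimedean2 by blast
  then have n0: "n > 0" using st assms(1) by (cases n) (auto simp: divide_less_0_iff not_less)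
  define h where "h = (t - s) / n"
  have h: "0 \<le> h" "h < d" using st n n0 assms(1) by (auto simp: h_def field_simps)
  have step: "f (s + real k * h) \<le> f (s + real (Suc k) * h)" for k
    using assms(2)[of "s + real k * h" "s + real (Suc k) * h"] h by (cases "h = 0") (auto simp: algebra_simps)
  have "f s \<le> f (s + real n * h)"
  proof (induction n)
    case (Suc n)
    then show ?case using step[of n] by linarith
  qed simp
  then show "f s \<le> f t" using n0 by (simp add: h_def)
qed

context plane_norm begin

lemma radius_Lipschitz: obtains L where "L > 0" "\<And>a b. \<bar>radius a - radius b\<bar> \<le> L * \<bar>a - b\<bar>"
proof -
  obtain k where k: "k > 0" "\<And>x. Nm x \<le> k * norm x" using Nm_le_norm by blast
  obtain r1 r2 where r: "0 < r1" "\<And>a. r1 \<le> radius a" "\<And>a. radius a \<le> r2" using radius_bounds by metis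
  have r2: "r2 > 0" using r(1) r(2)[of 0] r(3)[of 0] by linarith
  show thesis
  proof (rule that[of "r2 * r2 * (k * 2)"])
    fix a b
    define N where "N a = Nm (cos a, sin a)" for a
    have N: "N a > 0" for a using Nm_pos[OF cis_nonzero] by (simp add: N_def)
    have "norm ((cos a, sin a) - (cos b, sin b)) \<le> 2 * \<bar>a - b\<bar>"
      using norm_Pair_le[of "cos a - cos b" "sin a - sin b"] sin_cos_Lipschitz[of a b] by simp
    then have "k * norm ((cos a, sin a) - (cos b, sin b)) \<le> k * (2 * \<bar>a - b\<bar>)" using k(1) by simp
    then have "\<bar>N b - N a\<bar> \<le> k * (2 * \<bar>a - b\<bar>)"
      using k(2)[of "(cos a, sin a) - (cos b, sin b)"] k(2)[of "(cos b, sin b) - (cos a, sin a)"]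
        Nm_diff_le[of "(cos a, sin a)" "(cos b, sin b)"] Nm_diff_le[of "(cos b, sin b)" "(cos a, sin a)"]
      unfolding N_def norm_minus_commute[of "(cos b, sin b)"] by linarith
    moreover have "radius a - radius b = radius a * radius b * (N b - N a)"
      using N[of a] N[of b] by (simp add: radius_def N_def[symmetric] field_simps)
    then have "\<bar>radius a - radius b\<bar> = radius a * radius b * \<bar>N b - N a\<bar>"
      using radius_pos[of a] radius_pos[of b] by (simp add: abs_mult)
    moreover have "radius a * radius b \<le> r2 * r2"
      using r radius_pos[of a] radius_pos[of b] r2 by (intro mult_mono) (auto intro: less_imp_le)
    ultimately show "\<bar>radius a - radius b\<bar> \<le> r2 * r2 * (k * 2) * \<bar>a - b\<bar>"
      using r2 mult_mono[of "radius a * radius b" "r2 * r2" "\<bar>N b - N a\<bar>" "k * (2 * \<bar>a - b\<bar>)"] by (simp add: mult_ac)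
  qed (use k r2 in simp)
qed

lemma trig_pt_Lipschitz:
  obtains L where "L > 0" "\<And>s t. norm (trig_pt (unit_ball_of Nm) s - trig_pt (unit_ball_of Nm) t) \<le> L * \<bar>s - t\<bar>"
proof -
  obtain k where k: "k > 0" "\<And>s t. \<bar>angle s - angle t\<bar> \<le> k * \<bar>s - t\<bar>" using angle_Lipschitz by blast
  obtain l where l: "l > 0" "\<And>s t. \<bar>radius s - radius t\<bar> \<le> l * \<bar>s - t\<bar>" using radius_Lipschitz by blast
  obtain r1 r2 where r: "0 < r1" "\<And>a. r1 \<le> radius a" "\<And>a. radius a \<le> r2" using radius_bounds by metis
  have ar: "\<bar>radius a\<bar> \<le> r2" for a using r(3)[of a] radius_pos[of a] by simp
  have r2: "r2 \<ge> 0" using ar[of 0] by simp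
  define c where "c = r2 * 1 + 1 * l"
  have c: "c > 0" using r2 l by (simp add: c_def add_nonneg_pos)
  show thesis
  proof (rule that[of "2 * c * k"])
    fix s t
    have "\<bar>radius a * cos a - radius b * cos b\<bar> \<le> c * \<bar>a - b\<bar>" "\<bar>radius a * sin a - radius b * sin b\<bar> \<le> c * \<bar>a - b\<bar>" for a b
      unfolding c_def by (intro Lipschitz_mult_real l sin_cos_Lipschitz ar; simp)+
    then have "norm (trig_pt (unit_ball_of Nm) s - trig_pt (unit_ball_of Nm) t) \<le> c * \<bar>angle s - angle t\<bar> + c * \<bar>angle s - angle t\<bar>"
      unfolding trig_pt_unit_ball diff_Pair by (intro order_trans[OF norm_Pair_le] add_mono) (simp_all only: real_norm_def)
    also have "\<dots> \<le> 2 * c * k * \<bar>s - t\<bar>" using mult_left_mono[OF k(2)[of s t], of c] c by (simp add: mult_ac)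
    finally show "norm (trig_pt (unit_ball_of Nm) s - trig_pt (unit_ball_of Nm) t) \<le> 2 * c * k * \<bar>s - t\<bar>" .
  qed (use c k in simp)
qed

end

context regular_norm begin

text \<open>\<open>Pc s\<close> runs along the dual unit sphere with \<open>Pc' s = J (uc s)\<close>, where \<open>J (a, b) = (- b, a)\<close> and \<open>uc s\<close>
  is the point of the unit sphere at which \<open>Pc s\<close> is maximal.\<close>

definition Pc where "Pc = trig_pt (unit_ball_of Nd)"
definition uc where "uc s = dir (Pc s)"

lemma Nd_Pc: "Nd (Pc s) = 1" by (simp add: Pc_def dual.Nm_trig_pt)

lemma Pc_nonzero: "Pc s \<noteq> 0"
proof
  assume "Pc s = 0"
  then show False using Nd_Pc[of s] dual.Nm_zero by simp
qed

lemma Nm_uc: "Nm (uc s) = 1" and Pc_uc: "Pc s \<bullet> uc s = 1"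
  using dir[OF Pc_nonzero[of s]] by (simp_all add: uc_def Nd_Pc)

lemma Pc_polar: "Pc s = (dual.radius (dual.angle s) * cos (dual.angle s), dual.radius (dual.angle s) * sin (dual.angle s))"
  by (simp add: Pc_def dual.trig_pt_unit_ball)

text \<open>In polar form the derivative of \<open>dual.radius\<close> comes from that of
  \<open>Nd\<close>, whose gradient is \<open>uc s\<close>, and the angle has speed
  \<open>1 / R\<^sup>2\<close> in the area coordinate. The relation
  \<open>Pc s \<bullet> uc s = 1\<close> then collapses the result to \<open>uc s\<close> turned by
  a right angle.\<close>

lemma Pc_has_derivative:
  "((\<lambda>s. fst (Pc s)) has_real_derivative - snd (uc s)) (at s)"
  "((\<lambda>s. snd (Pc s)) has_real_derivative fst (uc s)) (at s)"
proof -
  define a where "a = dual.angle s"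
  define R where "R = dual.radius a"
  define u1 u2 where "u1 = fst (uc s)" and "u2 = snd (uc s)"
  have R: "R > 0" using dual.radius_pos by (simp add: R_def)
  have Pc: "Pc s = (R * cos a, R * sin a)" by (simp add: Pc_polar R_def a_def)
  have Nc: "Nd (cos a, sin a) = 1 / R" by (simp add: R_def dual.radius_def)
  have nz: "(cos a, sin a) \<noteq> (0 :: R2)" by (rule dual.cis_nonzero)
  have "Pc s \<bullet> v = R * ((cos a, sin a) \<bullet> v)" for v by (simp add: Pc inner_prod_def algebra_simps)
  \<comment> \<open>Positive factors do not change maximizers, so \<open>uc s\<close> is also the
    maximizer of the unnormalized covector \<open>(cos a, sin a)\<close>.\<close>
  then have "dir (cos a, sin a) = uc s"
    using dir[OF nz] R by (intro maximizer_unique[OF Nd_Pc[of s] _ Pc_uc _ Nm_uc]) (auto simp: Nc)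
  then have "(Nd has_derivative (\<lambda>h. uc s \<bullet> h)) (at (cos a, sin a))" using Nd_has_derivative[OF nz] by simp
  moreover have "((\<lambda>a. (cos a, sin a)) has_derivative (\<lambda>h. (- sin a * h, cos a * h))) (at a)"
    by (auto intro!: derivative_eq_intros has_derivative_Pair)
  ultimately have "((\<lambda>a. Nd (cos a, sin a)) has_derivative (\<lambda>h. uc s \<bullet> (- sin a * h, cos a * h))) (at a)"
    by (rule has_derivative_compose[rotated])
  then have dN: "((\<lambda>a. Nd (cos a, sin a)) has_real_derivative u2 * cos a - u1 * sin a) (at a)"
    unfolding has_field_derivative_def by (rule has_derivative_eq_rhs) (auto simp: u1_def u2_def inner_prod_def algebra_simps)
  have "((\<lambda>a. 1 / Nd (cos a, sin a)) has_real_derivative - (u2 * cos a - u1 * sin a) * R\<^sup>2) (at a)"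
    using dN R by (auto intro!: derivative_eq_intros simp: Nc power2_eq_square)
  then have dR: "(dual.radius has_real_derivative - (u2 * cos a - u1 * sin a) * R\<^sup>2) (at a)"
    unfolding dual.radius_def[abs_def] .
  have eq: "R * (u1 * cos a + u2 * sin a) = 1"
    using Pc_uc[of s] by (simp add: Pc u1_def u2_def inner_prod_def algebra_simps)
  have cs: "cos a * cos a + sin a * sin a = 1" using sin_cos_squared_add2[of a] by (simp add: power2_eq_square)
  have "- (u2 * cos a - u1 * sin a) * R\<^sup>2 * cos a - R * sin a = - u2 * R\<^sup>2"
  proof -
    have alg: "R\<^sup>2 * (u1 * s * c - u2 * (c * c)) - R\<^sup>2 * (u1 * s * c + u2 * (s * s)) = - u2 * R\<^sup>2 * (c * c + s * s)" for c s
      by (simp add: algebra_simps)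
    have e1: "R * sin a = R\<^sup>2 * (u1 * sin a * cos a + u2 * (sin a * sin a))"
      using arg_cong[OF eq, of "\<lambda>z. R * sin a * z"] by (simp add: power2_eq_square algebra_simps)
    have e2: "- (u2 * cos a - u1 * sin a) * R\<^sup>2 * cos a = R\<^sup>2 * (u1 * sin a * cos a - u2 * (cos a * cos a))"
      by (simp add: algebra_simps)
    have "- (u2 * cos a - u1 * sin a) * R\<^sup>2 * cos a - R * sin a = - u2 * R\<^sup>2 * (cos a * cos a + sin a * sin a)"
      unfolding e2 unfolding e1 by (rule alg)
    then show ?thesis unfolding cs by simp
  qed
  moreover have "((\<lambda>a. dual.radius a * cos a) has_real_derivative (- (u2 * cos a - u1 * sin a) * R\<^sup>2 * cos a - R * sin a)) (at a)"
    using DERIV_mult[OF dR DERIV_cos[of a]] by (simp add: R_def algebra_simps)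
  ultimately have d1: "((\<lambda>a. dual.radius a * cos a) has_real_derivative - u2 * R\<^sup>2) (at a)" by simp
  have "- (u2 * cos a - u1 * sin a) * R\<^sup>2 * sin a + R * cos a = u1 * R\<^sup>2"
  proof -
    have alg: "R\<^sup>2 * (u1 * (s * s) - u2 * s * c) + R\<^sup>2 * (u1 * (c * c) + u2 * s * c) = u1 * R\<^sup>2 * (c * c + s * s)" for c s
      by (simp add: algebra_simps)
    have e1: "R * cos a = R\<^sup>2 * (u1 * (cos a * cos a) + u2 * sin a * cos a)"
      using arg_cong[OF eq, of "\<lambda>z. R * cos a * z"] by (simp add: power2_eq_square algebra_simps)
    have e2: "- (u2 * cos a - u1 * sin a) * R\<^sup>2 * sin a = R\<^sup>2 * (u1 * (sin a * sin a) - u2 * sin a * cos a)"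
      by (simp add: algebra_simps)
    have "- (u2 * cos a - u1 * sin a) * R\<^sup>2 * sin a + R * cos a = u1 * R\<^sup>2 * (cos a * cos a + sin a * sin a)"
      unfolding e2 unfolding e1 by (rule alg)
    then show ?thesis unfolding cs by simp
  qed
  moreover have "((\<lambda>a. dual.radius a * sin a) has_real_derivative (- (u2 * cos a - u1 * sin a) * R\<^sup>2 * sin a + R * cos a)) (at a)"
    using DERIV_mult[OF dR DERIV_sin[of a]] by (simp add: R_def algebra_simps)
  ultimately have d2: "((\<lambda>a. dual.radius a * sin a) has_real_derivative u1 * R\<^sup>2) (at a)" by simp
  have da: "(dual.angle has_real_derivative 1 / R\<^sup>2) (at s)" using dual.angle_has_derivative[of s] by (simp add: R_def a_def)
  from DERIV_chain2[OF d1[unfolded a_def] da] show "((\<lambda>s. fst (Pc s)) has_real_derivative - snd (uc s)) (at s)"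
    using R by (simp add: Pc_polar u2_def)
  from DERIV_chain2[OF d2[unfolded a_def] da] show "((\<lambda>s. snd (Pc s)) has_real_derivative fst (uc s)) (at s)"
    using R by (simp add: Pc_polar u1_def)
qed

lemma uc_bounded: obtains k where "k > 0" "\<And>s. \<bar>fst (uc s)\<bar> \<le> k" "\<And>s. \<bar>snd (uc s)\<bar> \<le> k" "\<And>v. norm v \<le> k * Nm v"
proof -
  obtain k where k: "k > 0" "\<And>x. norm x \<le> k * Nm x" using norm_le_Nm by blast
  have "\<bar>fst (uc s)\<bar> \<le> k" "\<bar>snd (uc s)\<bar> \<le> k" for s
    using k(2)[of "uc s"] R2_norm_bounds[of "uc s"] by (auto simp: Nm_uc)
  then show thesis using that k by blast
qed

lemma Pc_Lipschitz: obtains L where "L > 0" "\<And>s t. \<bar>fst (Pc s) - fst (Pc t)\<bar> \<le> L * \<bar>s - t\<bar>"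
    "\<And>s t. \<bar>snd (Pc s) - snd (Pc t)\<bar> \<le> L * \<bar>s - t\<bar>"
proof -
  obtain k where k: "k > 0" "\<And>s. \<bar>fst (uc s)\<bar> \<le> k" "\<And>s. \<bar>snd (uc s)\<bar> \<le> k" using uc_bounded by metis
  show thesis
  proof (rule that[OF k(1)])
    fix s t
    have "norm (fst (Pc s) - fst (Pc t)) \<le> k * norm (s - t)"
      by (rule field_differentiable_bound[of UNIV _ "\<lambda>s. - snd (uc s)"]) (auto intro: Pc_has_derivative k)
    moreover have "norm (snd (Pc s) - snd (Pc t)) \<le> k * norm (s - t)"
      by (rule field_differentiable_bound[of UNIV _ "\<lambda>s. fst (uc s)"]) (auto intro: Pc_has_derivative k)
    ultimately show "\<bar>fst (Pc s) - fst (Pc t)\<bar> \<le> k * \<bar>s - t\<bar>" "\<bar>snd (Pc s) - snd (Pc t)\<bar> \<le> k * \<bar>s - t\<bar>" by simp_all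
  qed
qed

lemma uc_Lipschitz: obtains L where "L > 0" "\<And>s t. \<bar>fst (uc s) - fst (uc t)\<bar> \<le> L * \<bar>s - t\<bar>"
    "\<And>s t. \<bar>snd (uc s) - snd (uc t)\<bar> \<le> L * \<bar>s - t\<bar>"
proof -
  obtain L where L: "L > 0" "\<And>p q. Nd p = 1 \<Longrightarrow> Nd q = 1 \<Longrightarrow> norm (dir p - dir q) \<le> L * norm (p - q)"
    using dir_Lipschitz by metis
  obtain M where M: "M > 0" "\<And>s t. \<bar>fst (Pc s) - fst (Pc t)\<bar> \<le> M * \<bar>s - t\<bar>"
    "\<And>s t. \<bar>snd (Pc s) - snd (Pc t)\<bar> \<le> M * \<bar>s - t\<bar>" using Pc_Lipschitz by metis
  have *: "norm (uc s - uc t) \<le> L * (2 * M) * \<bar>s - t\<bar>" for s t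
  proof -
    have "norm (uc s - uc t) \<le> L * norm (Pc s - Pc t)" unfolding uc_def by (intro L Nd_Pc)
    also have "norm (Pc s - Pc t) \<le> M * \<bar>s - t\<bar> + M * \<bar>s - t\<bar>"
      using R2_norm_bounds(3)[of "Pc s - Pc t"] M(2,3)[of s t] by simp
    finally show ?thesis using L(1) by (simp add: algebra_simps)
  qed
  show thesis
  proof (rule that[of "L * (2 * M)"])
    fix s t
    show "\<bar>fst (uc s) - fst (uc t)\<bar> \<le> L * (2 * M) * \<bar>s - t\<bar>" "\<bar>snd (uc s) - snd (uc t)\<bar> \<le> L * (2 * M) * \<bar>s - t\<bar>"
      using *[of s t] R2_norm_bounds(1,2)[of "uc s - uc t"] by simp_all
  qed (use L M in simp)
qed

lemma Pc_inj:
  assumes "Pc s = Pc t" "\<bar>s - t\<bar> < 2 * area (polar_set (unit_ball_of Nm))"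
  shows "s = t"
proof -
  define a b where "a = dual.angle s" and "b = dual.angle t"
  have r: "dual.radius a > 0" "dual.radius b > 0" by (simp_all add: dual.radius_pos)
  have eq: "dual.radius a * cos a = dual.radius b * cos b" "dual.radius a * sin a = dual.radius b * sin b"
    using assms(1) by (simp_all add: Pc_polar a_def b_def)
  have "(dual.radius a)\<^sup>2 * ((cos a)\<^sup>2 + (sin a)\<^sup>2) = (dual.radius b)\<^sup>2 * ((cos b)\<^sup>2 + (sin b)\<^sup>2)"
    using eq by (simp only: distrib_left power_mult_distrib[symmetric])
  then have "dual.radius a = dual.radius b" using r by (simp add: sin_cos_squared_add2)
  then have "sin a = sin b" "cos a = cos b" using eq r by auto
  then obtain n :: int where n: "a = b + 2 * pi * n" using sin_cos_eq_iff[of a b] by auto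
  define A where "A = area (unit_ball_of Nd)"
  have "dual.swept a = dual.swept b + n * (2 * A)"
    unfolding n dual.swept_add_2pi A_def by (simp add: dual.area_unit_ball)
  then have st: "s - t = n * (2 * A)" by (simp add: a_def b_def)
  have "\<bar>of_int n * (2 * A)\<bar> < 2 * A" using assms(2) st by (simp add: A_def polar_unit_ball)
  then have "\<bar>real_of_int n\<bar> * \<bar>2 * A\<bar> < 2 * A" by (simp only: abs_mult)
  moreover from this have "2 * A > 0" by (metis abs_ge_zero le_less_trans mult_nonneg_nonneg)
  ultimately have "\<bar>real_of_int n\<bar> < 1" by simp
  then have "n = 0" by linarith
  then show "s = t" using st by simp
qed

text \<open>Since the covector can be recovered from its maximizer, \<open>uc\<close> repeats a
  value only where \<open>Pc\<close> does, that is after full periods of the area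
  coordinate.\<close>

lemma uc_inj:
  assumes "uc s = uc t" "\<bar>s - t\<bar> < 2 * area (polar_set (unit_ball_of Nm))"
  shows "s = t"
proof (rule Pc_inj[OF _ assms(2)])
  have "Pc t \<bullet> uc s = 1" using Pc_uc[of t] assms(1) by simp
  then show "Pc s = Pc t" by (rule dual_unit_determined[OF Nd_Pc Nd_Pc Pc_uc _ Nm_uc])
qed

text \<open>A lift of the polar angle of \<open>uc\<close>: since \<open>Pc \<bullet> uc = 1\<close>, the angle from \<open>Pc\<close> to \<open>uc\<close> has
  tangent \<open>Pc \<times> uc\<close> and lies in \<open>(- pi / 2, pi / 2)\<close>.\<close>

definition uangle where
  "uangle s = dual.angle s + arctan (fst (Pc s) * snd (uc s) - snd (Pc s) * fst (uc s))"

lemma uc_polar: "uc s = (radius (uangle s) * cos (uangle s), radius (uangle s) * sin (uangle s))"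
proof -
  define a where "a = dual.angle s"
  define R where "R = dual.radius a"
  define u1 u2 where "u1 = fst (uc s)" and "u2 = snd (uc s)"
  have R: "R > 0" using dual.radius_pos by (simp add: R_def)
  have Pc: "Pc s = (R * cos a, R * sin a)" by (simp add: Pc_polar R_def a_def)
  define \<tau> where "\<tau> = fst (Pc s) * snd (uc s) - snd (Pc s) * fst (uc s)"
  define \<delta> where "\<delta> = arctan \<tau>"
  define \<rho> where "\<rho> = sqrt (1 + \<tau>\<^sup>2) / R"
  have sq: "sqrt (1 + \<tau>\<^sup>2) > 0" by (simp add: add_pos_nonneg)
  have \<rho>: "\<rho> > 0" using R sq by (simp add: \<rho>_def)
  have 1: "R * (u1 * cos a + u2 * sin a) = 1"
    using Pc_uc[of s] by (simp add: Pc u1_def u2_def inner_prod_def algebra_simps)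
  have 2: "R * (u2 * cos a - u1 * sin a) = \<tau>" by (simp add: \<tau>_def Pc u1_def u2_def algebra_simps)
  have c: "\<rho> * cos \<delta> = 1 / R" "\<rho> * sin \<delta> = \<tau> / R"
    using sq R by (simp_all add: \<rho>_def \<delta>_def cos_arctan sin_arctan)
  have cs: "cos a * cos a + sin a * sin a = 1" using sin_cos_squared_add2[of a] by (simp add: power2_eq_square)
  have alg: "(u1 * c + u2 * s) * c - (u2 * c - u1 * s) * s = u1 * (c * c + s * s)"
    "(u1 * c + u2 * s) * s + (u2 * c - u1 * s) * c = u2 * (c * c + s * s)" for c s
    by (simp_all add: algebra_simps)
  have "\<rho> * cos (a + \<delta>) = (\<rho> * cos \<delta>) * cos a - (\<rho> * sin \<delta>) * sin a" by (simp add: cos_add algebra_simps)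
  also have "\<dots> = (u1 * cos a + u2 * sin a) * cos a - (u2 * cos a - u1 * sin a) * sin a"
    unfolding c using 1 2 R by (metis nonzero_mult_div_cancel_left less_irrefl)
  also have "\<dots> = u1 * (cos a * cos a + sin a * sin a)" by (rule alg(1))
  finally have 3: "\<rho> * cos (a + \<delta>) = u1" by (simp only: cs mult_1_right)
  have "\<rho> * sin (a + \<delta>) = (\<rho> * cos \<delta>) * sin a + (\<rho> * sin \<delta>) * cos a" by (simp add: sin_add algebra_simps)
  also have "\<dots> = (u1 * cos a + u2 * sin a) * sin a + (u2 * cos a - u1 * sin a) * cos a"
    unfolding c using 1 2 R by (metis nonzero_mult_div_cancel_left less_irrefl)
  also have "\<dots> = u2 * (cos a * cos a + sin a * sin a)" by (rule alg(2))
  finally have 4: "\<rho> * sin (a + \<delta>) = u2" by (simp only: cs mult_1_right)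
  have ua: "uangle s = a + \<delta>" by (simp add: uangle_def a_def \<delta>_def \<tau>_def)
  have "uc s = (\<rho> * cos (uangle s), \<rho> * sin (uangle s))" using 3 4 by (simp add: ua u1_def u2_def prod_eq_iff)
  moreover have "\<rho> = radius (uangle s)"
    using Nm_polar[of \<rho> "uangle s"] \<rho> radius_pos[of "uangle s"] Nm_uc[of s] calculation by (simp add: field_simps)
  ultimately show ?thesis by simp
qed

text \<open>By the Lagrange identity the cross product of the covectors times that of the maximizers
  equals \<open>1 - (Pc s \<bullet> uc t) * (Pc t \<bullet> uc s)\<close>. For close parameters both
  factors lie in \<open>{0<..1}\<close> and the covectors turn counterclockwise, so the maximizers
  cannot turn back.\<close>

lemma uc_cross_nonneg:
  obtains d where "d > 0" "\<And>s t. s < t \<Longrightarrow> t - s < d \<Longrightarrow> 0 \<le> fst (uc s) * snd (uc t) - snd (uc s) * fst (uc t)"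
proof -
  obtain k where k: "k > 0" "\<And>s. \<bar>fst (uc s)\<bar> \<le> k" "\<And>s. \<bar>snd (uc s)\<bar> \<le> k" using uc_bounded by metis
  obtain M where M: "M > 0" "\<And>s t. \<bar>fst (Pc s) - fst (Pc t)\<bar> \<le> M * \<bar>s - t\<bar>"
    "\<And>s t. \<bar>snd (Pc s) - snd (Pc t)\<bar> \<le> M * \<bar>s - t\<bar>" using Pc_Lipschitz by metis
  obtain L where L: "L > 0" "\<And>s t. \<bar>fst (uc s) - fst (uc t)\<bar> \<le> L * \<bar>s - t\<bar>"
    "\<And>s t. \<bar>snd (uc s) - snd (uc t)\<bar> \<le> L * \<bar>s - t\<bar>" using uc_Lipschitz by metis
  obtain l where l: "l > 0" "\<And>s t. \<bar>dual.angle s - dual.angle t\<bar> \<le> l * \<bar>s - t\<bar>" using dual.angle_Lipschitz by blast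
  obtain q where q: "q > 0" "\<And>x. norm x \<le> q * Nd x" using dual.norm_le_Nm by blast
  have Pq: "\<bar>fst (Pc s)\<bar> \<le> q" "\<bar>snd (Pc s)\<bar> \<le> q" for s
    using q(2)[of "Pc s"] R2_norm_bounds[of "Pc s"] by (auto simp: Nd_Pc)
  have Pu: "\<bar>Pc s \<bullet> uc t - 1\<bar> \<le> 2 * q * L * \<bar>s - t\<bar>" for s t
  proof -
    have "Pc s \<bullet> uc t - 1 = fst (Pc s) * (fst (uc t) - fst (uc s)) + snd (Pc s) * (snd (uc t) - snd (uc s))"
      using Pc_uc[of s] by (simp add: inner_prod_def algebra_simps)
    also have "\<bar>\<dots>\<bar> \<le> \<bar>fst (Pc s)\<bar> * \<bar>fst (uc t) - fst (uc s)\<bar> + \<bar>snd (Pc s)\<bar> * \<bar>snd (uc t) - snd (uc s)\<bar>"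
      by (metis abs_mult abs_triangle_ineq)
    also have "\<dots> \<le> q * (L * \<bar>t - s\<bar>) + q * (L * \<bar>t - s\<bar>)"
      using Pq L q by (intro add_mono mult_mono) auto
    finally show ?thesis by (simp add: abs_minus_commute mult_ac)
  qed
  \<comment> \<open>The first bound keeps \<open>Pc s \<bullet> uc t\<close> positive, the second
    keeps the angle between the covectors below \<open>1 < pi\<close>.\<close>
  define d where "d = min (1 / (2 * q * L)) (1 / l)"
  show thesis
  proof (rule that[of d])
    show "d > 0" using q L l by (simp add: d_def)
    fix s t :: real assume st: "s < t" "t - s < d"
    have d1: "2 * q * L * (t - s) < 1" "l * (t - s) < 1"
      using st q L l by (auto simp: d_def field_simps add_pos_pos)
    have P1: "Pc s \<bullet> uc t > 0" "Pc t \<bullet> uc s > 0" using Pu[of s t] Pu[of t s] st d1(1) by (auto simp: abs_le_iff)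
    have P2: "Pc s \<bullet> uc t \<le> 1" "Pc t \<bullet> uc s \<le> 1"
      using inner_le_Nd[of "Pc s" "uc t"] inner_le_Nd[of "Pc t" "uc s"] by (simp_all add: Nd_Pc Nm_uc)
    have P3: "(Pc s \<bullet> uc t) * (Pc t \<bullet> uc s) \<le> 1 * 1" using P1 P2 by (intro mult_mono) auto
    have "(fst (Pc s) * snd (Pc t) - snd (Pc s) * fst (Pc t)) * (fst (uc s) * snd (uc t) - snd (uc s) * fst (uc t))
       = (Pc s \<bullet> uc s) * (Pc t \<bullet> uc t) - (Pc s \<bullet> uc t) * (Pc t \<bullet> uc s)"
      by (simp add: inner_prod_def algebra_simps)
    then have *: "0 \<le> (fst (Pc s) * snd (Pc t) - snd (Pc s) * fst (Pc t)) * (fst (uc s) * snd (uc t) - snd (uc s) * fst (uc t))"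
      using P3 by (simp add: Pc_uc)
    define a b where "a = dual.angle s" and "b = dual.angle t"
    have "a < b" using st by (simp add: a_def b_def dual.angle_less_iff)
    moreover have "b - a < pi" using l(2)[of t s] st d1(2) pi_gt3 by (auto simp: a_def b_def)
    ultimately have sinab: "sin (b - a) > 0" by (intro sin_gt_zero) auto
    have "fst (Pc s) * snd (Pc t) - snd (Pc s) * fst (Pc t) = dual.radius a * dual.radius b * sin (b - a)"
      by (simp add: Pc_polar a_def b_def sin_diff algebra_simps)
    then have "0 < fst (Pc s) * snd (Pc t) - snd (Pc s) * fst (Pc t)"
      using sinab dual.radius_pos[of a] dual.radius_pos[of b] by simp
    then show "0 \<le> fst (uc s) * snd (uc t) - snd (uc s) * fst (uc t)"
      using * by (simp add: zero_le_mult_iff)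
  qed
qed

text \<open>A Lipschitz bound keeps increments of \<open>uangle\<close> over short intervals below
  \<open>pi\<close>, so their sign is that of \<open>sin (uangle t - uangle s)\<close>, which the
  cross product controls. Local monotonicity then extends to the line.\<close>

lemma mono_uangle: "mono uangle"
proof -
  obtain k where k: "k > 0" "\<And>s. \<bar>fst (uc s)\<bar> \<le> k" "\<And>s. \<bar>snd (uc s)\<bar> \<le> k" using uc_bounded by metis
  obtain M where M: "M > 0" "\<And>s t. \<bar>fst (Pc s) - fst (Pc t)\<bar> \<le> M * \<bar>s - t\<bar>"
    "\<And>s t. \<bar>snd (Pc s) - snd (Pc t)\<bar> \<le> M * \<bar>s - t\<bar>" using Pc_Lipschitz by metis
  obtain L where L: "L > 0" "\<And>s t. \<bar>fst (uc s) - fst (uc t)\<bar> \<le> L * \<bar>s - t\<bar>"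
    "\<And>s t. \<bar>snd (uc s) - snd (uc t)\<bar> \<le> L * \<bar>s - t\<bar>" using uc_Lipschitz by metis
  obtain l where l: "l > 0" "\<And>s t. \<bar>dual.angle s - dual.angle t\<bar> \<le> l * \<bar>s - t\<bar>" using dual.angle_Lipschitz by blast
  obtain q where q: "q > 0" "\<And>x. norm x \<le> q * Nd x" using dual.norm_le_Nm by blast
  have Pq: "\<bar>fst (Pc s)\<bar> \<le> q" "\<bar>snd (Pc s)\<bar> \<le> q" for s
    using q(2)[of "Pc s"] R2_norm_bounds[of "Pc s"] by (auto simp: Nd_Pc)
  define c where "c = q * L + k * M"
  have c: "c > 0" using q L k M by (simp add: c_def add_pos_pos)
  have Lx: "\<bar>f s * g s - f t * g t\<bar> \<le> c * \<bar>s - t\<bar>"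
    if "f = (\<lambda>s. fst (Pc s)) \<or> f = (\<lambda>s. snd (Pc s))" "g = (\<lambda>s. fst (uc s)) \<or> g = (\<lambda>s. snd (uc s))" for f g s t
    unfolding c_def by (rule Lipschitz_mult_real) (use that M L Pq k in auto)
  have ua: "\<bar>uangle s - uangle t\<bar> \<le> (l + 2 * c) * \<bar>s - t\<bar>" for s t
  proof -
    define A B where "A s = fst (Pc s) * snd (uc s)" and "B s = snd (Pc s) * fst (uc s)" for s
    have "\<bar>A s - A t\<bar> \<le> c * \<bar>s - t\<bar>" "\<bar>B s - B t\<bar> \<le> c * \<bar>s - t\<bar>"
      unfolding A_def B_def
      using Lx[of "\<lambda>s. fst (Pc s)" "\<lambda>s. snd (uc s)" s t] Lx[of "\<lambda>s. snd (Pc s)" "\<lambda>s. fst (uc s)" s t] by auto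
    moreover have "uangle s = dual.angle s + arctan (A s - B s)" "uangle t = dual.angle t + arctan (A t - B t)"
      by (simp_all add: uangle_def A_def B_def)
    moreover have "(l + 2 * c) * \<bar>s - t\<bar> = l * \<bar>s - t\<bar> + c * \<bar>s - t\<bar> + c * \<bar>s - t\<bar>" by (simp add: algebra_simps)
    ultimately show ?thesis
      using arctan_Lipschitz[of "A s - B s" "A t - B t"] l(2)[of s t] by linarith
  qed
  obtain d0 where d0: "d0 > 0" "\<And>s t. s < t \<Longrightarrow> t - s < d0 \<Longrightarrow> 0 \<le> fst (uc s) * snd (uc t) - snd (uc s) * fst (uc t)"
    using uc_cross_nonneg by blast
  define d where "d = min d0 (1 / (l + 2 * c))"
  show ?thesis
  proof (rule mono_of_locally_mono[of d])
    show "d > 0" using d0 l c by (simp add: d_def add_pos_pos)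
    fix s t :: real assume st: "s < t" "t - s < d"
    have d1: "(l + 2 * c) * (t - s) < 1"
      using st l c by (auto simp: d_def field_simps add_pos_pos)
    have "0 \<le> fst (uc s) * snd (uc t) - snd (uc s) * fst (uc t)" using st d0(2) by (simp add: d_def)
    also have "\<dots> = radius (uangle s) * radius (uangle t) * sin (uangle t - uangle s)"
      by (subst (1 2 3 4) uc_polar) (simp add: sin_diff algebra_simps)
    finally have sinu: "0 \<le> sin (uangle t - uangle s)"
      using mult_pos_pos[OF radius_pos[of "uangle s"] radius_pos[of "uangle t"]] by (meson mult_pos_neg not_le)
    show "uangle s \<le> uangle t"
    proof (rule ccontr)
      assume "\<not> uangle s \<le> uangle t"
      moreover have "uangle s - uangle t < pi" using ua[of s t] st d1 pi_gt3 by (auto simp: abs_le_iff)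
      ultimately have "sin (uangle s - uangle t) > 0" by (intro sin_gt_zero) auto
      then show False using sinu sin_minus[of "uangle s - uangle t"] by simp
    qed
  qed
qed

text \<open>\<open>Ccirc\<close> is defined by choice, so a map with the required properties has to
  be exhibited: the swept area up to the lifted angle of \<open>uc\<close>.\<close>

lemma is_Ccirc_Ccirc: "is_Ccirc Nm (Ccirc Nm)"
proof -
  have "is_Ccirc Nm (\<lambda>s. swept (uangle s))"
    unfolding is_Ccirc_def
  proof (intro conjI allI)
    show "mono (\<lambda>s. swept (uangle s))"
    proof (rule monoI)
      fix s t :: real assume "s \<le> t"
      then have "uangle s \<le> uangle t" using mono_uangle by (rule monoD[rotated])
      then show "swept (uangle s) \<le> swept (uangle t)" using swept_less_iff by (meson not_le)
    qed
    have "trig_pt (unit_ball_of Nm) (swept (uangle s)) = uc s" for s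
      by (subst uc_polar) (simp add: trig_pt_unit_ball)
    then show "corresponds Nm (swept (uangle s)) s" for s
      using Pc_uc[of s] unfolding corresponds_def Let_def cos_S_def sin_S_def polar_unit_ball Pc_def[symmetric]
      by (simp add: inner_prod_def mult.commute)
    fix s and k :: int
    have an: "dual.angle (s + 2 * of_int k * area (unit_ball_of Nd)) = dual.angle s + 2 * pi * of_int k"
      by (rule dual.angle_add_area)
    then have "Pc (s + 2 * of_int k * area (unit_ball_of Nd)) = Pc s"
      by (simp add: Pc_polar dual.radius_add_2pi cos_add sin_add)
    then have "uangle (s + 2 * of_int k * area (unit_ball_of Nd)) = uangle s + 2 * pi * of_int k"
      by (simp add: uangle_def uc_def an)
    then show "swept (uangle (s + 2 * of_int k * area (polar_set (unit_ball_of Nm)))) =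
        swept (uangle s) + 2 * of_int k * area (unit_ball_of Nm)"
      by (simp add: polar_unit_ball swept_add_2pi area_unit_ball[symmetric])
  qed
  then show ?thesis unfolding Ccirc_def by (rule someI[of "is_Ccirc Nm"])
qed

lemma uc_Ccirc: "uc s = trig_pt (unit_ball_of Nm) (Ccirc Nm s)"
proof -
  have "corresponds Nm (Ccirc Nm s) s" using is_Ccirc_Ccirc unfolding is_Ccirc_def by blast
  then have "Pc s \<bullet> trig_pt (unit_ball_of Nm) (Ccirc Nm s) = 1"
    unfolding corresponds_def Let_def cos_S_def sin_S_def polar_unit_ball Pc_def[symmetric]
    by (simp add: inner_prod_def mult.commute)
  then show ?thesis unfolding uc_def by (intro dir_eqI Nd_Pc Nm_trig_pt)
qed

text \<open>\<open>uc\<close> is the Lipschitz curve \<open>trig_pt\<close> evaluated at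
  \<open>Ccirc\<close>, so it is stationary wherever \<open>Ccirc\<close> has derivative
  zero.\<close>

lemma Zset_stationary:
  assumes "s \<in> Zset Nm" and e: "e > 0"
  obtains d where "d > 0" "\<And>t. \<bar>t - s\<bar> < d \<Longrightarrow> norm (uc t - uc s) \<le> e * \<bar>t - s\<bar>"
proof -
  obtain L where L: "L > 0" "\<And>s t. norm (trig_pt (unit_ball_of Nm) s - trig_pt (unit_ball_of Nm) t) \<le> L * \<bar>s - t\<bar>"
    using trig_pt_Lipschitz by metis
  have "(Ccirc Nm has_derivative (\<lambda>h. 0)) (at s)"
  proof -
    have "(*) (0::real) = (\<lambda>h. 0)" by auto
    then show ?thesis using assms(1) unfolding Zset_def has_field_derivative_def by simp
  qed
  then have *: "\<forall>e>0. \<exists>d>0. \<forall>t. norm (t - s) < d \<longrightarrow> norm (Ccirc Nm t - Ccirc Nm s - 0) \<le> e * norm (t - s)"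
    unfolding has_derivative_at_alt by blast
  have "e / L > 0" using e L by simp
  then obtain d where d: "d > 0" "\<And>t. \<bar>t - s\<bar> < d \<Longrightarrow> \<bar>Ccirc Nm t - Ccirc Nm s\<bar> \<le> e / L * \<bar>t - s\<bar>"
    using *[rule_format, of "e / L"] by (auto simp del: times_divide_eq_left)
  show thesis
  proof (rule that[OF d(1)])
    fix t assume "\<bar>t - s\<bar> < d"
    then have "L * \<bar>Ccirc Nm t - Ccirc Nm s\<bar> \<le> L * (e / L * \<bar>t - s\<bar>)" using L(1) by (intro mult_left_mono d(2)) auto
    also have "\<dots> = e * \<bar>t - s\<bar>" using L(1) by simp
    finally show "norm (uc t - uc s) \<le> e * \<bar>t - s\<bar>"
      using L(2)[of "Ccirc Nm t" "Ccirc Nm s"] unfolding uc_Ccirc[of t] uc_Ccirc[of s] by linarith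
  qed
qed

end

section \<open>Minimality of the extremals\<close>

context regular_norm begin

text \<open>If a calibration \<open>HP\<close> is sharp between \<open>p\<close> and \<open>q\<close>, then any function \<open>HW\<close> whose
  horizontal derivative annihilates the calibrated direction takes the same value at \<open>p\<close> and \<open>q\<close>:
  \<open>HP + a * HW\<close> is Lipschitz with constant \<open>1 + O(a\<^sup>2)\<close>.\<close>

lemma conserved_of_sharp_calibration:
  assumes KP: "\<And>x. \<bar>x\<bar> < r \<Longrightarrow> (KP has_real_derivative fst (Pf x)) (at x)" "\<And>x. \<bar>x\<bar> < r \<Longrightarrow> kP1 + kP2 * x = snd (Pf x)"
    and KW: "\<And>x. \<bar>x\<bar> < r \<Longrightarrow> (KW has_real_derivative fst (Wf x)) (at x)" "\<And>x. \<bar>x\<bar> < r \<Longrightarrow> kW1 + kW2 * x = snd (Wf x)"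
    and P: "\<And>x. \<bar>x\<bar> < r \<Longrightarrow> Nd (Pf x) \<le> 1" "\<And>x. \<bar>x\<bar> < r \<Longrightarrow> Pf x \<bullet> uf x = 1" "\<And>x. \<bar>x\<bar> < r \<Longrightarrow> Nm (uf x) = 1"
    and W: "\<And>x. \<bar>x\<bar> < r \<Longrightarrow> Nd (Wf x) \<le> C" "\<And>x. \<bar>x\<bar> < r \<Longrightarrow> Wf x \<bullet> uf x = 0"
    and \<kappa>: "\<And>v. norm v \<le> \<kappa> * Nm v"
    and strip: "\<bar>fst p\<bar> + \<kappa> * sf_dist Nm p q < r"
    and HP: "\<And>x y z. HP (x, y, z) = KP x + kP1 * y + kP2 * (z + x * y / 2)"
    and HW: "\<And>x y z. HW (x, y, z) = KW x + kW1 * y + kW2 * (z + x * y / 2)"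
    and sharp: "HP q - HP p = sf_dist Nm p q"
  shows "HW q = HW p"
proof -
  define d where "d = sf_dist Nm p q"
  define B where "B = C\<^sup>2 / (2 * conv) * d"
  have B: "B \<ge> 0" using conv(1) sf_dist_nonneg by (simp add: B_def d_def)
  \<comment> \<open>Here \<open>a\<close> may have either sign, and a linear function of
    \<open>a\<close> that is bounded by \<open>a\<^sup>2 * B\<close> for all \<open>a\<close>
    vanishes.\<close>
  have *: "a * (HW q - HW p) \<le> a\<^sup>2 * B" for a
  proof -
    define H where "H p = HP p + a * HW p" for p
    have "H q - H p \<le> (1 + a\<^sup>2 * C\<^sup>2 / (2 * conv)) * sf_dist Nm p q"
    proof (rule sf_dist_calibration[where K = "\<lambda>x. KP x + a * KW x" and K' = "\<lambda>x. fst (Pf x) + a * fst (Wf x)"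
          and r = r and \<kappa> = \<kappa> and ?k1.0 = "kP1 + a * kW1" and ?k2.0 = "kP2 + a * kW2"])
      show "((\<lambda>x. KP x + a * KW x) has_real_derivative fst (Pf x) + a * fst (Wf x)) (at x)" if "\<bar>x\<bar> < r" for x
        by (intro DERIV_add DERIV_cmult KP KW that)
      show "(fst (Pf x) + a * fst (Wf x)) * v1 + (kP1 + a * kW1 + (kP2 + a * kW2) * x) * v2
          \<le> (1 + a\<^sup>2 * C\<^sup>2 / (2 * conv)) * Nm (v1, v2)" if x: "\<bar>x\<bar> < r" for x v1 v2
      proof -
        have "(fst (Pf x) + a * fst (Wf x)) * v1 + (kP1 + a * kW1 + (kP2 + a * kW2) * x) * v2
          = Pf x \<bullet> (v1, v2) + a * (Wf x \<bullet> (v1, v2))"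
          unfolding inner_prod_def using KP(2)[OF x, symmetric] KW(2)[OF x, symmetric] by (simp add: algebra_simps)
        then show ?thesis using tilted_covector_le[OF P(1)[OF x] P(2)[OF x] P(3)[OF x] W(2)[OF x] W(1)[OF x]] by simp
      qed
      show "H (x, y, z) = KP x + a * KW x + (kP1 + a * kW1) * y + (kP2 + a * kW2) * (z + x * y / 2)" for x y z
        by (simp add: H_def HP HW algebra_simps)
    qed (use \<kappa> strip in auto)
    then show ?thesis using sharp by (simp add: H_def B_def d_def algebra_simps)
  qed
  have "x \<le> 0" if "\<And>a. a * x \<le> a\<^sup>2 * B" for x
  proof (rule ccontr)
    assume "\<not> x \<le> 0"
    then have x: "x > 0" by simp
    define a where "a = x / (B + 1)"
    have a: "a > 0" "a * (B + 1) = x" using x B by (simp_all add: a_def)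
    have "a * x \<le> a * (a * B)" using that[of a] by (simp add: power2_eq_square mult.assoc)
    then have "x \<le> a * B" using a(1) by simp
    then show False using a by (simp add: algebra_simps)
  qed
  from this[of "HW q - HW p"] this[of "HW p - HW q"] * *[of "- a" for a] show ?thesis
    by (auto simp: algebra_simps)
qed

definition P1 where "P1 s = fst (Pc s)"
definition P2 where "P2 s = snd (Pc s)"
definition u1 where "u1 s = fst (uc s)"
definition u2 where "u2 s = snd (uc s)"

lemma DERIV_P [derivative_intros]: "(P1 has_real_derivative - u2 s) (at s)" "(P2 has_real_derivative u1 s) (at s)"
  using Pc_has_derivative[of s] unfolding P1_def[abs_def] P2_def[abs_def] u1_def u2_def .

lemma P_u: "P1 s * u1 s + P2 s * u2 s = 1"
  using Pc_uc[of s] by (simp add: inner_prod_def P1_def P2_def u1_def u2_def)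

lemma P_le: "P1 s * v1 + P2 s * v2 \<le> Nm (v1, v2)"
  using inner_le_Nd[of "Pc s" "(v1, v2)"] by (simp add: inner_prod_def P1_def P2_def Nd_Pc)

lemma continuous_u: "continuous_on S u1" "continuous_on S u2"
proof -
  obtain L where L: "L > 0" "\<And>s t. \<bar>fst (uc s) - fst (uc t)\<bar> \<le> L * \<bar>s - t\<bar>"
    "\<And>s t. \<bar>snd (uc s) - snd (uc t)\<bar> \<le> L * \<bar>s - t\<bar>" using uc_Lipschitz by metis
  have "L-lipschitz_on UNIV u1" "L-lipschitz_on UNIV u2"
    using L by (auto intro!: lipschitz_onI simp: dist_real_def u1_def u2_def)
  then show "continuous_on S u1" "continuous_on S u2"
    using lipschitz_on_continuous_on continuous_on_subset by blast+
qed

text \<open>The curve that starts at the origin and whose control is \<open>\<rho>\<close> times \<open>uc\<close>, run from \<open>\<phi>\<close> to \<open>s\<close>.\<close>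

definition arc :: "real \<Rightarrow> real \<Rightarrow> real \<Rightarrow> R3" where
  "arc \<rho> \<phi> s = (\<rho> * (P2 s - P2 \<phi>), - \<rho> * (P1 s - P1 \<phi>), \<rho>\<^sup>2 / 2 * (s - \<phi> - (P1 \<phi> * P2 s - P2 \<phi> * P1 s)))"

lemma arc_start: "arc \<rho> \<phi> \<phi> = (0, 0, 0)"
  by (simp add: arc_def algebra_simps)

lemma sf_dist_arc_le:
  assumes "0 \<le> \<rho>" "s \<le> t"
  shows "sf_dist Nm (arc \<rho> \<phi> s) (arc \<rho> \<phi> t) \<le> \<rho> * (t - s)"
proof -
  define l where "l = t - s"
  define \<gamma> where "\<gamma> x = arc \<rho> \<phi> (s + x * l)" for x
  define u where "u x = ((\<rho> * l) * u1 (s + x * l), (\<rho> * l) * u2 (s + x * l))" for x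
  have adm: "admissible \<gamma> u"
  proof (rule admissible_C1)
    fix x :: real
    define y where "y = s + x * l"
    have dP: "((\<lambda>x. P1 (s + x * l)) has_real_derivative - u2 y * l) (at x)"
         "((\<lambda>x. P2 (s + x * l)) has_real_derivative u1 y * l) (at x)"
      unfolding y_def by (rule DERIV_chain2[OF DERIV_P(1)], (auto intro!: derivative_eq_intros)[1],
         rule DERIV_chain2[OF DERIV_P(2)], (auto intro!: derivative_eq_intros)[1])
    have "((\<lambda>x. \<rho> * (P2 (s + x * l) - P2 \<phi>)) has_real_derivative \<rho> * (u1 y * l - 0)) (at x)"
      "((\<lambda>x. - \<rho> * (P1 (s + x * l) - P1 \<phi>)) has_real_derivative - \<rho> * (- u2 y * l - 0)) (at x)"
      "((\<lambda>x. \<rho>\<^sup>2 / 2 * (s + x * l - \<phi> - (P1 \<phi> * P2 (s + x * l) - P2 \<phi> * P1 (s + x * l)))) has_real_derivative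
         \<rho>\<^sup>2 / 2 * (0 + (1 * l) - 0 - (P1 \<phi> * (u1 y * l) - P2 \<phi> * (- u2 y * l)))) (at x)"
      by (intro DERIV_cmult DERIV_diff DERIV_add DERIV_const DERIV_cmult_right DERIV_ident dP)+
    then have "(\<gamma> has_vector_derivative (\<rho> * (u1 y * l - 0), - \<rho> * (- u2 y * l - 0),
         \<rho>\<^sup>2 / 2 * (0 + (1 * l) - 0 - (P1 \<phi> * (u1 y * l) - P2 \<phi> * (- u2 y * l))))) (at x)"
      unfolding \<gamma>_def arc_def has_real_derivative_iff_has_vector_derivative
      by (intro has_vector_derivative_Pair)
    moreover have "(\<rho> * (u1 y * l - 0), - \<rho> * (- u2 y * l - 0),
         \<rho>\<^sup>2 / 2 * (0 + (1 * l) - 0 - (P1 \<phi> * (u1 y * l) - P2 \<phi> * (- u2 y * l))))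
         = fst (u x) *\<^sub>R X1 (\<gamma> x) + snd (u x) *\<^sub>R X2 (\<gamma> x)"
    proof -
      have comp: "fst (u x) *\<^sub>R X1 (\<gamma> x) + snd (u x) *\<^sub>R X2 (\<gamma> x) = (\<rho> * l * u1 y, \<rho> * l * u2 y,
          \<rho> * l * u1 y * (\<rho> * (P1 y - P1 \<phi>) / 2) + \<rho> * l * u2 y * (\<rho> * (P2 y - P2 \<phi>) / 2))"
        by (simp add: u_def \<gamma>_def arc_def X1_def X2_def y_def[symmetric])
      have "\<rho>\<^sup>2 / 2 * (0 + (1 * l) - 0 - (P1 \<phi> * (u1 y * l) - P2 \<phi> * (- u2 y * l)))
        = \<rho>\<^sup>2 / 2 * l * ((P1 y * u1 y + P2 y * u2 y) - P1 \<phi> * u1 y - P2 \<phi> * u2 y)"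
        unfolding P_u by (simp add: algebra_simps)
      also have "\<dots> = \<rho> * l * u1 y * (\<rho> * (P1 y - P1 \<phi>) / 2) + \<rho> * l * u2 y * (\<rho> * (P2 y - P2 \<phi>) / 2)"
        by (simp add: power2_eq_square field_simps)
      finally show ?thesis unfolding comp by (simp only: prod.inject) (simp add: mult_ac)
    qed
    ultimately show "(\<gamma> has_vector_derivative fst (u x) *\<^sub>R X1 (\<gamma> x) + snd (u x) *\<^sub>R X2 (\<gamma> x)) (at x)" by simp
  next
    show "continuous_on UNIV u"
      unfolding u_def by (intro continuous_intros continuous_on_compose2[OF continuous_u(1)[of UNIV]]
          continuous_on_compose2[OF continuous_u(2)[of UNIV]]) auto
  qed
  have "Nm (u x) = \<rho> * l" for x
  proof -
    have "u x = (\<rho> * l) *\<^sub>R uc (s + x * l)" by (simp add: u_def u1_def u2_def prod_eq_iff)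
    then show ?thesis using assms by (simp add: Nm_scale Nm_uc l_def)
  qed
  then have "control_length Nm u = \<rho> * l"
    using has_integral_unique[OF control_length_has_integral[OF adm]] has_integral_const_real[of "\<rho> * l" 0 1] by simp
  then show ?thesis
    using sf_dist_le[OF adm, of "arc \<rho> \<phi> s" "arc \<rho> \<phi> t"] by (simp add: \<gamma>_def l_def)
qed

text \<open>Where \<open>u1\<close>, the derivative of \<open>P2\<close>, keeps its sign, the angle
  is a function of \<open>P2\<close> and hence of the first coordinate of an arc. The sign is
  carried by \<open>sg\<close>; growth at rate at least \<open>b\<close> shows that the
  \<open>b * \<eta>\<close>-neighbourhood of \<open>P2 \<phi>\<close> is covered.\<close>

lemma P2_local_inverse:
  assumes I: "l < \<phi>" "\<phi> < r" and b: "b > 0" and sg: "sg = 1 \<or> sg = -1" "\<And>s. s \<in> {l..r} \<Longrightarrow> b \<le> sg * u1 s"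
    and \<eta>: "\<eta> \<le> \<phi> - l" "\<eta> \<le> r - \<phi>"
  obtains \<sigma> where "\<And>X. \<bar>X - P2 \<phi>\<bar> < b * \<eta> \<Longrightarrow> \<sigma> X \<in> {l..r} \<and> P2 (\<sigma> X) = X \<and> (\<sigma> has_real_derivative 1 / u1 (\<sigma> X)) (at X)"
    "\<And>s. s \<in> {l..r} \<Longrightarrow> \<sigma> (P2 s) = s"
proof -
  have grow: "b * (t - s) \<le> sg * P2 t - sg * P2 s" if "s \<in> {l..r}" "t \<in> {l..r}" "s \<le> t" for s t
  proof -
    have "(\<lambda>x. sg * P2 x - b * x) s \<le> (\<lambda>x. sg * P2 x - b * x) t"
    proof (rule DERIV_nonneg_imp_nondecreasing[OF that(3)])
      fix x assume "s \<le> x" "x \<le> t"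
      then have "b \<le> sg * u1 x" using that by (intro sg) auto
      then show "\<exists>y. ((\<lambda>x. sg * P2 x - b * x) has_real_derivative y) (at x) \<and> 0 \<le> y"
        by (intro exI[of _ "sg * u1 x - b * 1"] conjI DERIV_diff DERIV_cmult DERIV_P DERIV_ident) simp
    qed
    then show ?thesis by (simp add: algebra_simps)
  qed
  have sg1: "\<bar>sg * x\<bar> = \<bar>x\<bar>" "sg * (sg * x) = x" for x :: real using sg(1) by auto
  have bi: "b * \<bar>t - s\<bar> \<le> \<bar>P2 t - P2 s\<bar>" if "s \<in> {l..r}" "t \<in> {l..r}" for s t
    using grow[OF that] grow[OF that(2,1)] sg(1) by (cases "s \<le> t") auto
  have inj: "s = t" if "s \<in> {l..r}" "t \<in> {l..r}" "P2 s = P2 t" for s t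
    using bi[OF that(1,2)] that(3) b by (simp add: mult_le_0_iff)
  define \<sigma> where "\<sigma> X = (THE s. s \<in> {l..r} \<and> P2 s = X)" for X
  have \<sigma>P: "\<sigma> (P2 s) = s" if "s \<in> {l..r}" for s
    unfolding \<sigma>_def using that inj by (intro the_equality) auto
  have ex: "\<exists>s\<in>{l..r}. P2 s = X" if X: "\<bar>X - P2 \<phi>\<bar> < b * \<eta>" for X
  proof -
    have "b * \<eta> \<le> b * (\<phi> - l)" "b * \<eta> \<le> b * (r - \<phi>)" using \<eta> b by simp_all
    moreover have "\<bar>sg * X - sg * P2 \<phi>\<bar> < b * \<eta>" using X sg1(1)[of "X - P2 \<phi>"] by (simp add: algebra_simps)
    ultimately have "sg * P2 l \<le> sg * X" "sg * X \<le> sg * P2 r"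
      using grow[of l \<phi>] grow[of \<phi> r] I by auto
    moreover have "isCont (\<lambda>s. sg * P2 s) x" for x
      by (intro continuous_intros DERIV_isCont[OF DERIV_P(2)])
    ultimately have "\<exists>s\<ge>l. s \<le> r \<and> sg * P2 s = sg * X"
      using I by (intro IVT) auto
    then show ?thesis using sg(1) by auto
  qed
  have \<sigma>1: "\<sigma> X \<in> {l..r} \<and> P2 (\<sigma> X) = X" if X: "\<bar>X - P2 \<phi>\<bar> < b * \<eta>" for X
    using ex[OF X] \<sigma>P by auto
  have "(\<sigma> has_real_derivative 1 / u1 (\<sigma> X)) (at X)" if X: "\<bar>X - P2 \<phi>\<bar> < b * \<eta>" for X
  proof -
    let ?U = "{P2 \<phi> - b * \<eta><..<P2 \<phi> + b * \<eta>}"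
    have XU: "X \<in> ?U" and U: "\<bar>Y - P2 \<phi>\<bar> < b * \<eta>" if "Y \<in> ?U" for Y using X that by auto
    have "(1 / b)-lipschitz_on ?U \<sigma>"
    proof (rule lipschitz_onI)
      fix Y Z assume "Y \<in> ?U" "Z \<in> ?U"
      then show "dist (\<sigma> Y) (\<sigma> Z) \<le> 1 / b * dist Y Z"
        using bi[of "\<sigma> Y" "\<sigma> Z"] \<sigma>1[OF U[of Y]] \<sigma>1[OF U[of Z]] b by (auto simp: dist_real_def field_simps abs_minus_commute)
    qed (use b in simp)
    then have "isCont \<sigma> X"
      using lipschitz_on_continuous_on continuous_on_eq_continuous_at[of ?U \<sigma>] X by (auto simp: abs_less_iff)
    moreover have "u1 (\<sigma> X) \<noteq> 0" using sg(2)[of "\<sigma> X"] \<sigma>1[OF X] b by auto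
    ultimately have "(\<sigma> has_real_derivative inverse (u1 (\<sigma> X))) (at X)"
      using X \<sigma>1 by (intro DERIV_inverse_function[OF DERIV_P(2), of _ _ "P2 \<phi> - b * \<eta>" "P2 \<phi> + b * \<eta>"]) (auto simp: abs_less_iff)
    then show ?thesis by (simp add: divide_inverse)
  qed
  then show thesis using that \<sigma>1 \<sigma>P by blast
qed

text \<open>\<open>HP\<close> is a calibration whose horizontal gradient over the abscissa
  \<open>x\<close> is the covector \<open>Pc (S x)\<close>, where \<open>S x\<close> is the angle at
  which the arc passes over \<open>x\<close>. Along the arc it grows exactly by the length, so the
  arc is minimizing. At a point that splits the distance it must be sharp; then \<open>H1\<close>
  fixes the angle and with it \<open>x\<close>, \<open>H2\<close> fixes \<open>y\<close>, and the
  value of \<open>HP\<close> fixes \<open>z\<close>.\<close>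

theorem arc_minimizing:
  assumes I: "l < \<phi>" "\<phi> \<le> \<psi>" "\<psi> < r" and b: "b > 0" and sg: "sg = 1 \<or> sg = -1" "\<And>s. s \<in> {l..r} \<Longrightarrow> b \<le> sg * u1 s"
    and \<kappa>: "\<And>v. norm v \<le> \<kappa> * Nm v" and \<eta>: "\<eta> \<le> \<phi> - l" "\<eta> \<le> r - \<phi>" "\<kappa> * (\<psi> - \<phi>) < b * \<eta>"
    and \<rho>: "\<rho> > 0"
  shows "\<phi> \<le> s \<Longrightarrow> s \<le> s' \<Longrightarrow> s' \<le> \<psi> \<Longrightarrow> sf_dist Nm (arc \<rho> \<phi> s) (arc \<rho> \<phi> s') = \<rho> * (s' - s)"
    and "0 \<le> t \<Longrightarrow> t \<le> 1 \<Longrightarrow> sf_dist Nm (0, 0, 0) q = t * (\<rho> * (\<psi> - \<phi>)) \<Longrightarrow>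
      sf_dist Nm q (arc \<rho> \<phi> \<psi>) = (1 - t) * (\<rho> * (\<psi> - \<phi>)) \<Longrightarrow> q = arc \<rho> \<phi> (\<phi> + t * (\<psi> - \<phi>))"
proof -
  obtain \<sigma> where \<sigma>': "\<And>X. \<bar>X - P2 \<phi>\<bar> < b * \<eta> \<Longrightarrow> \<sigma> X \<in> {l..r} \<and> P2 (\<sigma> X) = X \<and> (\<sigma> has_real_derivative 1 / u1 (\<sigma> X)) (at X)"
    "\<And>s. s \<in> {l..r} \<Longrightarrow> \<sigma> (P2 s) = s"
  proof (rule P2_local_inverse[of l \<phi> r b sg \<eta>])
    show "\<phi> < r" using I by simp
  qed (use I b sg \<eta> in blast)+
  then have \<sigma>: "\<And>X. \<bar>X - P2 \<phi>\<bar> < b * \<eta> \<Longrightarrow> \<sigma> X \<in> {l..r}" "\<And>X. \<bar>X - P2 \<phi>\<bar> < b * \<eta> \<Longrightarrow> P2 (\<sigma> X) = X"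
     "\<And>X. \<bar>X - P2 \<phi>\<bar> < b * \<eta> \<Longrightarrow> (\<sigma> has_real_derivative 1 / u1 (\<sigma> X)) (at X)" "\<And>s. s \<in> {l..r} \<Longrightarrow> \<sigma> (P2 s) = s"
    by blast+
  have n1: "0 < \<kappa> * Nm (1, 0)" using \<kappa>[of "(1, 0)"] by (simp add: norm_Pair order_less_le_trans[OF zero_less_one])
  then have \<kappa>0: "\<kappa> > 0" using Nm_ge_0[of "(1, 0)"] by (auto simp: zero_less_mult_iff)
  define X0 where "X0 = P2 \<phi>"
  define rr where "rr = \<rho> * (b * \<eta>)"
  define S where "S x = \<sigma> (X0 + x / \<rho>)" for x
  have xr: "\<bar>(X0 + x / \<rho>) - P2 \<phi>\<bar> < b * \<eta>" if "\<bar>x\<bar> < rr" for x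
    using that \<rho> by (simp add: X0_def rr_def abs_divide divide_less_eq mult.commute)
  have S: "S x \<in> {l..r}" "P2 (S x) = X0 + x / \<rho>" "(S has_real_derivative 1 / (\<rho> * u1 (S x))) (at x)" if x: "\<bar>x\<bar> < rr" for x
  proof -
    show "S x \<in> {l..r}" "P2 (S x) = X0 + x / \<rho>" using \<sigma>(1,2)[OF xr[OF x]] by (simp_all add: S_def)
    have "((\<lambda>x. X0 + x / \<rho>) has_real_derivative 1 / \<rho>) (at x)" using \<rho> by (auto intro!: derivative_eq_intros)
    from DERIV_chain2[OF \<sigma>(3)[OF xr[OF x]] this] show "(S has_real_derivative 1 / (\<rho> * u1 (S x))) (at x)"
      by (simp add: S_def[abs_def] mult.commute)
  qed
  have u1: "b \<le> \<bar>u1 s\<bar>" "u1 s \<noteq> 0" if "s \<in> {l..r}" for s using sg(2)[OF that] sg(1) b by auto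
  \<comment> \<open>A primitive of \<open>P1 (S x)\<close> in \<open>x\<close>: by
    \<open>P_u\<close> the expression \<open>\<rho> * (s + P1 s * P2 s) / 2\<close> has
    \<open>s\<close>-derivative \<open>\<rho> * u1 s * P1 s\<close>, and
    \<open>\<rho> * u1 s\<close> is the speed of the first coordinate.\<close>
  define KP where "KP x = \<rho> * ((S x + P1 (S x) * P2 (S x)) / 2)" for x
  define HP where "HP p = KP (fst p) + X0 * fst (snd p) + 1 / \<rho> * (snd (snd p) + fst p * fst (snd p) / 2)" for p
  have dSc: "((\<lambda>x. f (S x)) has_real_derivative f' / (\<rho> * u1 (S x))) (at x)"
    if "\<bar>x\<bar> < rr" "(f has_real_derivative f') (at (S x))" for f f' x
    using DERIV_chain2[OF that(2) S(3)[OF that(1)]] by simp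
  have dP1: "((\<lambda>x. P1 (S x)) has_real_derivative - u2 (S x) / (\<rho> * u1 (S x))) (at x)" if "\<bar>x\<bar> < rr" for x
    by (rule dSc[OF that DERIV_P(1)])
  have KP: "(KP has_real_derivative P1 (S x)) (at x)" if x: "\<bar>x\<bar> < rr" for x
  proof -
    have "((\<lambda>s. \<rho> * ((s + P1 s * P2 s) / 2)) has_real_derivative \<rho> * ((1 + (- u2 s * P2 s + u1 s * P1 s)) / 2)) (at s)" for s
      by (intro DERIV_cmult DERIV_cdivide DERIV_add DERIV_mult DERIV_ident DERIV_P)
    moreover have "\<rho> * ((1 + (- u2 s * P2 s + u1 s * P1 s)) / 2) = \<rho> * u1 s * P1 s" for s
    proof -
      have "1 + (- u2 s * P2 s + u1 s * P1 s) = 2 * (u1 s * P1 s)" using P_u[of s] by (simp add: algebra_simps)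
      then show ?thesis by simp
    qed
    ultimately have "((\<lambda>s. \<rho> * ((s + P1 s * P2 s) / 2)) has_real_derivative \<rho> * u1 s * P1 s) (at s)" for s by (simp only:)
    from dSc[OF x this] show ?thesis using u1(2)[OF S(1)[OF x]] \<rho> by (simp add: KP_def[abs_def])
  qed
  define Pf where "Pf x = Pc (S x)" for x
  define uf where "uf x = uc (S x)" for x
  have Pf: "fst (Pf x) = P1 (S x)" "snd (Pf x) = P2 (S x)" "fst (uf x) = u1 (S x)" "snd (uf x) = u2 (S x)" for x
    by (simp_all add: Pf_def uf_def P1_def P2_def u1_def u2_def)
  have H0: "HP (x, y, z) = KP x + X0 * y + 1 / \<rho> * (z + x * y / 2)" for x y z by (simp add: HP_def)
  have X0S: "X0 + 1 / \<rho> * x = P2 (S x)" if "\<bar>x\<bar> < rr" for x using S(2)[OF that] by simp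
  have lipP: "HP q - HP p \<le> sf_dist Nm p q" if "\<bar>fst p\<bar> + \<kappa> * sf_dist Nm p q < rr" for p q
  proof -
    have "HP q - HP p \<le> 1 * sf_dist Nm p q"
    proof (rule sf_dist_calibration[OF KP _ \<kappa> that H0])
      show "P1 (S x) * v1 + (X0 + 1 / \<rho> * x) * v2 \<le> 1 * Nm (v1, v2)" if "\<bar>x\<bar> < rr" for x v1 v2
        unfolding X0S[OF that] using P_le[of "S x" v1 v2] by simp
    qed
    then show ?thesis by simp
  qed
  have arcS: "S (fst (arc \<rho> \<phi> s)) = s" if "s \<in> {l..r}" for s
    using \<sigma>(4)[OF that] \<rho> by (simp add: S_def arc_def X0_def)
  have HPs: "HP (arc \<rho> \<phi> s) = \<rho> * s - \<rho> * (\<phi> - X0 * P1 \<phi>) / 2" if "s \<in> {l..r}" for s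
  proof -
    have 1: "\<rho>\<^sup>2 / \<rho> = \<rho>" using \<rho> by (simp add: power2_eq_square)
    have "HP (arc \<rho> \<phi> s) = \<rho> * ((s + P1 s * P2 s) / 2) + X0 * (- \<rho> * (P1 s - P1 \<phi>))
       + 1 / \<rho> * (\<rho>\<^sup>2 / 2 * (s - \<phi> - (P1 \<phi> * P2 s - P2 \<phi> * P1 s)) + \<rho> * (P2 s - P2 \<phi>) * (- \<rho> * (P1 s - P1 \<phi>)) / 2)"
      using arcS[OF that] by (simp add: HP_def KP_def) (simp add: arc_def)
    also have "1 / \<rho> * (\<rho>\<^sup>2 / 2 * (s - \<phi> - (P1 \<phi> * P2 s - P2 \<phi> * P1 s)) + \<rho> * (P2 s - P2 \<phi>) * (- \<rho> * (P1 s - P1 \<phi>)) / 2)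
      = (\<rho>\<^sup>2 / \<rho>) * ((s - \<phi> - (P1 \<phi> * P2 s - P2 \<phi> * P1 s)) / 2 - (P2 s - P2 \<phi>) * (P1 s - P1 \<phi>) / 2)"
    proof -
      have "1 / \<rho> * (\<rho>\<^sup>2 / 2 * A + \<rho> * B * (- \<rho> * C) / 2) = (\<rho>\<^sup>2 / \<rho>) * (A / 2 - B * C / 2)" for A B C
        using \<rho> by (simp add: power2_eq_square field_simps)
      then show ?thesis .
    qed
    finally show ?thesis unfolding 1 X0_def[symmetric] by (simp add: field_simps)
  qed
  have \<phi>I: "\<phi> \<in> {l..r}" "\<psi> \<in> {l..r}" using I by auto
  define e :: R3 where "e = (0, 0, 0)"
  have e0: "fst e = 0" by (simp add: e_def)
  have e: "e = arc \<rho> \<phi> \<phi>" by (simp add: e_def arc_start)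
  have HPe: "HP e = \<rho> * \<phi> - \<rho> * (\<phi> - X0 * P1 \<phi>) / 2" unfolding e by (rule HPs[OF \<phi>I(1)])
  have small: "\<kappa> * (\<rho> * (\<psi> - \<phi>)) < rr" using \<eta>(3) \<rho> by (simp add: rr_def mult.left_commute)
  have u1\<kappa>: "\<bar>u1 s\<bar> \<le> \<kappa>" for s
    using R2_norm_bounds(1)[of "uc s"] \<kappa>[of "uc s"] by (auto simp: u1_def Nm_uc)
  have len: "sf_dist Nm (arc \<rho> \<phi> s) (arc \<rho> \<phi> s') = \<rho> * (s' - s)" if s: "\<phi> \<le> s" "s \<le> s'" "s' \<le> \<psi>" for s s'
  proof -
    have sI: "s \<in> {l..r}" "s' \<in> {l..r}" using s I by auto
    have le: "sf_dist Nm (arc \<rho> \<phi> s) (arc \<rho> \<phi> s') \<le> \<rho> * (s' - s)" using sf_dist_arc_le[of \<rho> s s' \<phi>] \<rho> s by simp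
    have "norm (P2 s - P2 \<phi>) \<le> \<kappa> * norm (s - \<phi>)"
      by (rule field_differentiable_bound[of UNIV _ u1]) (auto intro: DERIV_P u1\<kappa>)
    then have "\<rho> * \<bar>P2 s - P2 \<phi>\<bar> \<le> \<rho> * (\<kappa> * (s - \<phi>))" using s \<rho> by simp
    then have "\<bar>fst (arc \<rho> \<phi> s)\<bar> \<le> \<rho> * (\<kappa> * (s - \<phi>))" using \<rho> by (simp add: arc_def abs_mult)
    moreover have "\<kappa> * sf_dist Nm (arc \<rho> \<phi> s) (arc \<rho> \<phi> s') \<le> \<kappa> * (\<rho> * (s' - s))"
      by (intro mult_left_mono le less_imp_le[OF \<kappa>0])
    moreover have "\<rho> * (\<kappa> * (s - \<phi>)) + \<kappa> * (\<rho> * (s' - s)) \<le> \<kappa> * (\<rho> * (\<psi> - \<phi>))"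
    proof -
      have "\<kappa> * (\<rho> * (s' - \<phi>)) \<le> \<kappa> * (\<rho> * (\<psi> - \<phi>))" using s \<kappa>0 \<rho> by (intro mult_left_mono) auto
      then show ?thesis by (simp add: algebra_simps)
    qed
    ultimately have "\<bar>fst (arc \<rho> \<phi> s)\<bar> + \<kappa> * sf_dist Nm (arc \<rho> \<phi> s) (arc \<rho> \<phi> s') < rr" using small by linarith
    from lipP[OF this] have "\<rho> * (s' - s) \<le> sf_dist Nm (arc \<rho> \<phi> s) (arc \<rho> \<phi> s')"
      unfolding HPs[OF sI(1)] HPs[OF sI(2)] by (simp add: algebra_simps)
    then show ?thesis using le by simp
  qed
  then show "\<phi> \<le> s \<Longrightarrow> s \<le> s' \<Longrightarrow> s' \<le> \<psi> \<Longrightarrow> sf_dist Nm (arc \<rho> \<phi> s) (arc \<rho> \<phi> s') = \<rho> * (s' - s)" .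
  assume t: "0 \<le> t" "t \<le> 1" and q1: "sf_dist Nm (0, 0, 0) q = t * (\<rho> * (\<psi> - \<phi>))"
    and q2: "sf_dist Nm q (arc \<rho> \<phi> \<psi>) = (1 - t) * (\<rho> * (\<psi> - \<phi>))"
  have w0: "0 \<le> \<rho> * (\<psi> - \<phi>)" using \<rho> I by simp
  have strip1: "\<bar>fst e\<bar> + \<kappa> * sf_dist Nm e q < rr"
  proof -
    have "t * (\<rho> * (\<psi> - \<phi>)) \<le> 1 * (\<rho> * (\<psi> - \<phi>))" using t w0 by (intro mult_right_mono) auto
    from mult_left_mono[OF this less_imp_le[OF \<kappa>0]] show ?thesis
      using small unfolding q1[folded e_def] mult_1 e0 abs_zero add_0 by (rule le_less_trans)
  qed
  \<comment> \<open>The functions \<open>x\<close> and \<open>- x\<close> are calibrations with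
    constant \<open>\<kappa>\<close>. They locate \<open>q\<close> inside the strip and leave enough
    room for the second leg.\<close>
  have xq: "\<bar>fst q\<bar> \<le> \<kappa> * sf_dist Nm e q"
  proof -
    have v: "\<bar>fst v\<bar> \<le> \<kappa> * Nm v" for v using R2_norm_bounds(1)[of v] \<kappa>[of v] by linarith
    have "fst q - fst e \<le> \<kappa> * sf_dist Nm e q"
    proof (rule sf_dist_calibration[where K = "\<lambda>x. x" and K' = "\<lambda>x. 1" and ?k1.0 = 0 and ?k2.0 = 0 and H = fst, OF _ _ \<kappa> strip1])
      show "1 * v1 + (0 + 0 * x) * v2 \<le> \<kappa> * Nm (v1, v2)" for x v1 v2 :: real using v[of "(v1, v2)"] by simp
    qed (auto intro!: derivative_eq_intros)
    moreover have "- fst q - - fst e \<le> \<kappa> * sf_dist Nm e q"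
    proof (rule sf_dist_calibration[where K = "\<lambda>x. - x" and K' = "\<lambda>x. - 1" and ?k1.0 = 0 and ?k2.0 = 0 and H = "\<lambda>p. - fst p", OF _ _ \<kappa> strip1])
      show "- 1 * v1 + (0 + 0 * x) * v2 \<le> \<kappa> * Nm (v1, v2)" for x v1 v2 :: real using v[of "(v1, v2)"] by simp
      show "((\<lambda>x. - x) has_real_derivative - 1) (at x)" for x :: real by (intro DERIV_minus DERIV_ident)
    qed simp
    ultimately have "\<bar>fst q - fst e\<bar> \<le> \<kappa> * sf_dist Nm e q" by linarith
    then show ?thesis by (simp add: e_def)
  qed
  have xqr: "\<bar>fst q\<bar> < rr" using xq strip1 by (simp add: e_def)
  have strip2: "\<bar>fst q\<bar> + \<kappa> * sf_dist Nm q (arc \<rho> \<phi> \<psi>) < rr"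
    using xq small unfolding q2 e_def q1 by (simp add: algebra_simps)
  \<comment> \<open>The two one-sided bounds add up to the exact increment of \<open>HP\<close>
    between the ends of the arc, so both are equalities.\<close>
  have "HP q - HP e \<le> t * (\<rho> * (\<psi> - \<phi>))" using lipP[OF strip1] q1 by (simp add: e_def)
  moreover have "HP (arc \<rho> \<phi> \<psi>) - HP q \<le> (1 - t) * (\<rho> * (\<psi> - \<phi>))" using lipP[OF strip2] q2 by simp
  moreover have "HP (arc \<rho> \<phi> \<psi>) - HP e = \<rho> * (\<psi> - \<phi>)" unfolding HPs[OF \<phi>I(2)] HPe by (simp add: algebra_simps)
  ultimately have HPq: "HP q - HP e = t * (\<rho> * (\<psi> - \<phi>))" by (simp add: algebra_simps)
  then have sharp: "HP q - HP e = sf_dist Nm e q" using q1 by (simp add: e_def)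
  obtain c where c: "c > 0" "\<And>x. Nd x \<le> c * norm x" using dual.Nm_le_norm by blast
  obtain m where m: "m > 0" "\<And>x. norm x \<le> m * Nd x" using dual.norm_le_Nm by blast
  have PB: "\<bar>P1 s\<bar> \<le> m" "\<bar>P2 s\<bar> \<le> m" for s
    using R2_norm_bounds(1,2)[of "Pc s"] m(2)[of "Pc s"] by (auto simp: P1_def P2_def Nd_Pc)
  have uB: "\<bar>u2 s\<bar> \<le> \<kappa>" for s
    using R2_norm_bounds(2)[of "uc s"] \<kappa>[of "uc s"] by (auto simp: u2_def Nm_uc)
  have NdB: "Nd (x, y) \<le> c * (\<bar>x\<bar> + \<bar>y\<bar>)" for x y
    using order_trans[OF c(2)[of "(x, y)"] mult_left_mono[OF R2_norm_bounds(3)[of "(x, y)"]]] c(1) by simp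
  note cons = conserved_of_sharp_calibration[where r = rr and KP = KP and Pf = Pf and ?kP1.0 = X0 and ?kP2.0 = "1 / \<rho>"
      and uf = uf and \<kappa> = \<kappa> and p = e and q = q and HP = HP]
  \<comment> \<open>On an arc with this \<open>\<rho>\<close> the second coordinate and
    \<open>- \<rho> * P1\<close> differ by a constant, so the horizontal gradient of
    \<open>H2\<close> annihilates \<open>uf\<close>.\<close>
  define H2 where "H2 p = fst (snd p) + \<rho> * P1 (S (fst p))" for p :: R3
  have "H2 q = H2 e"
  proof (rule cons[where KW = "\<lambda>x. \<rho> * P1 (S x)" and Wf = "\<lambda>x. (- u2 (S x) / u1 (S x), 1)" and ?kW1.0 = 1 and ?kW2.0 = 0
       and C = "c * (\<kappa> / b + 1)"])
    fix x assume x: "\<bar>x\<bar> < rr"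
    show "(KP has_real_derivative fst (Pf x)) (at x)" "X0 + 1 / \<rho> * x = snd (Pf x)"
      "Nd (Pf x) \<le> 1" "Pf x \<bullet> uf x = 1" "Nm (uf x) = 1"
      using KP[OF x] X0S[OF x] by (simp_all add: Pf) (simp_all add: Pf_def uf_def Nd_Pc Pc_uc Nm_uc)
    show "((\<lambda>x. \<rho> * P1 (S x)) has_real_derivative fst (- u2 (S x) / u1 (S x), 1)) (at x)"
      using DERIV_cmult[OF dP1[OF x], of \<rho>] \<rho> by simp
    have "\<bar>u2 (S x)\<bar> / \<bar>u1 (S x)\<bar> \<le> \<kappa> / b" using uB u1(1)[OF S(1)[OF x]] b \<kappa>0 by (intro frac_le) auto
    then have "c * (\<bar>- u2 (S x) / u1 (S x)\<bar> + \<bar>1\<bar>) \<le> c * (\<kappa> / b + 1)" using c(1) by (intro mult_left_mono) auto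
    then show "Nd (- u2 (S x) / u1 (S x), 1) \<le> c * (\<kappa> / b + 1)" using NdB order_trans by blast
    show "(- u2 (S x) / u1 (S x), 1) \<bullet> uf x = 0" using u1(2)[OF S(1)[OF x]] by (simp add: inner_prod_def Pf)
  qed (use \<kappa> strip1 H0 sharp in \<open>auto simp: H2_def\<close>)
  \<comment> \<open>Both \<open>\<rho> * S\<close> and \<open>HP\<close> grow at unit rate in the
    direction \<open>uf\<close>, so their difference is flat.\<close>
  define H1 where "H1 p = \<rho> * S (fst p) - HP p" for p
  have "H1 q = H1 e"
  proof (rule cons[where KW = "\<lambda>x. \<rho> * S x - KP x" and Wf = "\<lambda>x. (1 / u1 (S x) - P1 (S x), - P2 (S x))" and ?kW1.0 = "- X0"
       and ?kW2.0 = "- (1 / \<rho>)" and C = "c * (1 / b + m + m)"])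
    fix x assume x: "\<bar>x\<bar> < rr"
    show "(KP has_real_derivative fst (Pf x)) (at x)" "X0 + 1 / \<rho> * x = snd (Pf x)"
      "Nd (Pf x) \<le> 1" "Pf x \<bullet> uf x = 1" "Nm (uf x) = 1"
      using KP[OF x] X0S[OF x] by (simp_all add: Pf) (simp_all add: Pf_def uf_def Nd_Pc Pc_uc Nm_uc)
    show "((\<lambda>x. \<rho> * S x - KP x) has_real_derivative fst (1 / u1 (S x) - P1 (S x), - P2 (S x))) (at x)"
      using DERIV_diff[OF DERIV_cmult[OF S(3)[OF x], of \<rho>] KP[OF x]] \<rho> by simp
    show "- X0 + - (1 / \<rho>) * x = snd (1 / u1 (S x) - P1 (S x), - P2 (S x))" using X0S[OF x] by simp
    have "1 / \<bar>u1 (S x)\<bar> \<le> 1 / b" using u1(1)[OF S(1)[OF x]] b by (intro divide_left_mono) auto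
    then have "c * (\<bar>1 / u1 (S x) - P1 (S x)\<bar> + \<bar>- P2 (S x)\<bar>) \<le> c * (1 / b + m + m)"
      using c(1) PB[of "S x"] abs_triangle_ineq4[of "1 / u1 (S x)" "P1 (S x)"] by (intro mult_left_mono) auto
    then show "Nd (1 / u1 (S x) - P1 (S x), - P2 (S x)) \<le> c * (1 / b + m + m)" using NdB order_trans by blast
    show "(1 / u1 (S x) - P1 (S x), - P2 (S x)) \<bullet> uf x = 0"
      using u1(2)[OF S(1)[OF x]] P_u[of "S x"] by (simp add: inner_prod_def Pf algebra_simps)
  qed (use \<kappa> strip1 H0 sharp in \<open>auto simp: H1_def algebra_simps\<close>)
  have Se: "S (fst e) = \<phi>" unfolding e by (rule arcS[OF \<phi>I(1)])
  define s where "s = \<phi> + t * (\<psi> - \<phi>)"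
  have "\<rho> * (S (fst q)) = \<rho> * s"
    using \<open>H1 q = H1 e\<close> HPq by (simp add: H1_def Se s_def algebra_simps)
  then have Sq: "S (fst q) = s" using \<rho> by simp
  have x: "fst q = \<rho> * (P2 s - P2 \<phi>)" using S(2)[OF xqr] \<rho> unfolding Sq X0_def by simp
  have y: "fst (snd q) = - \<rho> * (P1 s - P1 \<phi>)" 
  proof -
    have "fst (snd q) + \<rho> * P1 s = fst (snd e) + \<rho> * P1 \<phi>" using \<open>H2 q = H2 e\<close> by (simp only: H2_def Sq Se)
    then show ?thesis by (simp add: e_def algebra_simps)
  qed
  have sI: "s \<in> {l..r}" using S(1)[OF xqr] Sq by simp
  have "HP q = HP (arc \<rho> \<phi> s)" unfolding HPs[OF sI] using HPq HPe by (simp add: s_def algebra_simps)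
  moreover have "fst q = fst (arc \<rho> \<phi> s)" "fst (snd q) = fst (snd (arc \<rho> \<phi> s))" using x y by (simp_all add: arc_def)
  ultimately have "fst q = fst (arc \<rho> \<phi> s) \<and> fst (snd q) = fst (snd (arc \<rho> \<phi> s)) \<and> snd (snd q) = snd (snd (arc \<rho> \<phi> s))"
    using \<rho> by (simp add: HP_def)
  then show "q = arc \<rho> \<phi> (\<phi> + t * (\<psi> - \<phi>))" by (simp add: prod_eq_iff s_def)
qed

end

section \<open>The Jacobian of the contraction\<close>

definition det3 :: "R3 \<Rightarrow> R3 \<Rightarrow> R3 \<Rightarrow> real" where
  "det3 a b c = fst a * (fst (snd b) * snd (snd c) - snd (snd b) * fst (snd c))
     - fst (snd a) * (fst b * snd (snd c) - snd (snd b) * fst c)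
     + snd (snd a) * (fst b * fst (snd c) - fst (snd b) * fst c)"

text \<open>The lower bound serves the set of end points, where the parametrization is injective;
  the upper bound serves the intermediate points and tolerates overlaps.\<close>

lemma measure_image_R3:
  fixes g :: "R3 \<Rightarrow> R3"
  assumes S: "compact S" and der: "\<And>p. p \<in> S \<Longrightarrow> (g has_derivative (\<lambda>h. (A p \<bullet> h, B p \<bullet> h, C p \<bullet> h))) (at p)"
  shows "inj_on g S \<Longrightarrow> (\<And>p. p \<in> S \<Longrightarrow> m \<le> \<bar>det3 (A p) (B p) (C p)\<bar>) \<Longrightarrow> m * measure lborel S \<le> measure lborel (g ` S)"
    and "continuous_on S (\<lambda>p. det3 (A p) (B p) (C p)) \<Longrightarrow> (\<And>p. p \<in> S \<Longrightarrow> \<bar>det3 (A p) (B p) (C p)\<bar> \<le> m) \<Longrightarrow>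
      measure lborel (g ` S) \<le> m * measure lborel S"
proof -
  define S' where "S' = to_vec3 ` S"
  define g' where "g' v = to_vec3 (g (of_vec3 v))" for v
  define D where "D v h = to_vec3 (A (of_vec3 v) \<bullet> of_vec3 h, B (of_vec3 v) \<bullet> of_vec3 h, C (of_vec3 v) \<bullet> of_vec3 h)" for v h
  have vim: "of_vec3 -` T = to_vec3 ` T" for T
    by (auto simp: image_iff) (metis to_of_vec(3))
  have cont: "continuous_on T to_vec3" "continuous_on T' of_vec3" for T T'
    using linear_to_vec(2) linear_of_vec(2) linear_continuous_on linear_conv_bounded_linear by blast+
  have cS': "compact S'" unfolding S'_def by (intro compact_continuous_image cont S)
  have cg: "continuous_on S g" using der has_derivative_continuous continuous_at_imp_continuous_on by blast
  have cgS: "compact (g ` S)" by (intro compact_continuous_image cg S)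
  have mS: "measure lborel S' = measure lborel S" "measure lborel (to_vec3 ` (g ` S)) = measure lborel (g ` S)"
    using measure_of_vec3(1)[of S] measure_of_vec3(1)[of "g ` S"] S cgS by (auto simp: vim S'_def compact_imp_closed)
  have im: "g' ` S' = to_vec3 ` (g ` S)" by (auto simp: g'_def S'_def image_iff)
  have cgS': "compact (g' ` S')" unfolding im by (intro compact_continuous_image cont cgS)
  have S'p: "of_vec3 v \<in> S" if "v \<in> S'" for v using that by (auto simp: S'_def)
  have d: "(g' has_derivative D v) (at v within S')" "det (matrix (D v)) = det3 (A (of_vec3 v)) (B (of_vec3 v)) (C (of_vec3 v))"
    if "v \<in> S'" for v
    using conj_derivative_vec3[OF der[OF S'p[OF that]]] by (simp_all add: g'_def[abs_def] D_def[abs_def] det3_def)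
  have lm: "S' \<in> lmeasurable" "g' ` S' \<in> lmeasurable" using cS' cgS' by (simp_all add: lmeasurable_compact)
  have ml: "measure lebesgue S' = measure lborel S" "measure lebesgue (g' ` S') = measure lborel (g ` S)"
    using mS im cS' cgS' by (simp_all add: compact_imp_closed borel_compact measure_completion)
  have one: "((\<lambda>v. c) has_integral c * measure lebesgue S') S'" for c :: real
  proof -
    have "((\<lambda>v. 1) has_integral measure lebesgue S') S'"
      using lm(1) by (simp add: lmeasure_integral lmeasurable_iff_integrable_on integrable_integral)
    from has_integral_mult_right[OF this, of c] show ?thesis by simp
  qed
  {
    assume inj: "inj_on g S" and m: "\<And>p. p \<in> S \<Longrightarrow> m \<le> \<bar>det3 (A p) (B p) (C p)\<bar>"
    have inj': "inj_on g' S'"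
    proof (rule inj_onI)
      fix v w assume vw: "v \<in> S'" "w \<in> S'" "g' v = g' w"
      have "g (of_vec3 v) = g (of_vec3 w)" using arg_cong[OF vw(3), of of_vec3] by (simp add: g'_def)
      then have "of_vec3 v = of_vec3 w" using inj S'p[OF vw(1)] S'p[OF vw(2)] by (simp add: inj_on_def)
      then show "v = w" by (metis to_of_vec(3))
    qed
    have "((\<lambda>v. \<bar>det (matrix (D v))\<bar>) has_integral measure lebesgue (g' ` S')) S'"
      using has_measure_differentiable_image[OF _ d(1) inj'] lm by blast
    from has_integral_le[OF one this] show "m * measure lborel S \<le> measure lborel (g ` S)"
      using m d(2) S'p by (simp add: ml)
  next
    assume c: "continuous_on S (\<lambda>p. det3 (A p) (B p) (C p))" and m: "\<And>p. p \<in> S \<Longrightarrow> \<bar>det3 (A p) (B p) (C p)\<bar> \<le> m"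
    have "continuous_on S' (\<lambda>v. \<bar>det3 (A (of_vec3 v)) (B (of_vec3 v)) (C (of_vec3 v))\<bar>)"
      by (intro continuous_intros continuous_on_compose2[OF c cont(2)]) (use S'p in auto)
    then have "continuous_on S' (\<lambda>v. \<bar>det (matrix (D v))\<bar>)" by (rule continuous_on_eq) (simp add: d)
    then have int: "(\<lambda>v. \<bar>det (matrix (D v))\<bar>) integrable_on S'"
    proof (rule measurable_bounded_by_integrable_imp_integrable[OF continuous_imp_measurable_on_sets_lebesgue])
      show "(\<lambda>v. m) integrable_on S'" using one by blast
      show "norm \<bar>det (matrix (D v))\<bar> \<le> m" if "v \<in> S'" for v using m d(2)[OF that] S'p[OF that] by simp
    qed (use lm in auto)
    have "measure lebesgue (g' ` S') \<le> m * measure lebesgue S'"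
      by (rule measure_bounded_differentiable_image[OF lm(1) d(1) int]) (use m d(2) S'p in auto)
    then show "measure lborel (g ` S) \<le> m * measure lborel S" by (simp add: ml)
  }
qed

section \<open>What measure contraction says about intermediate points\<close>

context plane_norm begin

lemma tau_pow_N_0: "1 < N \<Longrightarrow> 0 < t \<Longrightarrow> tau_pow_N 0 N t \<theta> = ennreal (t powr N)"
proof -
  assume N: "1 < N" and t: "0 < t"
  have "\<not> (N - 1) * pi\<^sup>2 \<le> 0" using N by (simp add: mult_le_0_iff)
  then have "sigma_KN 0 (N - 1) t \<theta> = ennreal t" by (simp add: sigma_KN_def)
  moreover have "t powr (1 / N) * t powr (1 - 1 / N) = t" using t by (simp flip: powr_add)
  ultimately show ?thesis using t by (simp add: tau_pow_N_def)
qed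

lemma origin_in_support: "p \<in> mm_support (sf_dist Nm) lborel"
  unfolding mm_support_def
proof (intro CollectI allI impI)
  fix r :: real assume "r > 0"
  define U where "U = {y. sf_dist Nm p y < r}"
  have U: "open U" "p \<in> U" using open_sf_ball sf_dist_refl \<open>r > 0\<close> by (auto simp: U_def)
  then have "\<not> negligible U" using open_not_negligible by blast
  then have "emeasure lebesgue U \<noteq> 0" using U by (auto simp: negligible_iff_null_sets null_sets_def)
  then show "0 < emeasure lborel {y. sf_dist Nm p y < r}" using U by (simp add: U_def zero_less_iff_neq_zero)
qed

text \<open>Almost every geodesic of the transport measure starts at \<open>p\<close> and ends in
  \<open>A\<close>, so by \<open>inter\<close> it lies in \<open>B\<close> at time \<open>t\<close>.
  Tested on \<open>B\<close>, the left side of the contraction inequality is therefore exactly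
  \<open>t powr N\<close>.\<close>

lemma MCP_intermediate_measure:
  assumes MCP: "MCP (sf_dist Nm) lborel 0 N" and N: "1 < N" and t: "0 < t" "t \<le> 1"
    and A: "compact A" "0 < measure lborel A" and B: "compact B"
    and inter: "\<And>y q. y \<in> A \<Longrightarrow> sf_dist Nm p q = t * sf_dist Nm p y \<Longrightarrow> sf_dist Nm q y = (1 - t) * sf_dist Nm p y \<Longrightarrow> q \<in> B"
  shows "t powr N * measure lborel A \<le> measure lborel B"
proof -
  let ?d = "sf_dist Nm"
  have Ab: "A \<in> sets borel" "B \<in> sets borel" using A B compact_imp_closed borel_closed by blast+
  have Af: "emeasure lborel A < \<infinity>" "emeasure lborel B < \<infinity>"
    using A(1) B emeasure_bounded_finite compact_imp_bounded by blast+
  have eA: "emeasure lborel A = ennreal (measure lborel A)" "emeasure lborel B = ennreal (measure lborel B)"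
    using Af by (simp_all add: emeasure_eq_ennreal_measure)
  have "0 < emeasure lborel A \<and> emeasure lborel A < \<infinity>" using A(2) Af by (simp add: eA)
  then obtain \<eta> where \<eta>: "prob_space \<eta>" "sets \<eta> = sets (GeoM ?d)"
    and d0: "distr \<eta> borel (\<lambda>\<gamma>. \<gamma> 0) = return borel p"
    and d1: "distr \<eta> borel (\<lambda>\<gamma>. \<gamma> 1) = density lborel (\<lambda>y. indicator A y / emeasure lborel A)"
    and c: "\<And>t B. t \<in> {0..1} \<Longrightarrow> B \<in> sets borel \<Longrightarrow>
              (\<integral>\<^sup>+ \<gamma>. tau_pow_N 0 N t (?d (\<gamma> 0) (\<gamma> 1)) * indicator B (\<gamma> t) \<partial>\<eta>)
                \<le> emeasure lborel B / emeasure lborel A"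
    using MCP[unfolded MCP_def, rule_format, OF origin_in_support[of p] Ab(1)] by blast
  interpret prob_space \<eta> by (rule \<eta>(1))
  have m: "(\<lambda>\<gamma>. \<gamma> s) \<in> measurable \<eta> borel" if "s \<in> {0..1}" for s
  proof -
    have "(\<lambda>\<gamma>. \<gamma> s) \<in> measurable (GeoM ?d) borel"
      unfolding GeoM_def by (intro measurable_restrict_space1 measurable_component_singleton that)
    then show ?thesis using measurable_cong_sets[OF \<eta>(2) refl] by blast
  qed
  have sp: "\<gamma> \<in> Geo ?d" if "\<gamma> \<in> space \<eta>" for \<gamma>
    using that sets_eq_imp_space_eq[OF \<eta>(2)] by (simp add: GeoM_def space_restrict_space)
  have m01: "(\<lambda>\<gamma>. \<gamma> 0) \<in> measurable \<eta> borel" "(\<lambda>\<gamma>. \<gamma> 1) \<in> measurable \<eta> borel" by (intro m; simp)+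
  have "AE x in return borel p. x = p" by (subst AE_return) auto
  then have a0: "AE \<gamma> in \<eta>. \<gamma> 0 = p"
    unfolding d0[symmetric] by (subst (asm) AE_distr_iff[OF m01(1)]) auto
  have "AE y in density lborel (\<lambda>y. indicator A y / emeasure lborel A). y \<in> A"
    using Ab by (subst AE_density) (auto simp: indicator_def intro!: borel_measurable_divide_ennreal AE_I2 split: if_splits)
  then have a1: "AE \<gamma> in \<eta>. \<gamma> 1 \<in> A"
    unfolding d1[symmetric] by (subst (asm) AE_distr_iff[OF m01(2)]) (use Ab in auto)
  have aB: "AE \<gamma> in \<eta>. \<gamma> t \<in> B"
    using a0 a1 AE_space
  proof eventually_elim
    fix \<gamma> assume \<gamma>: "\<gamma> 0 = p" "\<gamma> 1 \<in> A" "\<gamma> \<in> space \<eta>"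
    have G: "\<forall>s\<in>{0..1}. \<forall>t\<in>{0..1}. ?d (\<gamma> s) (\<gamma> t) = \<bar>t - s\<bar> * ?d (\<gamma> 0) (\<gamma> 1)"
      using sp[OF \<gamma>(3)] unfolding Geo_def by blast
    show "\<gamma> t \<in> B"
    proof (rule inter[OF \<gamma>(2)])
      show "?d p (\<gamma> t) = t * ?d p (\<gamma> 1)" using G[rule_format, of 0 t] t \<gamma>(1) by simp
      show "?d (\<gamma> t) (\<gamma> 1) = (1 - t) * ?d p (\<gamma> 1)" using G[rule_format, of t 1] t \<gamma>(1) by simp
    qed
  qed
  have "ennreal (t powr N) = (\<integral>\<^sup>+ \<gamma>. ennreal (t powr N) \<partial>\<eta>)" by (simp add: emeasure_space_1)
  also have "\<dots> = (\<integral>\<^sup>+ \<gamma>. tau_pow_N 0 N t (?d (\<gamma> 0) (\<gamma> 1)) * indicator B (\<gamma> t) \<partial>\<eta>)"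
    by (rule nn_integral_cong_AE) (use aB in eventually_elim, simp add: tau_pow_N_0[OF N t(1)])
  also have "\<dots> \<le> emeasure lborel B / emeasure lborel A" using t Ab(2) by (intro c) auto
  also have "\<dots> = ennreal (measure lborel B / measure lborel A)"
    unfolding eA using A(2) by (simp add: divide_ennreal)
  finally have "t powr N \<le> measure lborel B / measure lborel A"
    by (simp add: ennreal_le_iff divide_nonneg_nonneg)
  then show ?thesis using A(2) by (simp add: pos_le_divide_eq)
qed

end

section \<open>The Jacobian of the exponential map\<close>

context regular_norm begin

text \<open>The Jacobian determinant of
  \<open>(\<rho>, \<phi>, s) \<mapsto> arc \<rho> \<phi> s\<close>, divided by
  \<open>\<rho> ^ 3\<close>.\<close>

definition jac :: "real \<Rightarrow> real \<Rightarrow> real" where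
  "jac \<phi> s = (u1 \<phi> * - (P1 s - P1 \<phi>) - u2 \<phi> * (P2 s - P2 \<phi>)) * ((P2 s - P2 \<phi>) * u2 s - - (P1 s - P1 \<phi>) * u1 s)
     - (s - \<phi> - (P1 \<phi> * P2 s - P2 \<phi> * P1 s)) * (u1 \<phi> * u2 s - u2 \<phi> * u1 s)"

text \<open>A triple \<open>p = (\<rho>, \<phi>, \<psi>)\<close> parametrizes end points \<open>arc \<rho> \<phi> \<psi>\<close>; \<open>row1\<close>, \<open>row2\<close> and \<open>row3\<close> are the rows of
  the Jacobian matrix of the map from \<open>p\<close> to the \<open>t\<close>-intermediate point.\<close>

definition par :: "real \<Rightarrow> R3 \<Rightarrow> real" where "par t p = fst (snd p) + t * (snd (snd p) - fst (snd p))"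

definition row1 where "row1 t p = (P2 (par t p) - P2 (fst (snd p)), fst p * ((1 - t) * u1 (par t p) - u1 (fst (snd p))), fst p * (t * u1 (par t p)))"
definition row2 where "row2 t p = (- (P1 (par t p) - P1 (fst (snd p))), fst p * ((1 - t) * u2 (par t p) - u2 (fst (snd p))), fst p * (t * u2 (par t p)))"
definition row3 where "row3 t p = (let \<phi> = fst (snd p); s = par t p; q1 = (P2 s - P2 \<phi>) * u2 s - - (P1 s - P1 \<phi>) * u1 s;
     q0 = (P2 s - P2 \<phi>) * u2 \<phi> - - (P1 s - P1 \<phi>) * u1 \<phi> in
   (fst p * (s - \<phi> - (P1 \<phi> * P2 s - P2 \<phi> * P1 s)), (fst p)\<^sup>2 / 2 * ((1 - t) * q1 + q0), (fst p)\<^sup>2 / 2 * (t * q1)))"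

text \<open>For \<open>t \<noteq> 0\<close> the terms with \<open>1 - t\<close> in the middle column
  are a multiple of the last column and drop out. What remains is \<open>t\<close> times the
  Jacobian of the end point map with the final angle replaced by \<open>par t p\<close>.\<close>

lemma det3_rows: "det3 (row1 t p) (row2 t p) (row3 t p) = t * (fst p) ^ 3 * jac (fst (snd p)) (par t p)"
proof -
  have *: "det3 (i1, \<rho> * ((1 - t) * w1 - v1), \<rho> * (t * w1)) (i2, \<rho> * ((1 - t) * w2 - v2), \<rho> * (t * w2))
     (\<rho> * a, \<rho>\<^sup>2 / 2 * ((1 - t) * (i1 * w2 - i2 * w1) + (i1 * v2 - i2 * v1)), \<rho>\<^sup>2 / 2 * (t * (i1 * w2 - i2 * w1)))
     = t * \<rho> ^ 3 * ((v1 * i2 - v2 * i1) * (i1 * w2 - i2 * w1) - a * (v1 * w2 - v2 * w1))" for i1 i2 v1 v2 w1 w2 \<rho> a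
    by (simp add: det3_def power2_eq_square power3_eq_cube field_simps)
  show ?thesis unfolding row1_def row2_def row3_def jac_def Let_def by (rule *)
qed

lemma arc_has_derivative:
  "((\<lambda>p. arc (fst p) (fst (snd p)) (par t p)) has_derivative (\<lambda>h. (row1 t p \<bullet> h, row2 t p \<bullet> h, row3 t p \<bullet> h))) (at p)"
proof -
  obtain \<rho> \<phi> \<psi> where p: "p = (\<rho>, \<phi>, \<psi>)" by (metis prod.exhaust)
  define s where "s = par t p"
  have bl: "((\<lambda>p :: R3. fst p) has_derivative (\<lambda>h. fst h)) (at p)" "((\<lambda>p :: R3. fst (snd p)) has_derivative (\<lambda>h. fst (snd h))) (at p)"
    "((\<lambda>p :: R3. snd (snd p)) has_derivative (\<lambda>h. snd (snd h))) (at p)"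
    by (auto intro!: derivative_eq_intros)
  have dpar: "(par t has_derivative (\<lambda>h. fst (snd h) + t * (snd (snd h) - fst (snd h)))) (at p)"
    unfolding par_def[abs_def] by (intro has_derivative_add has_derivative_mult_right has_derivative_diff bl)
  note D = DERIV_compose_FDERIV[OF DERIV_P(1) bl(2)] DERIV_compose_FDERIV[OF DERIV_P(2) bl(2)]
     DERIV_compose_FDERIV[OF DERIV_P(1) dpar] DERIV_compose_FDERIV[OF DERIV_P(2) dpar]
  have "((\<lambda>p. arc (fst p) (fst (snd p)) (par t p)) has_derivative (\<lambda>h.
     (let \<tau> = fst (snd h) + t * (snd (snd h) - fst (snd h)); f = fst (snd h) in
     (\<rho> * (\<tau> * u1 s - f * u1 \<phi>) + fst h * (P2 s - P2 \<phi>),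
      - \<rho> * (\<tau> * - u2 s - f * - u2 \<phi>) + - fst h * (P1 s - P1 \<phi>),
      \<rho>\<^sup>2 / 2 * (\<tau> - f - ((P1 \<phi> * (\<tau> * u1 s) + (f * - u2 \<phi>) * P2 s) - (P2 \<phi> * (\<tau> * - u2 s) + (f * u1 \<phi>) * P1 s)))
       + (\<rho> * fst h + fst h * \<rho>) / 2 * (s - \<phi> - (P1 \<phi> * P2 s - P2 \<phi> * P1 s)))))) (at p)"
  proof -
    have h2: "((\<lambda>p :: R3. (fst p)\<^sup>2 / 2) has_derivative (\<lambda>h. (\<rho> * fst h + fst h * \<rho>) / 2)) (at p)"
      by (auto intro!: derivative_eq_intros simp: p)
    show ?thesis
      unfolding arc_def Let_def
      by (rule has_derivative_eq_rhs[OF has_derivative_Pair[OF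
          has_derivative_mult[OF bl(1) has_derivative_diff[OF D(4) D(2)]] has_derivative_Pair[OF
          has_derivative_mult[OF has_derivative_minus[OF bl(1)] has_derivative_diff[OF D(3) D(1)]]
          has_derivative_mult[OF h2 has_derivative_diff[OF has_derivative_diff[OF dpar bl(2)]
            has_derivative_diff[OF has_derivative_mult[OF D(1) D(4)] has_derivative_mult[OF D(2) D(3)]]]]]]])
         (unfold s_def[symmetric], simp add: p)
  qed
  moreover have "(let \<tau> = fst (snd h) + t * (snd (snd h) - fst (snd h)); f = fst (snd h) in
     (\<rho> * (\<tau> * u1 s - f * u1 \<phi>) + fst h * (P2 s - P2 \<phi>),
      - \<rho> * (\<tau> * - u2 s - f * - u2 \<phi>) + - fst h * (P1 s - P1 \<phi>),
      \<rho>\<^sup>2 / 2 * (\<tau> - f - ((P1 \<phi> * (\<tau> * u1 s) + (f * - u2 \<phi>) * P2 s) - (P2 \<phi> * (\<tau> * - u2 s) + (f * u1 \<phi>) * P1 s)))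
       + (\<rho> * fst h + fst h * \<rho>) / 2 * (s - \<phi> - (P1 \<phi> * P2 s - P2 \<phi> * P1 s))))
     = (row1 t p \<bullet> h, row2 t p \<bullet> h, row3 t p \<bullet> h)" for h
  proof -
    obtain h1 h2 h3 where h: "h = (h1, h2, h3)" by (metis prod.exhaust)
    define \<tau> where "\<tau> = h2 + t * (h3 - h2)"
    define q1 where "q1 = (P2 s - P2 \<phi>) * u2 s - - (P1 s - P1 \<phi>) * u1 s"
    define q0 where "q0 = (P2 s - P2 \<phi>) * u2 \<phi> - - (P1 s - P1 \<phi>) * u1 \<phi>"
    \<comment> \<open>The constant \<open>1\<close> is rewritten by \<open>P_u\<close>, once at
      \<open>s\<close> and once at \<open>\<phi>\<close>; this expresses the vertical derivative
      through \<open>q1\<close> and \<open>q0\<close>.\<close>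
    have 1: "1 - P1 \<phi> * u1 s - P2 \<phi> * u2 s = q1" using P_u[of s] by (simp add: q1_def algebra_simps)
    have 0: "u2 \<phi> * P2 s + u1 \<phi> * P1 s - 1 = q0" using P_u[of \<phi>] by (simp add: q0_def algebra_simps)
    have "\<tau> - h2 - ((P1 \<phi> * (\<tau> * u1 s) + (h2 * - u2 \<phi>) * P2 s) - (P2 \<phi> * (\<tau> * - u2 s) + (h2 * u1 \<phi>) * P1 s)) = \<tau> * q1 + h2 * q0"
      unfolding 1[symmetric] 0[symmetric] by (simp add: algebra_simps)
    then have e: "\<rho>\<^sup>2 / 2 * (\<tau> - h2 - ((P1 \<phi> * (\<tau> * u1 s) + (h2 * - u2 \<phi>) * P2 s) - (P2 \<phi> * (\<tau> * - u2 s) + (h2 * u1 \<phi>) * P1 s)))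
       + (\<rho> * h1 + h1 * \<rho>) / 2 * (s - \<phi> - (P1 \<phi> * P2 s - P2 \<phi> * P1 s))
       = \<rho> * (s - \<phi> - (P1 \<phi> * P2 s - P2 \<phi> * P1 s)) * h1 + \<rho>\<^sup>2 / 2 * ((1 - t) * q1 + q0) * h2 + \<rho>\<^sup>2 / 2 * (t * q1) * h3"
      by (simp only: \<tau>_def) (simp add: field_simps)
    show ?thesis
      unfolding Let_def h fst_conv snd_conv \<tau>_def[symmetric] e
      unfolding row1_def row2_def row3_def Let_def unfolding s_def[symmetric]
      unfolding p fst_conv snd_conv q1_def[symmetric] q0_def[symmetric] inner_prod_def
      by (simp add: \<tau>_def algebra_simps)
  qed
  ultimately show ?thesis by simp
qed

lemma continuous_on_P: "continuous_on S P1" "continuous_on S P2"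
  using DERIV_P by (meson DERIV_isCont continuous_at_imp_continuous_on)+

lemma continuous_on_jac: "continuous_on S f \<Longrightarrow> continuous_on S g \<Longrightarrow> continuous_on S (\<lambda>x. jac (f x) (g x))"
  unfolding jac_def
  by (intro continuous_intros continuous_on_compose2[OF continuous_on_P(1)[of UNIV]] continuous_on_compose2[OF continuous_on_P(2)[of UNIV]]
     continuous_on_compose2[OF continuous_u(1)[of UNIV]] continuous_on_compose2[OF continuous_u(2)[of UNIV]]) auto

end

section \<open>Dini derivatives and density points\<close>

text \<open>At the leftmost point where \<open>f x - M * x\<close> is at least its value at
  \<open>t\<close>, the local bound would yield a point of the same kind further left.\<close>

lemma increment_le_of_left_Dini:
  fixes f :: "real \<Rightarrow> real"
  assumes cont: "continuous_on {a..e} f"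
    and loc: "\<And>p. a < p \<Longrightarrow> p \<le> e \<Longrightarrow> \<exists>d>0. \<forall>x. p - d < x \<longrightarrow> x < p \<longrightarrow> a \<le> x \<longrightarrow> f p - f x \<le> M * (p - x)"
    and st: "a \<le> s" "s \<le> t" "t \<le> e"
  shows "f t - f s \<le> M * (t - s)"
proof (rule ccontr)
  define g where "g x = f x - M * x" for x
  assume "\<not> f t - f s \<le> M * (t - s)"
  then have gts: "g s < g t" by (simp add: g_def algebra_simps)
  have cg: "continuous_on {s..t} g"
    unfolding g_def by (intro continuous_intros continuous_on_subset[OF cont]) (use st in auto)
  define T where "T = {x\<in>{s..t}. g t \<le> g x}"
  have "T = {s..t} \<inter> g -` {g t..}" by (auto simp: T_def)
  then have "closed T" using continuous_closed_preimage[OF cg closed_atLeastAtMost closed_atLeast] by simp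
  have T: "t \<in> T" "bdd_below T" using st by (auto simp: T_def intro!: bdd_belowI[of _ s])
  define x0 where "x0 = Inf T"
  have "x0 \<in> T" unfolding x0_def by (rule closed_contains_Inf) (use T \<open>closed T\<close> in auto)
  then have x0: "s \<le> x0" "x0 \<le> t" "g t \<le> g x0" by (auto simp: T_def)
  then have "s < x0" using gts by (cases "s = x0") auto
  then obtain d where d: "d > 0" "\<And>x. x0 - d < x \<Longrightarrow> x < x0 \<Longrightarrow> a \<le> x \<Longrightarrow> f x0 - f x \<le> M * (x0 - x)"
    using loc[of x0] st x0 by auto
  obtain x where x: "max (x0 - d) s < x" "x < x0" using dense[of "max (x0 - d) s" x0] \<open>s < x0\<close> d(1) by auto
  then have "g x0 \<le> g x" using d(2)[of x] st by (simp add: g_def algebra_simps)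
  then have "x \<in> T" using x x0 by (auto simp: T_def)
  then have "x0 \<le> x" unfolding x0_def using T(2) by (rule cInf_lower)
  then show False using x by simp
qed

text \<open>In a fine Riemann sum an interval tagged in \<open>Z\<close> adds at most
  \<open>\<epsilon>\<close> times its length to the increment, any other at most \<open>L\<close>
  times its length; the total length of the others approximates the measure of the complement of
  \<open>Z\<close>.\<close>

lemma increment_le_measure_nonstationary:
  fixes w :: "real \<Rightarrow> real"
  assumes ab: "a \<le> b" and L: "L \<ge> 0" "\<And>s t. a \<le> s \<Longrightarrow> s \<le> t \<Longrightarrow> t \<le> b \<Longrightarrow> w t - w s \<le> L * (t - s)"
    and Z: "Z \<in> sets lebesgue"
    and stat: "\<And>z e. z \<in> Z \<Longrightarrow> z \<in> {a..b} \<Longrightarrow> e > 0 \<Longrightarrow> \<exists>d>0. \<forall>t. \<bar>t - z\<bar> < d \<longrightarrow> a \<le> t \<longrightarrow> t \<le> b \<longrightarrow> \<bar>w t - w z\<bar> \<le> e * \<bar>t - z\<bar>"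
  shows "w b - w a \<le> L * measure lebesgue ({a..b} - Z)"
proof -
  define \<mu> where "\<mu> = measure lebesgue ({a..b} - Z)"
  define h where "h x = (if x \<in> Z then 0 else 1 :: real)" for x
  have lm: "{a..b} - Z \<in> lmeasurable" using Z by (intro fmeasurable_Diff) auto
  have "(h has_integral \<mu>) {a..b}"
  proof -
    have "((\<lambda>x. 1 :: real) has_integral \<mu>) ({a..b} - Z)"
      using lm by (simp add: \<mu>_def lmeasure_integral lmeasurable_iff_integrable_on integrable_integral)
    then have "((\<lambda>x. if x \<in> {a..b} - Z then 1 else 0 :: real) has_integral \<mu>) {a..b}"
      by (subst has_integral_restrict) auto
    then show ?thesis by (rule has_integral_eq[rotated]) (auto simp: h_def)
  qed
  note int = this[unfolded has_integral_real, rule_format]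
  have main: "w b - w a \<le> L * \<mu> + \<epsilon> * (L + (b - a))" if \<epsilon>: "\<epsilon> > 0" for \<epsilon>
  proof -
    obtain \<gamma>1 where \<gamma>1': "gauge \<gamma>1 \<and> (\<forall>D. D tagged_division_of {a..b} \<and> \<gamma>1 fine D \<longrightarrow>
      norm ((\<Sum>(x, K)\<in>D. measure lborel K *\<^sub>R h x) - \<mu>) < \<epsilon>)"
      by (rule exE[OF int[OF \<epsilon>]], rule that)
    note \<gamma>1 = conjunct1[OF \<gamma>1'] conjunct2[OF \<gamma>1', THEN spec, THEN mp, OF conjI]
    have "\<exists>d>0. z \<in> Z \<longrightarrow> z \<in> {a..b} \<longrightarrow> (\<forall>t. \<bar>t - z\<bar> < d \<longrightarrow> a \<le> t \<longrightarrow> t \<le> b \<longrightarrow> \<bar>w t - w z\<bar> \<le> \<epsilon> * \<bar>t - z\<bar>)" for z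
      using stat[of z \<epsilon>] \<epsilon> by (cases "z \<in> Z \<and> z \<in> {a..b}") (auto intro: exI[of _ 1])
    then obtain d where d: "\<And>z. d z > 0" "\<And>z t. z \<in> Z \<Longrightarrow> z \<in> {a..b} \<Longrightarrow> \<bar>t - z\<bar> < d z \<Longrightarrow> a \<le> t \<Longrightarrow> t \<le> b \<Longrightarrow> \<bar>w t - w z\<bar> \<le> \<epsilon> * \<bar>t - z\<bar>"
      by metis
    have "gauge (\<lambda>x. ball x (d x))" using d(1) by (rule gauge_ball_dependent[rule_format])
    then have "gauge (\<lambda>x. \<gamma>1 x \<inter> ball x (d x))" using \<gamma>1(1) by (intro gauge_Int)
    then obtain D where D: "D tagged_division_of {a..b}" "(\<lambda>x. \<gamma>1 x \<inter> ball x (d x)) fine D"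
      using fine_division_exists_real[of _ a b] by metis
    have fine1: "\<gamma>1 fine D" and fine2: "(\<lambda>x. ball x (d x)) fine D" using D(2) by (auto simp: fine_Int)
    have K: "\<exists>u v. K = {u..v} \<and> u \<le> v \<and> x \<in> {u..v} \<and> {u..v} \<subseteq> {a..b} \<and> {u..v} \<subseteq> ball x (d x)" if "(x, K) \<in> D" for x K
    proof -
      have "x \<in> K" "K \<subseteq> {a..b}" "\<exists>u v. K = cbox u v" "K \<subseteq> ball x (d x)"
        using D(1) fine2 that by (blast, blast, blast, blast)
      then show ?thesis by fastforce
    qed
    have each: "w (Sup K) - w (Inf K) \<le> L * (measure lborel K *\<^sub>R h x) + \<epsilon> * (Sup K - Inf K)" if xK: "(x, K) \<in> D" for x K
    proof -
      obtain u v where uv: "K = {u..v}" "u \<le> v" "x \<in> {u..v}" "{u..v} \<subseteq> {a..b}" "{u..v} \<subseteq> ball x (d x)" using K[OF xK] by blast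
      then have ab': "a \<le> u" "v \<le> b" "u \<le> x" "x \<le> v" by auto
      show ?thesis
      proof (cases "x \<in> Z")
        case True
        have "u \<in> {u..v}" "v \<in> {u..v}" using uv(2) by auto
        then have "u \<in> ball x (d x)" "v \<in> ball x (d x)" using uv(5) by blast+
        then have du: "\<bar>u - x\<bar> < d x" and dv: "\<bar>v - x\<bar> < d x" by (auto simp: dist_real_def)
        have "\<bar>w u - w x\<bar> \<le> \<epsilon> * \<bar>u - x\<bar>" by (rule d(2)[OF True _ du]) (use ab' in auto)
        moreover have "\<bar>w v - w x\<bar> \<le> \<epsilon> * \<bar>v - x\<bar>" by (rule d(2)[OF True _ dv]) (use ab' in auto)
        ultimately have "w x - w u \<le> \<epsilon> * (x - u)" "w v - w x \<le> \<epsilon> * (v - x)" using ab' by auto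
        then have "w v - w u \<le> \<epsilon> * (x - u) + \<epsilon> * (v - x)" by simp
        then show ?thesis using uv True by (simp add: h_def algebra_simps)
      next
        case False
        have "w v - w u \<le> L * (v - u)" using L(2) ab' uv(2) by auto
        moreover have "0 \<le> \<epsilon> * (v - u)" using \<epsilon> uv(2) by simp
        ultimately show ?thesis using uv False by (simp add: h_def)
      qed
    qed
    have "w b - w a = (\<Sum>(x, K)\<in>D. w (Sup K) - w (Inf K))"
      using additive_tagged_division_1[OF ab D(1), of w] by simp
    also have "\<dots> \<le> (\<Sum>(x, K)\<in>D. L * (measure lborel K *\<^sub>R h x) + \<epsilon> * (Sup K - Inf K))"
      by (rule sum_mono) (use each in auto)
    also have "\<dots> = L * (\<Sum>(x, K)\<in>D. measure lborel K *\<^sub>R h x) + \<epsilon> * (\<Sum>(x, K)\<in>D. Sup K - Inf K)"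
      by (simp only: split_def sum.distrib sum_distrib_left)
    also have "(\<Sum>(x, K)\<in>D. Sup K - Inf K) = b - a"
      using additive_tagged_division_1[OF ab D(1), of "\<lambda>x. x"] by simp
    also have "L * (\<Sum>(x, K)\<in>D. measure lborel K *\<^sub>R h x) \<le> L * (\<mu> + \<epsilon>)"
      using \<gamma>1(2)[OF D(1) fine1] L(1) by (intro mult_left_mono) (auto simp: abs_less_iff)
    finally show ?thesis by (simp add: algebra_simps)
  qed
  have "w b - w a \<le> L * \<mu>"
  proof (rule field_le_epsilon)
    fix e :: real assume e: "e > 0"
    define \<epsilon> where "\<epsilon> = e / (L + (b - a) + 1)"
    have p: "L + (b - a) + 1 > 0" using L(1) ab by simp
    then have "\<epsilon> > 0" "\<epsilon> * (L + (b - a) + 1) = e" using e by (simp_all add: \<epsilon>_def)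
    then show "w b - w a \<le> L * \<mu> + e" using main[of \<epsilon>] by (simp add: algebra_simps)
  qed
  then show ?thesis by (simp add: \<mu>_def)
qed

text \<open>Near a density point \<open>a\<close> of the stationary set, the Dini estimate improves every Lipschitz constant
  by the factor \<open>1 / 2\<close>.\<close>

lemma constant_of_Dini_and_density:
  fixes w :: "real \<Rightarrow> real"
  assumes ae: "a \<le> e" and K: "K > 0"
    and L0: "\<And>s t. a \<le> s \<Longrightarrow> s \<le> t \<Longrightarrow> t \<le> e \<Longrightarrow> \<bar>w t - w s\<bar> \<le> L0 * (t - s)"
    and Z: "Z \<in> sets lebesgue"
    and stat: "\<And>z \<epsilon>. z \<in> Z \<Longrightarrow> z \<in> {a..e} \<Longrightarrow> \<epsilon> > 0 \<Longrightarrow> \<exists>d>0. \<forall>t. \<bar>t - z\<bar> < d \<longrightarrow> a \<le> t \<longrightarrow> t \<le> e \<longrightarrow> \<bar>w t - w z\<bar> \<le> \<epsilon> * \<bar>t - z\<bar>"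
    and dens: "\<And>x. a < x \<Longrightarrow> x \<le> e \<Longrightarrow> measure lebesgue ({a..x} - Z) \<le> (x - a) / (2 * K)"
    and dini: "\<And>p. a < p \<Longrightarrow> p \<le> e \<Longrightarrow> \<exists>d>0. \<forall>x. p - d < x \<longrightarrow> x < p \<longrightarrow> a \<le> x \<longrightarrow> w p - w x \<le> K * ((w p - w a) / (p - a)) * (p - x)"
  shows "w e \<le> w a"
proof (cases "a = e")
  case False
  then have ae': "a < e" using ae by simp
  have L00: "L0 \<ge> 0" using L0[of a e] ae' by (smt (verit) mult_neg_pos)
  have cont: "continuous_on {a..e} w"
  proof -
    have "L0-lipschitz_on {a..e} w"
    proof (rule lipschitz_onI)
      fix s t assume "s \<in> {a..e}" "t \<in> {a..e}"
      then show "dist (w s) (w t) \<le> L0 * dist s t"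
        using L0[of s t] L0[of t s] by (cases "s \<le> t") (auto simp: dist_real_def abs_minus_commute)
    qed (rule L00)
    then show ?thesis by (rule lipschitz_on_continuous_on)
  qed
  \<comment> \<open>One round of improvement: density bounds the mean slope from \<open>a\<close> to
    \<open>p\<close>, and the Dini estimate passes this bound on to the left slopes at
    \<open>p\<close>.\<close>
  have step: "w t - w s \<le> L / 2 * (t - s)"
    if L: "L \<ge> 0" "\<And>s t. a \<le> s \<Longrightarrow> s \<le> t \<Longrightarrow> t \<le> e \<Longrightarrow> w t - w s \<le> L * (t - s)" and st: "a \<le> s" "s \<le> t" "t \<le> e" for L s t
  proof (rule increment_le_of_left_Dini[OF cont _ st])
    fix p assume p: "a < p" "p \<le> e"
    have "w p - w a \<le> L * measure lebesgue ({a..p} - Z)"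
    proof (rule increment_le_measure_nonstationary[OF _ L(1) _ Z])
      show "\<exists>d>0. \<forall>t. \<bar>t - z\<bar> < d \<longrightarrow> a \<le> t \<longrightarrow> t \<le> p \<longrightarrow> \<bar>w t - w z\<bar> \<le> \<epsilon> * \<bar>t - z\<bar>"
        if z: "z \<in> Z" "z \<in> {a..p}" "\<epsilon> > 0" for z \<epsilon>
      proof -
        have "z \<in> {a..e}" using z(2) p by auto
        then obtain d where "d > 0" and d: "\<And>t. \<bar>t - z\<bar> < d \<Longrightarrow> a \<le> t \<Longrightarrow> t \<le> e \<Longrightarrow> \<bar>w t - w z\<bar> \<le> \<epsilon> * \<bar>t - z\<bar>"
          using stat[OF z(1) _ z(3)] by blast
        show ?thesis by (intro exI[of _ d] conjI allI impI \<open>d > 0\<close> d) (use p(2) in auto)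
      qed
    qed (use L(2) p in auto)
    also have "\<dots> \<le> L * ((p - a) / (2 * K))" by (intro mult_left_mono dens p L)
    \<comment> \<open>The proportion \<open>1 / (2 * K)\<close> in \<open>dens\<close> is chosen to
      absorb the Dini constant and leave the factor \<open>1 / 2\<close>.\<close>
    finally have sl: "K * ((w p - w a) / (p - a)) \<le> L / 2" using p K by (simp add: field_simps)
    obtain d where d: "d > 0" "\<And>x. p - d < x \<Longrightarrow> x < p \<Longrightarrow> a \<le> x \<Longrightarrow> w p - w x \<le> K * ((w p - w a) / (p - a)) * (p - x)"
      using dini[OF p] by blast
    show "\<exists>d>0. \<forall>x. p - d < x \<longrightarrow> x < p \<longrightarrow> a \<le> x \<longrightarrow> w p - w x \<le> L / 2 * (p - x)"
    proof (intro exI[of _ d] conjI allI impI d(1))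
      fix x assume x: "p - d < x" "x < p" "a \<le> x"
      have "w p - w x \<le> K * ((w p - w a) / (p - a)) * (p - x)" using x by (rule d(2))
      also have "\<dots> \<le> L / 2 * (p - x)" using sl x by (intro mult_right_mono) auto
      finally show "w p - w x \<le> L / 2 * (p - x)" .
    qed
  qed
  have "w t - w s \<le> L0 / 2 ^ n * (t - s)" if "a \<le> s" "s \<le> t" "t \<le> e" for n s t
    using that
  proof (induction n arbitrary: s t)
    case 0
    then show ?case using L0[of s t] by simp
  next
    case (Suc n)
    then show ?case using step[of "L0 / 2 ^ n" s t] L00 by (simp add: field_simps)
  qed
  then have le: "w e - w a \<le> L0 / 2 ^ n * (e - a)" for n using ae' by simp
  have "(\<lambda>n. L0 * (1 / 2) ^ n * (e - a)) \<longlonglongrightarrow> L0 * 0 * (e - a)"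
    by (intro tendsto_intros LIMSEQ_power_zero) simp
  then have "w e - w a \<le> L0 * 0 * (e - a)"
    by (rule LIMSEQ_le_const) (use le in \<open>auto simp: power_divide\<close>)
  then show ?thesis by simp
qed simp

section \<open>The slope of the maximizers\<close>

text \<open>Lebesgue differentiation of the indicator of the complement of \<open>Z\<close>, with
  cubes that have the base point as their lower corner; in dimension one these are intervals to its
  right.\<close>

lemma right_density_ae:
  assumes Z: "Z \<in> sets lebesgue"
  obtains N where "negligible N" "\<And>a \<epsilon>. a \<in> Z \<Longrightarrow> a \<notin> N \<Longrightarrow> \<epsilon> > 0 \<Longrightarrow>
     \<exists>d>0. \<forall>x. a < x \<longrightarrow> x < a + d \<longrightarrow> measure lebesgue ({a..x} - Z) \<le> \<epsilon> * (x - a)"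
proof -
  define h where "h x = (if x \<in> Z then 0 else 1 :: real)" for x
  have int: "(h has_integral measure lebesgue ({a..b} - Z)) {a..b}" for a b
  proof -
    have lm: "{a..b} - Z \<in> lmeasurable" using Z by (intro fmeasurable_Diff) auto
    have "((\<lambda>x. 1 :: real) has_integral measure lebesgue ({a..b} - Z)) ({a..b} - Z)"
      using lm by (simp add: lmeasure_integral lmeasurable_iff_integrable_on integrable_integral)
    then have "((\<lambda>x. if x \<in> {a..b} - Z then 1 else 0 :: real) has_integral measure lebesgue ({a..b} - Z)) {a..b}"
      by (subst has_integral_restrict) auto
    then show ?thesis by (rule has_integral_eq[rotated]) (auto simp: h_def)
  qed
  have "h integrable_on cbox a b" for a b using int[of a b] by (auto simp: integrable_on_def)
  then obtain N where N: "negligible N" "\<And>x e. x \<notin> N \<Longrightarrow> 0 < e \<Longrightarrow>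
      \<exists>d>0. \<forall>k. 0 < k \<and> k < d \<longrightarrow> norm (integral (cbox x (x + k *\<^sub>R One)) h /\<^sub>R k ^ DIM(real) - h x) < e"
    by (rule integrable_ccontinuous_explicit) blast
  show thesis
  proof (rule that[OF N(1)])
    fix a \<epsilon> :: real assume a: "a \<in> Z" "a \<notin> N" "\<epsilon> > 0"
    obtain d where d: "d > 0" "\<And>k. 0 < k \<Longrightarrow> k < d \<Longrightarrow> norm (integral (cbox a (a + k *\<^sub>R One)) h /\<^sub>R k ^ DIM(real) - h a) < \<epsilon>"
      using N(2)[OF a(2,3)] by blast
    show "\<exists>d>0. \<forall>x. a < x \<longrightarrow> x < a + d \<longrightarrow> measure lebesgue ({a..x} - Z) \<le> \<epsilon> * (x - a)"
    proof (intro exI conjI allI impI, rule d(1))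
      fix x assume x: "a < x" "x < a + d"
      have "\<bar>measure lebesgue ({a..x} - Z) / (x - a)\<bar> < \<epsilon>"
        using d(2)[of "x - a"] x a(1) integral_unique[OF int[of a x]] by (simp add: h_def divide_inverse mult.commute)
      then show "measure lebesgue ({a..x} - Z) \<le> \<epsilon> * (x - a)"
        using x by (simp add: pos_divide_less_eq abs_less_iff)
    qed
  qed
qed

text \<open>Arcs have their angles in \<open>{c..d}\<close>, inside an interval
  \<open>{l..r}\<close> where \<open>u1\<close> has a fixed sign. The margin \<open>\<eta>\<close>,
  compared with the width \<open>d - c\<close>, makes all of them short enough for their
  calibration; \<open>short\<close> makes \<open>uc\<close> injective on \<open>{l..r}\<close>, and
  \<open>cross\<close> makes the slope nondecreasing there.\<close>

locale arc_chart = regular_norm +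
  fixes l r b sg \<kappa> \<eta> c d :: real
  assumes b: "b > 0" and sg: "sg = 1 \<or> sg = -1" and u1b: "\<And>s. s \<in> {l..r} \<Longrightarrow> b \<le> sg * u1 s"
    and \<kappa>: "\<And>v. norm v \<le> \<kappa> * Nm v"
    and \<eta>: "\<eta> \<le> c - l" "\<eta> \<le> r - d" "\<kappa> * (d - c) < b * \<eta>" and cd: "c < d"
    and short: "r - l < 2 * area (polar_set (unit_ball_of Nm))"
    and cross: "\<And>s t. s \<in> {l..r} \<Longrightarrow> t \<in> {l..r} \<Longrightarrow> s < t \<Longrightarrow> 0 \<le> u1 s * u2 t - u2 s * u1 t"
begin

lemma \<kappa>_pos: "0 < \<kappa>"
proof -
  have "0 < \<kappa> * Nm (1, 0)" using \<kappa>[of "(1, 0)"] by (simp add: norm_Pair order_less_le_trans[OF zero_less_one])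
  then show ?thesis using Nm_ge_0[of "(1, 0)"] by (auto simp: zero_less_mult_iff)
qed

lemma chart_order: "l < c" "d < r"
proof -
  have "0 < b * \<eta>" using \<eta>(3) mult_pos_pos[OF \<kappa>_pos, of "d - c"] cd by linarith
  then have "\<eta> > 0" using b by (simp add: zero_less_mult_iff)
  then show "l < c" "d < r" using \<eta> by auto
qed

lemma sg_mult: "sg * x * (sg * y) = x * y" "\<bar>sg * x\<bar> = \<bar>x\<bar>"
  using sg by auto

lemma arc_minimizing_chart:
  assumes "\<rho> > 0" "\<phi> \<in> {c..d}" "\<psi> \<in> {c..d}" "\<phi> \<le> \<psi>"
  shows "\<phi> \<le> s \<Longrightarrow> s \<le> s' \<Longrightarrow> s' \<le> \<psi> \<Longrightarrow> sf_dist Nm (arc \<rho> \<phi> s) (arc \<rho> \<phi> s') = \<rho> * (s' - s)"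
    and "0 \<le> t \<Longrightarrow> t \<le> 1 \<Longrightarrow> sf_dist Nm (0, 0, 0) q = t * (\<rho> * (\<psi> - \<phi>)) \<Longrightarrow>
      sf_dist Nm q (arc \<rho> \<phi> \<psi>) = (1 - t) * (\<rho> * (\<psi> - \<phi>)) \<Longrightarrow> q = arc \<rho> \<phi> (\<phi> + t * (\<psi> - \<phi>))"
proof -
  have o: "l < \<phi>" "\<psi> < r" "\<eta> \<le> \<phi> - l" "\<eta> \<le> r - \<phi>" using assms chart_order \<eta>(1,2) by auto
  have "\<kappa> * (\<psi> - \<phi>) \<le> \<kappa> * (d - c)" using assms \<kappa>_pos by (intro mult_left_mono) auto
  then have k: "\<kappa> * (\<psi> - \<phi>) < b * \<eta>" using \<eta>(3) by linarith
  note M = arc_minimizing[OF o(1) assms(4) o(2) b sg u1b \<kappa> o(3,4) k assms(1)]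
  show "\<phi> \<le> s \<Longrightarrow> s \<le> s' \<Longrightarrow> s' \<le> \<psi> \<Longrightarrow> sf_dist Nm (arc \<rho> \<phi> s) (arc \<rho> \<phi> s') = \<rho> * (s' - s)" by (rule M(1))
  show "0 \<le> t \<Longrightarrow> t \<le> 1 \<Longrightarrow> sf_dist Nm (0, 0, 0) q = t * (\<rho> * (\<psi> - \<phi>)) \<Longrightarrow>
      sf_dist Nm q (arc \<rho> \<phi> \<psi>) = (1 - t) * (\<rho> * (\<psi> - \<phi>)) \<Longrightarrow> q = arc \<rho> \<phi> (\<phi> + t * (\<psi> - \<phi>))" by (rule M(2))
qed

lemma sf_dist_arc:
  assumes "\<rho> > 0" "\<phi> \<in> {c..d}" "\<psi> \<in> {c..d}" "\<phi> \<le> \<psi>"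
  shows "sf_dist Nm (0, 0, 0) (arc \<rho> \<phi> \<psi>) = \<rho> * (\<psi> - \<phi>)"
  using arc_minimizing_chart(1)[OF assms, of \<phi> \<psi>] assms(4) by (simp add: arc_start)

text \<open>Both arcs minimize between the same points, so uniqueness of intermediate points makes
  them agree at every time, and with them their velocities. The directions at times \<open>0\<close>
  and \<open>1\<close> determine the angles by \<open>uc_inj\<close>, and the common length then
  determines \<open>\<rho>\<close>.\<close>

lemma arc_inj:
  assumes 1: "\<rho> > 0" "\<phi> \<in> {c..d}" "\<psi> \<in> {c..d}" "\<phi> < \<psi>"
    and 2: "\<rho>' > 0" "\<phi>' \<in> {c..d}" "\<psi>' \<in> {c..d}" "\<phi>' < \<psi>'"
    and eq: "arc \<rho> \<phi> \<psi> = arc \<rho>' \<phi>' \<psi>'"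
  shows "\<rho> = \<rho>' \<and> \<phi> = \<phi>' \<and> \<psi> = \<psi>'"
proof -
  define L where "L = \<rho> * (\<psi> - \<phi>)"
  have L: "L = \<rho>' * (\<psi>' - \<phi>')"
    using sf_dist_arc[OF 1(1-3)] sf_dist_arc[OF 2(1-3)] 1(4) 2(4) eq by (simp add: L_def)
  have L0: "L > 0" using 1 by (simp add: L_def)
  have arcs: "arc \<rho>' \<phi>' (\<phi>' + t * (\<psi>' - \<phi>')) = arc \<rho> \<phi> (\<phi> + t * (\<psi> - \<phi>))" if t: "0 \<le> t" "t \<le> 1" for t
  proof (rule arc_minimizing_chart(2)[OF 1(1-3) less_imp_le[OF 1(4)] t])
    define s where "s = \<phi>' + t * (\<psi>' - \<phi>')"
    have "t * (\<psi>' - \<phi>') \<le> 1 * (\<psi>' - \<phi>')" using t 2 by (intro mult_right_mono) auto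
    then have "\<phi>' + t * (\<psi>' - \<phi>') \<le> \<phi>' + 1 * (\<psi>' - \<phi>')" by (rule add_left_mono)
    then have "s \<le> \<psi>'" unfolding s_def[symmetric] by simp
    moreover have "\<phi>' \<le> s" using t 2 by (simp add: s_def)
    ultimately have s: "\<phi>' \<le> s" "s \<le> \<psi>'" by auto
    note M = arc_minimizing_chart(1)[OF 2(1-3) less_imp_le[OF 2(4)]]
    have "sf_dist Nm (arc \<rho>' \<phi>' \<phi>') (arc \<rho>' \<phi>' s) = \<rho>' * (s - \<phi>')" by (rule M) (use s in auto)
    then show "sf_dist Nm (0, 0, 0) (arc \<rho>' \<phi>' (\<phi>' + t * (\<psi>' - \<phi>'))) = t * (\<rho> * (\<psi> - \<phi>))"
      unfolding L_def[symmetric] L by (simp add: arc_start s_def)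
    have "sf_dist Nm (arc \<rho>' \<phi>' s) (arc \<rho>' \<phi>' \<psi>') = \<rho>' * (\<psi>' - s)" by (rule M) (use s in auto)
    then show "sf_dist Nm (arc \<rho>' \<phi>' (\<phi>' + t * (\<psi>' - \<phi>'))) (arc \<rho> \<phi> \<psi>) = (1 - t) * (\<rho> * (\<psi> - \<phi>))"
      unfolding L_def[symmetric] L eq by (simp add: s_def algebra_simps)
  qed
  have Dx: "((\<lambda>t. \<rho> * (P2 (\<phi> + t * (\<psi> - \<phi>)) - P2 \<phi>)) has_real_derivative \<rho> * (\<psi> - \<phi>) * u1 (\<phi> + t * (\<psi> - \<phi>))) (at t within S)"
    and Dy: "((\<lambda>t. - \<rho> * (P1 (\<phi> + t * (\<psi> - \<phi>)) - P1 \<phi>)) has_real_derivative \<rho> * (\<psi> - \<phi>) * u2 (\<phi> + t * (\<psi> - \<phi>))) (at t within S)"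
    for \<rho> \<phi> \<psi> t S
  proof -
    have lin: "((\<lambda>t. \<phi> + t * (\<psi> - \<phi>)) has_real_derivative \<psi> - \<phi>) (at t)" by (auto intro!: derivative_eq_intros)
    have D1: "((\<lambda>t. \<rho> * (P2 (\<phi> + t * (\<psi> - \<phi>)) - P2 \<phi>)) has_real_derivative \<rho> * (u1 (\<phi> + t * (\<psi> - \<phi>)) * (\<psi> - \<phi>) - 0)) (at t)"
      by (intro DERIV_cmult DERIV_diff DERIV_const DERIV_chain2[OF DERIV_P(2) lin])
    show "((\<lambda>t. \<rho> * (P2 (\<phi> + t * (\<psi> - \<phi>)) - P2 \<phi>)) has_real_derivative \<rho> * (\<psi> - \<phi>) * u1 (\<phi> + t * (\<psi> - \<phi>))) (at t within S)"
      by (rule has_field_derivative_at_within[OF DERIV_cong[OF D1]]) simp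
    have D2: "((\<lambda>t. - \<rho> * (P1 (\<phi> + t * (\<psi> - \<phi>)) - P1 \<phi>)) has_real_derivative - \<rho> * (- u2 (\<phi> + t * (\<psi> - \<phi>)) * (\<psi> - \<phi>) - 0)) (at t)"
      by (intro DERIV_cmult DERIV_diff DERIV_const DERIV_chain2[OF DERIV_P(1) lin])
    show "((\<lambda>t. - \<rho> * (P1 (\<phi> + t * (\<psi> - \<phi>)) - P1 \<phi>)) has_real_derivative \<rho> * (\<psi> - \<phi>) * u2 (\<phi> + t * (\<psi> - \<phi>))) (at t within S)"
      by (rule has_field_derivative_at_within[OF DERIV_cong[OF D2]]) simp
  qed
  have uu: "uc (\<phi> + t * (\<psi> - \<phi>)) = uc (\<phi>' + t * (\<psi>' - \<phi>'))" if t: "t \<in> {0..1}" for t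
  proof -
    have e: "\<rho> * (P2 (\<phi> + t * (\<psi> - \<phi>)) - P2 \<phi>) = \<rho>' * (P2 (\<phi>' + t * (\<psi>' - \<phi>')) - P2 \<phi>')"
      "- \<rho> * (P1 (\<phi> + t * (\<psi> - \<phi>)) - P1 \<phi>) = - \<rho>' * (P1 (\<phi>' + t * (\<psi>' - \<phi>')) - P1 \<phi>')" if "t \<in> {0..1}" for t
      using arcs[of t] that by (simp_all add: arc_def)
    have "((\<lambda>t. \<rho> * (P2 (\<phi> + t * (\<psi> - \<phi>)) - P2 \<phi>)) has_real_derivative \<rho>' * (\<psi>' - \<phi>') * u1 (\<phi>' + t * (\<psi>' - \<phi>'))) (at t within {0..1})"
      by (rule has_field_derivative_transform_within[OF Dx zero_less_one t]) (use e in simp)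
    then have "\<rho> * (\<psi> - \<phi>) * u1 (\<phi> + t * (\<psi> - \<phi>)) = \<rho>' * (\<psi>' - \<phi>') * u1 (\<phi>' + t * (\<psi>' - \<phi>'))"
      using vector_derivative_unique_within_closed_interval[of 0 1 t] Dx t
      unfolding has_real_derivative_iff_has_vector_derivative by (metis box_real(2) zero_less_one)
    then have 3: "u1 (\<phi> + t * (\<psi> - \<phi>)) = u1 (\<phi>' + t * (\<psi>' - \<phi>'))" using L0 unfolding L_def[symmetric] L[symmetric] by simp
    have "((\<lambda>t. - \<rho> * (P1 (\<phi> + t * (\<psi> - \<phi>)) - P1 \<phi>)) has_real_derivative \<rho>' * (\<psi>' - \<phi>') * u2 (\<phi>' + t * (\<psi>' - \<phi>'))) (at t within {0..1})"
      by (rule has_field_derivative_transform_within[OF Dy zero_less_one t]) (use e in simp)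
    then have "\<rho> * (\<psi> - \<phi>) * u2 (\<phi> + t * (\<psi> - \<phi>)) = \<rho>' * (\<psi>' - \<phi>') * u2 (\<phi>' + t * (\<psi>' - \<phi>'))"
      using vector_derivative_unique_within_closed_interval[of 0 1 t] Dy t
      unfolding has_real_derivative_iff_has_vector_derivative by (metis box_real(2) zero_less_one)
    then have 4: "u2 (\<phi> + t * (\<psi> - \<phi>)) = u2 (\<phi>' + t * (\<psi>' - \<phi>'))" using L0 unfolding L_def[symmetric] L[symmetric] by simp
    show ?thesis using 3 4 by (simp add: u1_def u2_def prod_eq_iff)
  qed
  have "\<bar>\<phi> - \<phi>'\<bar> < 2 * area (polar_set (unit_ball_of Nm))" "\<bar>\<psi> - \<psi>'\<bar> < 2 * area (polar_set (unit_ball_of Nm))"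
    using 1 2 short chart_order by auto
  then have "\<phi> = \<phi>'" "\<psi> = \<psi>'" using uu[of 0] uu[of 1] by (auto intro: uc_inj)
  then show ?thesis using L L_def 1 by simp
qed

definition slope where "slope s = u2 s / u1 s"

lemma u1_nonzero: "s \<in> {l..r} \<Longrightarrow> u1 s \<noteq> 0"
  using u1b[of s] b by auto

lemma u1_mult_pos: "s \<in> {l..r} \<Longrightarrow> t \<in> {l..r} \<Longrightarrow> b * b \<le> u1 s * u1 t"
  using mult_mono[of b "sg * u1 s" b "sg * u1 t"] u1b[of s] u1b[of t] b sg_mult(1)[of "u1 s" "u1 t"] by auto

lemma slope_diff:
  assumes "s \<in> {l..r}" "t \<in> {l..r}"
  shows "slope t - slope s = (u1 s * u2 t - u2 s * u1 t) / (u1 s * u1 t)"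
  using u1_nonzero[OF assms(1)] u1_nonzero[OF assms(2)] by (simp add: slope_def field_simps)

lemma slope_mono:
  assumes "s \<in> {l..r}" "t \<in> {l..r}" "s \<le> t"
  shows "slope s \<le> slope t"
proof (cases "s = t")
  case False
  then have "0 \<le> (u1 s * u2 t - u2 s * u1 t) / (u1 s * u1 t)"
    using cross[OF assms(1,2)] assms(3) u1_mult_pos[OF assms(1,2)] mult_pos_pos[OF b b] by (intro divide_nonneg_nonneg) auto
  then show ?thesis using slope_diff[OF assms(1,2)] by linarith
qed simp

text \<open>As \<open>u1\<close> keeps its sign, equal slopes put both maximizers on one ray and
  hence at the same unit vector.\<close>

lemma slope_inj:
  assumes st: "s \<in> {l..r}" "t \<in> {l..r}" and eq: "slope s = slope t"
  shows "s = t"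
proof -
  define k where "k = u1 s / u1 t"
  have nz: "u1 s \<noteq> 0" "u1 t \<noteq> 0" using u1_nonzero st by auto
  have "u1 s * u1 t > 0" using u1_mult_pos[OF st] mult_pos_pos[OF b b] by linarith
  then have k: "k > 0" by (auto simp: k_def zero_less_mult_iff zero_less_divide_iff)
  have "u1 s = k * u1 t" "u2 s = k * u2 t" using eq nz by (auto simp: slope_def k_def field_simps)
  then have "uc s = k *\<^sub>R uc t" by (simp add: u1_def u2_def prod_eq_iff)
  moreover from this have "Nm (uc s) = \<bar>k\<bar> * Nm (uc t)" by (simp only: Nm_scale)
  then have "k = 1" using k by (simp add: Nm_uc)
  ultimately have "uc s = uc t" by simp
  then show "s = t" by (rule uc_inj) (use st short in auto)
qed

lemma slope_strict_mono: "s \<in> {l..r} \<Longrightarrow> t \<in> {l..r} \<Longrightarrow> s < t \<Longrightarrow> slope s < slope t"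
  using slope_mono[of s t] slope_inj[of s t] by force

lemma u_le_\<kappa>: "\<bar>u1 s\<bar> \<le> \<kappa>" "\<bar>u2 s\<bar> \<le> \<kappa>"
  using R2_norm_bounds(1,2)[of "uc s"] \<kappa>[of "uc s"] by (auto simp: u1_def u2_def Nm_uc)

text \<open>Carries the Lipschitz bound, and the stationarity on \<open>Zset Nm\<close>, from
  \<open>uc\<close> over to the slope.\<close>

lemma slope_diff_le:
  assumes "s \<in> {l..r}" "t \<in> {l..r}"
  shows "\<bar>slope t - slope s\<bar> \<le> 2 * \<kappa> / (b * b) * norm (uc t - uc s)"
proof -
  define n where "n = norm (uc t - uc s)"
  have n: "\<bar>u1 t - u1 s\<bar> \<le> n" "\<bar>u2 t - u2 s\<bar> \<le> n" "n \<ge> 0"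
    using R2_norm_bounds(1,2)[of "uc t - uc s"] by (auto simp: n_def u1_def u2_def)
  have "u1 s * u2 t - u2 s * u1 t = u1 s * (u2 t - u2 s) - u2 s * (u1 t - u1 s)" by (simp add: algebra_simps)
  then have "\<bar>u1 s * u2 t - u2 s * u1 t\<bar> \<le> \<bar>u1 s\<bar> * \<bar>u2 t - u2 s\<bar> + \<bar>u2 s\<bar> * \<bar>u1 t - u1 s\<bar>"
    using abs_triangle_ineq4 by (metis abs_mult)
  also have "\<dots> \<le> \<kappa> * n + \<kappa> * n" using u_le_\<kappa> n \<kappa>_pos by (intro add_mono mult_mono) auto
  finally have "\<bar>u1 s * u2 t - u2 s * u1 t\<bar> \<le> 2 * \<kappa> * n" by simp
  moreover have "b * b \<le> \<bar>u1 s * u1 t\<bar>" using u1_mult_pos[OF assms] by simp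
  ultimately have "\<bar>u1 s * u2 t - u2 s * u1 t\<bar> / \<bar>u1 s * u1 t\<bar> \<le> 2 * \<kappa> * n / (b * b)"
    using b n(3) \<kappa>_pos by (intro frac_le) auto
  then show ?thesis unfolding slope_diff[OF assms] abs_divide n_def[symmetric] by simp
qed

text \<open>\<open>bulge \<phi>\<close> is the height of the arc above its initial tangent; \<open>bulge_int \<phi>\<close> is the integral of
  \<open>bulge \<phi>\<close> along the first coordinate.\<close>

definition bulge where "bulge \<phi> s = - (P1 s - P1 \<phi>) - slope \<phi> * (P2 s - P2 \<phi>)"
definition bulge_int where
  "bulge_int \<phi> s = ((P2 s - P2 \<phi>) * bulge \<phi> s - (s - \<phi> - (P1 \<phi> * P2 s - P2 \<phi> * P1 s))) / 2"

lemma DERIV_bulge: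
  assumes "s \<in> {l..r}"
  shows "(bulge \<phi> has_real_derivative u1 s * (slope s - slope \<phi>)) (at s)"
    and "(bulge_int \<phi> has_real_derivative u1 s * bulge \<phi> s) (at s)"
proof -
  have "u2 s = u1 s * slope s" using u1_nonzero[OF assms] by (simp add: slope_def)
  have "(bulge \<phi> has_real_derivative - (- u2 s - 0) - slope \<phi> * (u1 s - 0)) (at s)"
    unfolding bulge_def[abs_def] by (intro DERIV_diff DERIV_minus DERIV_cmult DERIV_P DERIV_const)
  then show D: "(bulge \<phi> has_real_derivative u1 s * (slope s - slope \<phi>)) (at s)"
    by (rule DERIV_cong) (simp add: \<open>u2 s = _\<close> algebra_simps)
  have "(bulge_int \<phi> has_real_derivative (((u1 s - 0) * bulge \<phi> s + u1 s * (slope s - slope \<phi>) * (P2 s - P2 \<phi>))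
      - (1 - 0 - (P1 \<phi> * u1 s - P2 \<phi> * - u2 s))) / 2) (at s)"
    unfolding bulge_int_def[abs_def]
    by (intro DERIV_cdivide DERIV_diff DERIV_mult DERIV_cmult DERIV_P DERIV_const DERIV_ident D)
  moreover have "1 - 0 - (P1 \<phi> * u1 s - P2 \<phi> * - u2 s) = (P1 s * u1 s + P2 s * u2 s) - P1 \<phi> * u1 s - P2 \<phi> * u2 s"
    unfolding P_u by simp
  ultimately show "(bulge_int \<phi> has_real_derivative u1 s * bulge \<phi> s) (at s)"
    by (elim DERIV_cong) (simp add: bulge_def \<open>u2 s = _\<close> field_simps)
qed

lemma bulge_start: "bulge \<phi> \<phi> = 0" "bulge_int \<phi> \<phi> = 0"
  by (simp_all add: bulge_def bulge_int_def algebra_simps)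

text \<open>Positivity comes from the strict growth of the slope; \<open>sg\<close> compensates for
  the direction in which the first coordinate is traversed.\<close>

lemma bulge_pos:
  assumes "\<phi> \<in> {l..r}" "s \<in> {l..r}" "\<phi> < s"
  shows "0 < sg * bulge \<phi> s"
proof -
  have I: "x \<in> {l..r}" if "\<phi> \<le> x" "x \<le> s" for x using that assms by auto
  have "(\<lambda>x. sg * bulge \<phi> x) \<phi> < (\<lambda>x. sg * bulge \<phi> x) s"
  proof (rule DERIV_pos_imp_increasing_open[OF assms(3)])
    fix x assume x: "\<phi> < x" "x < s"
    have "((\<lambda>x. sg * bulge \<phi> x) has_real_derivative sg * (u1 x * (slope x - slope \<phi>))) (at x)"
      using x by (intro DERIV_cmult DERIV_bulge I) auto
    moreover have "0 < sg * u1 x * (slope x - slope \<phi>)"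
    proof (rule mult_pos_pos)
      show "0 < sg * u1 x" using u1b[OF I, of x] b x by linarith
      show "0 < slope x - slope \<phi>" using slope_strict_mono[OF assms(1) I[of x]] x by simp
    qed
    ultimately show "\<exists>y. ((\<lambda>x. sg * bulge \<phi> x) has_real_derivative y) (at x) \<and> 0 < y"
      by (intro exI[of _ "sg * (u1 x * (slope x - slope \<phi>))"]) (simp add: mult.assoc)
  next
    show "continuous_on {\<phi>..s} (\<lambda>x. sg * bulge \<phi> x)"
      using I by (intro continuous_intros DERIV_continuous_on[OF has_field_derivative_at_within[OF DERIV_bulge(1)]]) auto
  qed
  then show ?thesis by (simp add: bulge_start)
qed

lemma u1_bulge_nonneg:
  assumes "\<phi> \<in> {l..r}" "s \<in> {l..r}" "\<phi> \<le> s"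
  shows "0 \<le> u1 s * bulge \<phi> s" "\<phi> < s \<Longrightarrow> 0 < u1 s * bulge \<phi> s"
proof -
  have *: "0 < u1 s * bulge \<phi> s" if "\<phi> < s"
    using mult_pos_pos[of "sg * u1 s" "sg * bulge \<phi> s"] bulge_pos[OF assms(1,2) that] u1b[OF assms(2)] b
    by (simp add: sg_mult)
  then show "\<phi> < s \<Longrightarrow> 0 < u1 s * bulge \<phi> s" .
  show "0 \<le> u1 s * bulge \<phi> s" using * assms(3) by (cases "\<phi> = s") (auto simp: bulge_start)
qed

lemma bulge_int_pos:
  assumes "\<phi> \<in> {l..r}" "s \<in> {l..r}" "\<phi> < s"
  shows "0 < bulge_int \<phi> s"
proof -
  have I: "x \<in> {l..r}" if "\<phi> \<le> x" "x \<le> s" for x using that assms by auto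
  have "bulge_int \<phi> \<phi> < bulge_int \<phi> s"
  proof (rule DERIV_pos_imp_increasing_open[OF assms(3)])
    fix x assume x: "\<phi> < x" "x < s"
    then show "\<exists>y. (bulge_int \<phi> has_real_derivative y) (at x) \<and> 0 < y"
      by (intro exI[of _ "u1 x * bulge \<phi> x"] conjI DERIV_bulge(2) u1_bulge_nonneg(2) assms(1) I) auto
  next
    show "continuous_on {\<phi>..s} (bulge_int \<phi>)"
      using I by (intro DERIV_continuous_on[OF has_field_derivative_at_within[OF DERIV_bulge(2)]]) auto
  qed
  then show ?thesis by (simp add: bulge_start)
qed

definition reduced_jac where "reduced_jac \<phi> s = 2 * (slope s - slope \<phi>) * bulge_int \<phi> s - (bulge \<phi> s)\<^sup>2"

text \<open>The factor \<open>u1 \<phi> * u1 s\<close> is at least \<open>b * b\<close>, so the sign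
  and the growth of the Jacobian are questions about \<open>reduced_jac\<close>.\<close>

lemma jac_eq:
  assumes "\<phi> \<in> {l..r}" "s \<in> {l..r}"
  shows "jac \<phi> s = u1 \<phi> * u1 s * reduced_jac \<phi> s"
proof -
  have u2: "u2 s = u1 s * slope s" "u2 \<phi> = u1 \<phi> * slope \<phi>" using u1_nonzero assms by (auto simp: slope_def)
  show ?thesis unfolding jac_def reduced_jac_def bulge_int_def bulge_def u2
    by (simp add: power2_eq_square field_simps)
qed

text \<open>With the final slope frozen, \<open>2 * W * bulge_int - bulge\<^sup>2\<close> is nondecreasing along the arc.\<close>

lemma reduced_jac_ge:
  assumes "\<phi> \<in> {l..r}" "s \<in> {l..r}" "\<phi> \<le> x" "x \<le> s"
  shows "2 * (slope s - slope \<phi>) * bulge_int \<phi> x - (bulge \<phi> x)\<^sup>2 \<le> reduced_jac \<phi> s"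
proof -
  have I: "z \<in> {l..r}" if "x \<le> z" "z \<le> s" for z using that assms by auto
  have "(\<lambda>z. 2 * (slope s - slope \<phi>) * bulge_int \<phi> z - (bulge \<phi> z)\<^sup>2) x \<le> (\<lambda>z. 2 * (slope s - slope \<phi>) * bulge_int \<phi> z - (bulge \<phi> z)\<^sup>2) s"
  proof (rule DERIV_nonneg_imp_nondecreasing[OF assms(4)])
    fix z assume z: "x \<le> z" "z \<le> s"
    have D: "((\<lambda>z. 2 * (slope s - slope \<phi>) * bulge_int \<phi> z - bulge \<phi> z * bulge \<phi> z) has_real_derivative
       2 * (slope s - slope \<phi>) * (u1 z * bulge \<phi> z) - (u1 z * (slope z - slope \<phi>) * bulge \<phi> z + u1 z * (slope z - slope \<phi>) * bulge \<phi> z)) (at z)"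
      by (intro DERIV_diff DERIV_cmult DERIV_mult DERIV_bulge I z)
    have eq: "2 * (slope s - slope \<phi>) * (u1 z * bulge \<phi> z) - (u1 z * (slope z - slope \<phi>) * bulge \<phi> z + u1 z * (slope z - slope \<phi>) * bulge \<phi> z)
       = 2 * (u1 z * bulge \<phi> z) * (slope s - slope z)" by (simp add: algebra_simps)
    have nn: "0 \<le> 2 * (u1 z * bulge \<phi> z) * (slope s - slope z)"
    proof (rule mult_nonneg_nonneg)
      show "0 \<le> 2 * (u1 z * bulge \<phi> z)" using u1_bulge_nonneg(1)[OF assms(1) I[OF z]] z assms(3) by simp
      show "0 \<le> slope s - slope z" using slope_mono[OF I[OF z] assms(2)] z by simp
    qed
    show "\<exists>y. ((\<lambda>z. 2 * (slope s - slope \<phi>) * bulge_int \<phi> z - (bulge \<phi> z)\<^sup>2) has_real_derivative y) (at z) \<and> 0 \<le> y"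
      unfolding power2_eq_square by (rule exI, rule conjI, rule D[unfolded eq], rule nn)
  qed
  then show ?thesis by (simp add: reduced_jac_def)
qed

lemma reduced_jac_nonneg: "\<phi> \<in> {l..r} \<Longrightarrow> s \<in> {l..r} \<Longrightarrow> \<phi> \<le> s \<Longrightarrow> 0 \<le> reduced_jac \<phi> s"
  using reduced_jac_ge[of \<phi> s \<phi>] by (simp add: bulge_start)

lemma jac_nonneg: "\<phi> \<in> {l..r} \<Longrightarrow> s \<in> {l..r} \<Longrightarrow> \<phi> \<le> s \<Longrightarrow> 0 \<le> jac \<phi> s"
  unfolding jac_eq using u1_mult_pos[of \<phi> s] mult_pos_pos[OF b b]
  by (intro mult_nonneg_nonneg[OF _ reduced_jac_nonneg]) auto

text \<open>A failure at \<open>(1, \<phi>, \<psi>)\<close> would persist with a margin on a small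
  box of parameters. The end points of that box would fill at least \<open>m\<close> times its
  volume and the \<open>t\<close>-intermediate points at most \<open>M\<close> times, contradicting
  \<open>MCP_intermediate_measure\<close>.\<close>

theorem MCP_jac:
  assumes MCP: "MCP (sf_dist Nm) lborel 0 N" and N: "1 < N" and t: "0 < t" "t < 1"
    and \<phi>\<psi>: "c < \<phi>" "\<phi> < \<psi>" "\<psi> < d"
  shows "t powr N * jac \<phi> \<psi> \<le> t * jac \<phi> (\<phi> + t * (\<psi> - \<phi>))"
proof (rule ccontr)
  define f where "f t p = t * (fst p) ^ 3 * jac (fst (snd p)) (par t p)" for t and p :: R3
  define p0 :: R3 where "p0 = (1, \<phi>, \<psi>)"
  define X where "X = f t p0"
  define Y where "Y = f 1 p0"
  have XY: "X = t * jac \<phi> (\<phi> + t * (\<psi> - \<phi>))" "Y = jac \<phi> \<psi>" by (simp_all add: X_def Y_def f_def p0_def par_def)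
  assume "\<not> ?thesis"
  then have less: "X < t powr N * Y" by (simp add: XY)
  have tN: "t powr N > 0" using t by simp
  \<comment> \<open>The strict inequality leaves room for \<open>X < M\<close> and
    \<open>m < Y\<close> with \<open>M < t powr N * m\<close>; these are open conditions on the
    parameters.\<close>
  obtain M where M: "X < M" "M < t powr N * Y" using dense[OF less] by blast
  then have "M / t powr N < Y" using tN by (simp add: pos_divide_less_eq mult.commute)
  then obtain m where m: "M / t powr N < m" "m < Y" using dense by blast
  have cf: "continuous_on UNIV (f t)" for t
    unfolding f_def par_def by (intro continuous_intros continuous_on_jac)
  define U where "U = {p. f t p < M \<and> m < f 1 p \<and> 0 < fst p \<and> c < fst (snd p) \<and> fst (snd p) < snd (snd p) \<and> snd (snd p) < d}"
  have "open U" unfolding U_def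
    by (intro open_Collect_conj open_Collect_less cf continuous_intros)
  moreover have "p0 \<in> U" using M m \<phi>\<psi> by (simp add: U_def X_def[symmetric] Y_def[symmetric]) (simp add: p0_def)
  ultimately obtain lo hi where box: "cbox lo hi \<subseteq> U" "p0 \<in> box lo hi"
    using open_contains_cbox by metis
  define S where "S = cbox lo hi"
  have SU: "f t p < M" "m < f 1 p" "0 < fst p" "c < fst (snd p)" "fst (snd p) < snd (snd p)" "snd (snd p) < d" if "p \<in> S" for p
    using box that unfolding S_def U_def by blast+
  have S: "compact S" "0 < measure lborel S"
    using box(2) content_pos_lt_eq[of lo hi] by (auto simp: S_def mem_box intro: less_trans)
  have par01: "fst (snd p) \<le> par t p" "par t p \<le> snd (snd p)" if "p \<in> S" for p
  proof -
    have "t * (snd (snd p) - fst (snd p)) \<le> 1 * (snd (snd p) - fst (snd p))"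
      using t SU(5)[OF that] by (intro mult_right_mono) auto
    then have "fst (snd p) + t * (snd (snd p) - fst (snd p)) \<le> fst (snd p) + 1 * (snd (snd p) - fst (snd p))"
      by (rule add_left_mono)
    then show "par t p \<le> snd (snd p)" unfolding par_def by (simp only: mult_1_left add_diff_cancel_left' diff_add_cancel add_diff_eq)
    show "fst (snd p) \<le> par t p" using t SU(5)[OF that] by (simp add: par_def)
  qed
  define g where "g t p = arc (fst p) (fst (snd p)) (par t p)" for t and p :: R3
  have g1: "g 1 p = arc (fst p) (fst (snd p)) (snd (snd p))" for p by (simp add: g_def par_def)
  note der = arc_has_derivative[folded g_def]
  have cg: "compact (g t ` S)" for t
    by (intro compact_continuous_image S(1) continuous_at_imp_continuous_on ballI has_derivative_continuous[OF der])
  have inj: "inj_on (g 1) S"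
  proof (rule inj_onI)
    fix p q assume pq: "p \<in> S" "q \<in> S" "g 1 p = g 1 q"
    have "fst p = fst q \<and> fst (snd p) = fst (snd q) \<and> snd (snd p) = snd (snd q)"
      using SU(3-6)[OF pq(1)] SU(3-6)[OF pq(2)] pq(3) unfolding g1 by (intro arc_inj) auto
    then show "p = q" by (simp add: prod_eq_iff)
  qed
  have A: "m * measure lborel S \<le> measure lborel (g 1 ` S)"
  proof (rule measure_image_R3(1)[OF S(1) der inj])
    fix p assume "p \<in> S"
    then show "m \<le> \<bar>det3 (row1 1 p) (row2 1 p) (row3 1 p)\<bar>"
      using SU(2)[of p] abs_ge_self[of "f 1 p"] unfolding det3_rows f_def[symmetric] by linarith
  qed
  have B: "measure lborel (g t ` S) \<le> M * measure lborel S"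
  proof (rule measure_image_R3(2)[OF S(1) der])
    show "continuous_on S (\<lambda>p. det3 (row1 t p) (row2 t p) (row3 t p))"
      unfolding det3_rows f_def[symmetric] using cf continuous_on_subset by blast
    fix p assume p: "p \<in> S"
    have "0 \<le> f t p"
      unfolding f_def using t SU(3-6)[OF p] par01[OF p] chart_order by (intro mult_nonneg_nonneg jac_nonneg) auto
    then show "\<bar>det3 (row1 t p) (row2 t p) (row3 t p)\<bar> \<le> M"
      using SU(1)[OF p] unfolding det3_rows f_def[symmetric] by simp
  qed
  \<comment> \<open>This yields \<open>m > 0\<close>, so the set of end points has positive volume
    and may serve as target set.\<close>
  have "0 \<le> X"
    unfolding X_def f_def using t par01[of p0] box \<phi>\<psi> chart_order S_def
    by (intro mult_nonneg_nonneg jac_nonneg) (auto simp: p0_def box_subset_cbox[THEN subsetD])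
  then have "0 < M / t powr N" using M tN by simp
  then have m0: "0 < m" using m by linarith
  have "t powr N * measure lborel (g 1 ` S) \<le> measure lborel (g t ` S)"
  proof (rule MCP_intermediate_measure[OF MCP N t(1) _ cg _ cg])
    show "0 < measure lborel (g 1 ` S)" using A mult_pos_pos[OF m0 S(2)] by linarith
    fix y q assume y: "y \<in> g 1 ` S" and q: "sf_dist Nm (0, 0, 0) q = t * sf_dist Nm (0, 0, 0) y"
      "sf_dist Nm q y = (1 - t) * sf_dist Nm (0, 0, 0) y"
    then obtain p where p: "p \<in> S" "y = g 1 p" by blast
    note pp = SU(3-6)[OF p(1)]
    have dy: "sf_dist Nm (0, 0, 0) y = fst p * (snd (snd p) - fst (snd p))"
      unfolding p(2) g1 using pp by (intro sf_dist_arc) auto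
    have "q = arc (fst p) (fst (snd p)) (fst (snd p) + t * (snd (snd p) - fst (snd p)))"
      using q pp t unfolding dy unfolding p(2) g1 by (intro arc_minimizing_chart(2)) auto
    then show "q \<in> g t ` S" using p(1) by (auto simp: g_def par_def)
  qed (use t in simp)
  then have "t powr N * (m * measure lborel S) \<le> M * measure lborel S"
    using mult_left_mono[OF A, of "t powr N"] B tN by linarith
  then have "t powr N * m \<le> M" using S(2) by (simp add: mult.assoc[symmetric])
  then show False using m(1) tN by (simp add: pos_divide_less_eq mult.commute)
qed

lemma slope_Dini:
  assumes MCP: "MCP (sf_dist Nm) lborel 0 N" and N: "1 < N"
  obtains K where "K > 0" "\<And>\<phi> \<psi>. c < \<phi> \<Longrightarrow> \<phi> < \<psi> \<Longrightarrow> \<psi> < d \<Longrightarrow>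
    \<exists>\<delta>>0. \<forall>x. \<psi> - \<delta> < x \<longrightarrow> x < \<psi> \<longrightarrow> \<phi> \<le> x \<longrightarrow> slope \<psi> - slope x \<le> K * ((slope \<psi> - slope \<phi>) / (\<psi> - \<phi>)) * (\<psi> - x)"
proof -
  obtain L where L: "L > 0" "\<And>s t. \<bar>u1 s - u1 t\<bar> \<le> L * \<bar>s - t\<bar>"
    using uc_Lipschitz unfolding u1_def by metis
  \<comment> \<open>An integer exponent above \<open>N\<close> makes the Bernoulli inequality
    available.\<close>
  obtain n :: nat where n: "N < n" using reals_Archimedean2 by blast
  \<comment> \<open>\<open>L * (d - c)\<close> accounts for the change of \<open>u1\<close> between
    \<open>x\<close> and \<open>\<psi>\<close>, and \<open>n * \<kappa>\<close> for the loss
    \<open>1 - t ^ n\<close>; both are uniform over the chart.\<close>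
  define C where "C = L * (d - c) + n * \<kappa>"
  have C: "C > 0" using L cd \<kappa>_pos by (simp add: C_def add_pos_nonneg)
  show thesis
  proof (rule that[of "2 * C / b"])
    show "2 * C / b > 0" using C b by simp
    fix \<phi> \<psi> assume \<phi>\<psi>: "c < \<phi>" "\<phi> < \<psi>" "\<psi> < d"
    have I: "\<phi> \<in> {l..r}" "\<psi> \<in> {l..r}" using \<phi>\<psi> chart_order by auto
    define Y where "Y = bulge_int \<phi>"
    define F where "F = reduced_jac \<phi>"
    define B where "B s = sg * u1 s" for s
    define W where "W = slope \<psi> - slope \<phi>"
    have W: "W > 0" using slope_strict_mono[OF I \<phi>\<psi>(2)] by (simp add: W_def)
    have Y\<psi>: "Y \<psi> > 0" using bulge_int_pos[OF I \<phi>\<psi>(2)] by (simp add: Y_def)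
    \<comment> \<open>A Dini bound concerns only \<open>x\<close> close to \<open>\<psi>\<close>, so
      \<open>Y x\<close> may replace \<open>Y \<psi>\<close> at the price of the \<open>2\<close> in
      \<open>2 * C / b\<close>.\<close>
    have "isCont Y \<psi>" unfolding Y_def by (rule DERIV_isCont[OF DERIV_bulge(2)[OF I(2)]])
    then have "\<forall>\<^sub>F x in at \<psi>. Y \<psi> / 2 < Y x"
      using Y\<psi> by (intro order_tendstoD(1)[where y = "Y \<psi>"]) (auto simp: isCont_def)
    then obtain \<delta> where \<delta>: "\<delta> > 0" "\<And>x. x \<noteq> \<psi> \<Longrightarrow> dist x \<psi> < \<delta> \<Longrightarrow> Y \<psi> / 2 < Y x"
      unfolding eventually_at by blast
    show "\<exists>\<delta>>0. \<forall>x. \<psi> - \<delta> < x \<longrightarrow> x < \<psi> \<longrightarrow> \<phi> \<le> x \<longrightarrow> slope \<psi> - slope x \<le> 2 * C / b * ((slope \<psi> - slope \<phi>) / (\<psi> - \<phi>)) * (\<psi> - x)"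
    proof (intro exI conjI allI impI)
      show "0 < min \<delta> (\<psi> - \<phi>)" using \<delta> \<phi>\<psi> by simp
      fix x assume x: "\<psi> - min \<delta> (\<psi> - \<phi>) < x" "x < \<psi>" "\<phi> \<le> x"
      then have x': "\<phi> < x" by auto
      have Ix: "x \<in> {l..r}" using x I by auto
      have Yx: "Y \<psi> \<le> 2 * Y x" "Y x > 0" 
      proof -
        have "dist x \<psi> < \<delta>" using x by (auto simp: dist_real_def)
        then have "Y \<psi> / 2 < Y x" using x by (intro \<delta>(2)) auto
        then show "Y \<psi> \<le> 2 * Y x" "Y x > 0" using Y\<psi> by auto
      qed
      define t where "t = (x - \<phi>) / (\<psi> - \<phi>)"
      have t: "0 < t" "t < 1" "\<phi> + t * (\<psi> - \<phi>) = x" using x x' \<phi>\<psi> by (auto simp: t_def field_simps)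
      have t1: "(1 - t) * (\<psi> - \<phi>) = \<psi> - x" using t(3) by (simp add: algebra_simps)
      have Bp: "b \<le> B s" "B s \<le> \<kappa>" if "s \<in> {l..r}" for s
        using u1b[OF that] u_le_\<kappa>(1)[of s] sg_mult(2)[of "u1 s"] by (auto simp: B_def)
      have F0: "0 \<le> F \<psi>" unfolding F_def by (rule reduced_jac_nonneg[OF I]) (use \<phi>\<psi> in simp)
      have "t powr N * (u1 \<phi> * u1 \<psi> * F \<psi>) \<le> t * (u1 \<phi> * u1 x * F x)"
        using MCP_jac[OF MCP N t(1,2) \<phi>\<psi>] unfolding t(3) jac_eq[OF I] jac_eq[OF I(1) Ix] F_def .
      then have "B \<phi> * (t powr N * (B \<psi> * F \<psi>)) \<le> B \<phi> * (t * (B x * F x))"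
        using sg by (auto simp: B_def mult_ac)
      then have 1: "t powr N * (B \<psi> * F \<psi>) \<le> t * (B x * F x)" using Bp[OF I(1)] b by simp
      have BF: "0 \<le> B \<psi> * F \<psi>" using Bp[OF I(2)] b F0 by simp
      \<comment> \<open>One factor \<open>t\<close> is split off in order to cancel the factor
        \<open>t\<close> on the right of \<open>MCP_jac\<close>.\<close>
      have "t * t ^ n \<le> t powr N"
      proof -
        have "t * t ^ n = t powr real (Suc n)" using t by (simp add: powr_realpow[symmetric] powr_add)
        also have "\<dots> \<le> t powr N" using t n by (intro powr_mono') auto
        finally show ?thesis .
      qed
      from mult_right_mono[OF this BF] 1 have "t * (t ^ n * (B \<psi> * F \<psi>)) \<le> t * (B x * F x)" by (simp add: mult.assoc)
      then have 2: "t ^ n * (B \<psi> * F \<psi>) \<le> B x * F x" using t by simp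
      have "1 + real n * (t - 1) \<le> t ^ n" using Bernoulli_inequality[of "t - 1" n] t by simp
      from mult_right_mono[OF this BF] 2 have 3: "(1 + real n * (t - 1)) * (B \<psi> * F \<psi>) \<le> B x * F x" by linarith
      have 4: "F x + 2 * (slope \<psi> - slope x) * Y x \<le> F \<psi>"
        using reduced_jac_ge[OF I, of x] x by (simp add: F_def Y_def reduced_jac_def algebra_simps)
      have 5: "F \<psi> \<le> 2 * W * Y \<psi>" by (simp add: F_def reduced_jac_def W_def Y_def)
      have "B x - B \<psi> \<le> L * (\<psi> - x)"
        using L(2)[of x \<psi>] sg_mult(2)[of "u1 x - u1 \<psi>"] x by (simp add: B_def algebra_simps abs_le_iff)
      also have "\<dots> = (1 - t) * (L * (\<psi> - \<phi>))" unfolding t1[symmetric] by simp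
      also have "\<dots> \<le> (1 - t) * (L * (d - c))" using t L \<phi>\<psi> by (intro mult_left_mono) auto
      finally have 6: "B x - B \<psi> \<le> (1 - t) * (L * (d - c))" .
      have "(1 - t) * real n * B \<psi> \<le> (1 - t) * real n * \<kappa>" using t Bp(2)[OF I(2)] by (intro mult_left_mono) auto
      then have "(B x - B \<psi>) + (1 - t) * real n * B \<psi> \<le> (1 - t) * C" using 6 by (simp add: C_def algebra_simps)
      from mult_right_mono[OF this F0] have 7: "((B x - B \<psi>) + (1 - t) * real n * B \<psi>) * F \<psi> \<le> (1 - t) * C * F \<psi>" .
      have "B x * (F \<psi> - F x) \<le> (1 - t) * C * F \<psi>" using 3 7 by (simp add: algebra_simps)
      moreover have "B x * (2 * (slope \<psi> - slope x) * Y x) \<le> B x * (F \<psi> - F x)"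
        using 4 Bp[OF Ix] b by (intro mult_left_mono) auto
      moreover have sx: "0 \<le> slope \<psi> - slope x" using slope_mono[OF Ix I(2)] x by simp
      then have "b * (2 * (slope \<psi> - slope x) * Y x) \<le> B x * (2 * (slope \<psi> - slope x) * Y x)"
        using Bp[OF Ix] Yx by (intro mult_right_mono) auto
      moreover have "(1 - t) * C * F \<psi> \<le> (1 - t) * C * (2 * W * (2 * Y x))"
        using 5 Yx W C t by (intro mult_left_mono order_trans[OF 5] mult_left_mono) auto
      ultimately have "b * (2 * (slope \<psi> - slope x) * Y x) \<le> (1 - t) * C * (2 * W * (2 * Y x))" by linarith
      then have "(2 * Y x) * (b * (slope \<psi> - slope x)) \<le> (2 * Y x) * ((1 - t) * C * (2 * W))" by (simp add: mult_ac)
      then have "b * (slope \<psi> - slope x) \<le> (1 - t) * C * (2 * W)" by (rule mult_left_le_imp_le) (use Yx in simp)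
      then have "slope \<psi> - slope x \<le> 2 * C / b * W * (1 - t)" using b by (simp add: field_simps)
      moreover have "1 - t = (\<psi> - x) / (\<psi> - \<phi>)" using t1 \<phi>\<psi> by (simp add: field_simps)
      ultimately show "slope \<psi> - slope x \<le> 2 * C / b * ((slope \<psi> - slope \<phi>) / (\<psi> - \<phi>)) * (\<psi> - x)"
        by (simp add: W_def)
    qed
  qed
qed

end

section \<open>Contradiction at a density point\<close>

context regular_norm begin

text \<open>Only two unit vectors are vertical, and \<open>uc\<close> is injective on a period. So
  almost every density point of \<open>Zset Nm\<close> has \<open>u1\<close> nonzero.\<close>

lemma finite_u1_zero: "finite {s \<in> {0..<2 * area (polar_set (unit_ball_of Nm))}. u1 s = 0}" (is "finite ?V")
proof (rule finite_imageD)
  define k where "k = Nm (0, 1)"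
  have "uc s \<in> {(0, 1 / k), (0, - (1 / k))}" if "s \<in> ?V" for s
  proof -
    have "uc s = u2 s *\<^sub>R (0, 1)" using that by (simp add: u1_def u2_def prod_eq_iff)
    then have "Nm (uc s) = \<bar>u2 s\<bar> * k" by (simp only: Nm_scale k_def)
    then have "\<bar>u2 s\<bar> * k = 1" by (simp add: Nm_uc)
    then have "\<bar>u2 s\<bar> = 1 / k" by (cases "k = 0") (auto simp: field_simps)
    then have "u2 s = 1 / k \<or> u2 s = - (1 / k)" by linarith
    then show ?thesis using that by (auto simp: u1_def u2_def prod_eq_iff)
  qed
  then have "uc ` ?V \<subseteq> {(0, 1 / k), (0, - (1 / k))}" by blast
  then show "finite (uc ` ?V)" by (rule finite_subset) simp
  show "inj_on uc ?V" by (intro inj_onI uc_inj) auto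
qed

text \<open>At a density point \<open>a\<close> of \<open>Zset Nm\<close> with \<open>u1 a \<noteq> 0\<close> the slope would have to be constant to the
  right of \<open>a\<close>.\<close>

lemma not_MCP:
  assumes Z: "0 < emeasure lebesgue (Zset Nm)" and N: "1 < N"
  shows "\<not> MCP (sf_dist Nm) lborel 0 N"
proof
  assume MCP: "MCP (sf_dist Nm) lborel 0 N"
  define A where "A = 2 * area (polar_set (unit_ball_of Nm))"
  have sets: "Zset Nm \<in> sets lebesgue" using Z emeasure_notin_sets by (metis less_irrefl)
  obtain M where M: "negligible M" "\<And>a \<epsilon>. a \<in> Zset Nm \<Longrightarrow> a \<notin> M \<Longrightarrow> \<epsilon> > 0 \<Longrightarrow>
     \<exists>d>0. \<forall>x. a < x \<longrightarrow> x < a + d \<longrightarrow> measure lebesgue ({a..x} - Zset Nm) \<le> \<epsilon> * (x - a)"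
    by (rule right_density_ae[OF sets]) blast
  have "negligible (M \<union> {s \<in> {0..<A}. u1 s = 0})"
    unfolding A_def by (rule negligible_Un[OF M(1) negligible_finite[OF finite_u1_zero]])
  then have "\<not> Zset Nm \<subseteq> M \<union> {s \<in> {0..<A}. u1 s = 0}"
    using negligible_subset negligible_iff_emeasure0[OF sets] Z by (metis less_irrefl)
  then obtain a where a: "a \<in> Zset Nm" "a \<notin> M" "u1 a \<noteq> 0" "0 < A" by (force simp: Zset_def A_def)
  define sg where "sg = sgn (u1 a)"
  define b where "b = \<bar>u1 a\<bar> / 2"
  have b: "b > 0" and sg: "sg = 1 \<or> sg = -1" "sg * u1 a = 2 * b" using a(3) by (auto simp: b_def sg_def sgn_if)
  have "isCont u1 a" using continuous_u(1)[of UNIV] by (simp add: continuous_on_eq_continuous_at)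
  then obtain \<delta>1 where \<delta>1: "\<delta>1 > 0" "\<And>s. dist s a < \<delta>1 \<Longrightarrow> dist (u1 s) (u1 a) < b"
    using b unfolding continuous_at_eps_delta by blast
  have u1b: "b \<le> sg * u1 s" if "\<bar>s - a\<bar> < \<delta>1" for s
  proof -
    have "\<bar>u1 s - u1 a\<bar> < b" using \<delta>1(2)[of s] that by (simp add: dist_real_def)
    then have "\<bar>sg * u1 s - sg * u1 a\<bar> < b" using sg(1) by auto
    then show ?thesis using sg(2) by linarith
  qed
  obtain \<delta>2 where \<delta>2: "\<delta>2 > 0" "\<And>s t. s < t \<Longrightarrow> t - s < \<delta>2 \<Longrightarrow> 0 \<le> u1 s * u2 t - u2 s * u1 t"
    using uc_cross_nonneg unfolding u1_def u2_def by metis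
  obtain \<kappa> where \<kappa>: "\<kappa> > 0" "\<And>v. norm v \<le> \<kappa> * Nm v" using norm_le_Nm by metis
  \<comment> \<open>At distance up to \<open>\<delta>\<close> from \<open>a\<close> the sign of
    \<open>u1\<close> is fixed by \<open>\<delta>1\<close>, while the interval of length
    \<open>2 * \<delta>\<close> is short enough for the cross product bound and shorter than a
    period.\<close>
  define \<delta> where "\<delta> = min (\<delta>1 / 2) (min (\<delta>2 / 3) (A / 3))"
  have \<delta>: "\<delta> > 0" "\<delta> < \<delta>1" "2 * \<delta> < \<delta>2" "2 * \<delta> < A"
    using \<delta>1(1) \<delta>2(1) a(4) by (auto simp: \<delta>_def min_def)
  \<comment> \<open>Arcs with angles within \<open>\<xi>\<close> of \<open>a\<close> must fit the
    margin \<open>\<delta> / 2\<close> of the chart: the choice gives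
    \<open>\<kappa> * (2 * \<xi>) \<le> b * \<delta> / 4\<close>.\<close>
  define \<xi> where "\<xi> = min (\<delta> / 2) (b * \<delta> / (8 * \<kappa>))"
  have "\<xi> * (8 * \<kappa>) \<le> b * \<delta>"
    using \<kappa>(1) by (simp add: \<xi>_def pos_le_divide_eq[symmetric])
  moreover have "\<kappa> * (2 * \<xi>) = \<xi> * (8 * \<kappa>) / 4" by simp
  ultimately have "\<kappa> * (2 * \<xi>) < b * (\<delta> / 2)" using mult_pos_pos[OF b \<delta>(1)] by linarith
  then have \<xi>: "0 < \<xi>" "\<xi> \<le> \<delta> / 2" "\<kappa> * (2 * \<xi>) < b * (\<delta> / 2)"
    using b \<delta>(1) \<kappa>(1) by (auto simp: \<xi>_def)
  interpret arc_chart Nm "a - \<delta>" "a + \<delta>" b sg \<kappa> "\<delta> / 2" "a - \<xi>" "a + \<xi>"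
  proof unfold_locales
    show "b \<le> sg * u1 s" if "s \<in> {a - \<delta>..a + \<delta>}" for s using that \<delta>(2) by (intro u1b) auto
    show "0 \<le> u1 s * u2 t - u2 s * u1 t" if "s \<in> {a - \<delta>..a + \<delta>}" "t \<in> {a - \<delta>..a + \<delta>}" "s < t" for s t
      using that \<delta>(3) by (intro \<delta>2(2)) auto
    show "a + \<delta> - (a - \<delta>) < 2 * area (polar_set (unit_ball_of Nm))" using \<delta>(4) unfolding A_def by simp
    show "\<kappa> * (a + \<xi> - (a - \<xi>)) < b * (\<delta> / 2)" using \<xi>(3) by simp
  qed (use b sg \<kappa> \<xi> in auto)
  obtain K where K: "K > 0" "\<And>\<phi> \<psi>. a - \<xi> < \<phi> \<Longrightarrow> \<phi> < \<psi> \<Longrightarrow> \<psi> < a + \<xi> \<Longrightarrow>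
    \<exists>\<delta>>0. \<forall>x. \<psi> - \<delta> < x \<longrightarrow> x < \<psi> \<longrightarrow> \<phi> \<le> x \<longrightarrow> slope \<psi> - slope x \<le> K * ((slope \<psi> - slope \<phi>) / (\<psi> - \<phi>)) * (\<psi> - x)"
    by (rule slope_Dini[OF MCP N]) blast
  \<comment> \<open>The required density depends on \<open>K\<close>, which is already fixed for the
    whole chart; so the interval can be shortened to \<open>{a..e}\<close> without changing the Dini
    constant.\<close>
  obtain \<delta>3 where \<delta>3: "\<delta>3 > 0" "\<And>x. a < x \<Longrightarrow> x < a + \<delta>3 \<Longrightarrow> measure lebesgue ({a..x} - Zset Nm) \<le> 1 / (2 * K) * (x - a)"
    using M(2)[OF a(1,2), of "1 / (2 * K)"] K(1) by auto
  define e where "e = a + min \<xi> \<delta>3 / 2"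
  have e: "a < e" "e < a + \<xi>" "e < a + \<delta>3" using \<xi>(1) \<delta>3(1) by (auto simp: e_def min_def)
  have I: "s \<in> {a - \<delta>..a + \<delta>}" if "a \<le> s" "s \<le> e" for s using that e \<xi> \<delta>(1) by auto
  define D where "D = 2 * \<kappa> / (b * b)"
  have D: "D > 0" using \<kappa>_pos b by (simp add: D_def)
  have slD: "\<bar>slope t - slope s\<bar> \<le> D * norm (uc t - uc s)" if "a \<le> s" "s \<le> e" "a \<le> t" "t \<le> e" for s t
    unfolding D_def by (intro slope_diff_le I that)
  obtain L where L: "L > 0" "\<And>s t. \<bar>fst (uc s) - fst (uc t)\<bar> \<le> L * \<bar>s - t\<bar>" "\<And>s t. \<bar>snd (uc s) - snd (uc t)\<bar> \<le> L * \<bar>s - t\<bar>"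
    using uc_Lipschitz by metis
  have "slope e \<le> slope a"
  proof (rule constant_of_Dini_and_density[OF less_imp_le[OF e(1)] K(1) _ sets])
    fix s t assume st: "a \<le> s" "s \<le> t" "t \<le> e"
    have "norm (uc t - uc s) \<le> 2 * L * (t - s)"
      using R2_norm_bounds(3)[of "uc t - uc s"] L(2,3)[of t s] st(2) by simp
    then have "D * norm (uc t - uc s) \<le> D * (2 * L * (t - s))" using D by simp
    then show "\<bar>slope t - slope s\<bar> \<le> D * (2 * L) * (t - s)" using slD[of s t] st by (simp add: mult.assoc)
  next
    fix z \<epsilon> :: real assume z: "z \<in> Zset Nm" "z \<in> {a..e}" "\<epsilon> > 0"
    obtain d where d: "d > 0" "\<And>t. \<bar>t - z\<bar> < d \<Longrightarrow> norm (uc t - uc z) \<le> \<epsilon> / D * \<bar>t - z\<bar>"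
      using Zset_stationary[OF z(1), of "\<epsilon> / D"] z(3) D by (metis divide_pos_pos)
    show "\<exists>d>0. \<forall>t. \<bar>t - z\<bar> < d \<longrightarrow> a \<le> t \<longrightarrow> t \<le> e \<longrightarrow> \<bar>slope t - slope z\<bar> \<le> \<epsilon> * \<bar>t - z\<bar>"
    proof (intro exI[of _ d] conjI allI impI d(1))
      fix t assume t: "\<bar>t - z\<bar> < d" "a \<le> t" "t \<le> e"
      have "\<bar>slope t - slope z\<bar> \<le> D * norm (uc t - uc z)" using t z(2) by (intro slD) auto
      also have "\<dots> \<le> D * (\<epsilon> / D * \<bar>t - z\<bar>)" using d(2)[OF t(1)] D by (intro mult_left_mono) auto
      also have "\<dots> = \<epsilon> * \<bar>t - z\<bar>" using D by simp
      finally show "\<bar>slope t - slope z\<bar> \<le> \<epsilon> * \<bar>t - z\<bar>" .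
    qed
  next
    fix x assume "a < x" "x \<le> e"
    then show "measure lebesgue ({a..x} - Zset Nm) \<le> (x - a) / (2 * K)" using \<delta>3(2)[of x] e by simp
  next
    fix p assume "a < p" "p \<le> e"
    then show "\<exists>d>0. \<forall>x. p - d < x \<longrightarrow> x < p \<longrightarrow> a \<le> x \<longrightarrow> slope p - slope x \<le> K * ((slope p - slope a) / (p - a)) * (p - x)"
      using \<xi>(1) e by (intro K(2)) auto
  qed
  moreover have "slope a < slope e" using e by (intro slope_strict_mono I) auto
  ultimately show False by simp
qed

end

theorem theorem5p3:
  fixes Nm :: "real \<times> real \<Rightarrow> real" and N :: real
  assumes "is_norm Nm" and "norm_C1 Nm" and "norm_strongly_convex Nm"
    and "0 < emeasure lebesgue (Zset Nm)"
    and "1 < N"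
  shows "\<not> MCP (sf_dist Nm) (lborel :: (real \<times> real \<times> real) measure) 0 N"
proof -
  interpret regular_norm Nm by unfold_locales (use assms in auto)
  show ?thesis by (rule not_MCP[OF assms(4,5)])
qed

end
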